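(* Let $Z=(X,Y)$ be a pairwise Markov model. Let $\mu$ be strictly positive (i.e. $\mu(O)>0$ for every non-empty open $O\subset\mathcal X$) and suppose that for every $i,j\in\mathcal Y$ the function $(x,x')\mapsto q(x,i|x',j)$ on $\mathcal X^2$ is lower semi-continuous and bounded. Suppose $Z$ satisfies the following two conditions. **B1.** There exists an open set $E\subset\mathcal X^{l}$, for some $l\ge2$, such that $\mathcal Y^+:=\mathcal Y^+(x)$ is the same for every $x\in E$ and satisfies: $(i,j)\in\mathcal Y^+$ for every $i\in\mathcal Y^+_{(1)}$ and $j\in\mathcal Y^+_{(2)}$. Furthermore, there exists a reachable point $(x_E,i_E)$ in $E_{(1)}\times\mathcal Y^+_{(1)}$. **B2.** For arbitrary $N\ge2$ there exists a strong center part of a barrier set, $\mathcal X^*_{(n_1,n_{2N+1})}$, which is open, non-empty and has $2N$ cycles. Both the set $\mathcal X^*_{(n_1)}$ and the parameter $\epsilon$ of condition A1 are independent of $N$, and there exists a compact set $K\subset\mathcal X$, independent of $N$, such that $\mathcal X^*_{(n_{2N+1})}\subset K$. Furthermore, there exists $x^*\in\mathcal X^*_{(n_1)}$ such that $(x^*,1)$ is reachable. Then there exists a set $\mathcal X^*$ (together with $N$, $n_1<\dots<n_{2N+2}$, $\epsilon$, $\delta$, $\Delta$) satisfying conditions A1', A2 and A3. Moreover, if $Z$ is Harris recurrent, then $P(X\in\mathcal X^*\text{ i.o.})=1$.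
   Context: Pairwise Markov model. $\mathcal X$ is a separable metric space with Borel $\sigma$-field $\mathcal B(\mathcal X)$; $\mathcal Y=\{1,\dots,|\mathcal Y|\}$ is finite; $\mathcal Z=\mathcal X\times\mathcal Y$ has the product topology ($\mathcal Y$ discrete) and Borel $\sigma$-field $\mathcal B(\mathcal Z)=\mathcal B(\mathcal X)\otimes2^{\mathcal Y}$. $\mu$ is a $\sigma$-finite measure on $\mathcal B(\mathcal X)$ and $c$ is counting measure on $\mathcal Y$. $q:\mathcal Z^2\to[0,\infty)$, $(z,z')\mapsto q(z|z')$, is measurable and for each $z'\in\mathcal Z$ the function $z\mapsto q(z|z')$ is a probability density with respect to $\mu\times c$. $Z=\{Z_k\}_{k\ge1}=\{(X_k,Y_k)\}_{k\ge1}$ is a homogeneous Markov chain on $\mathcal Z$ with transition kernel $P(Z_2\in A|Z_1=z')=\int_A q(z|z')\,\mu\times c(dz)$, whose initial distribution has a density with respect to the product of some $\sigma$-finite measure on $\mathcal B(\mathcal X)$ and $c$. $X=\{X_k\}$, $Y=\{Y_k\}$. Write $x_{k:l}=(x_k,\dots,x_l)$. For $n\ge2$, $x_{1:n}\in\mathcal X^n$, $i,j\in\mathcal Y$: $$p_{ij}(x_{1:n})=\max_{y_{1:n}:\,y_1=i,\,y_n=j}\ \prod_{k=2}^n q(x_k,y_k|x_{k-1},y_{k-1}),\qquad \mathcal Y^+(x_{1:n})=\{(i,j)\in\mathcal Y^2:\ p_{ij}(x_{1:n})>0\}.$$ For a set $A$ of vectors of length $n$: $A_{(k)}=\{x_k: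 x_{1:n}\in A\}$, $A_{(k,l)}=\{x_{k:l}:x_{1:n}\in A\}$; in particular $\mathcal Y^+_{(1)},\mathcal Y^+_{(2)}$ are the sets of first and second coordinates of pairs in $\mathcal Y^+$. Condition **A1** (for $N\ge2$, positive integers $n_1<\cdots<n_{2N+2}$, $\mathcal X^*\subset\mathcal X^{n_{2N+2}}$, $\epsilon>0$): for all $k=1,\dots,2N$ and all $x\in\mathcal X^*_{(n_k,n_{k+1})}$: (a) $p_{11}(x)\ge p_{i1}(x)$ for all $i\in\mathcal Y$; (b) $p_{11}(x)\ge p_{1i}(x)$ for all $i\in\mathcal Y$; (c) $p_{11}(x)(1-\epsilon)>p_{ij}(x)$ for all $i,j\in\mathcal Y\setminus\{1\}$. Condition **A1'**: A1 holds with either the inequalities (a) or the inequalities (b) being strict for all $i\ne1$. Condition **A2** (here $n_1\ge2$): there are constants $0<\delta\le\Delta<\infty$ such that $p_{ij}(x)\le\Delta$ for all $i,j\in\mathcal Y$ and $x\in\mathcal X^*_{(1,n_1)}\cup\mathcal X^*_{(n_{2N+1},n_{2N+2})}$; for all $x\in\mathcal X^*_{(1,n_1)}$, $\mathcal Y^+(x)\ne\emptyset$ and $p_{i1}(x)\ge\delta$ for all $i\in\mathcal Y^+(x)_{(1)}$; for all $x\in\mathcal X^*_{(n_{2N+1},n_{2N+2})}$, $\mathcal Y^+(x)\ne\emptyset$ and $p_{1j}(x)\ge\delta$ for all $j\in\mathcal Y^+(x)_{(2)}$. Condition **A3**: $\frac{\Delta}{\delta}(1-\epsilon)^N<1$.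 If $\mathcal X^*$ satisfies A1', then $\mathcal X^*_{(n_1,n_{2N+1})}$ is called a strong center part of a barrier set; it has $2N$ cycles (the blocks from $n_k$ to $n_{k+1}$, $k=1,\dots,2N$). Thus whether a set is a strong center part depends only on the section of $\mathcal X^*$ between $n_1$ and $n_{2N+1}$. A point $z\in\mathcal Z$ is reachable if for every open neighbourhood $O$ of $z$, $\sum_{k\ge2}P(Z_k\in O|Z_1=z')>0$ for all $z'\in\mathcal Z$. $Z$ is $\varphi$-irreducible for a $\sigma$-finite measure $\varphi$ on $\mathcal B(\mathcal Z)$ if $\varphi(A)>0$ implies $\sum_{k\ge2}P(Z_k\in A|Z_1=z)>0$ for all $z\in\mathcal Z$; $\psi$ denotes a maximal irreducibility measure (one dominating, in the sense of absolute continuity, every irreducibility measure). $Z$ is Harris recurrent if it is $\psi$-irreducible and $\psi(A)>0$ implies $P(Z_k\in A\text{ i.o.}|Z_1=z)=1$ for all $z\in\mathcal Z$. For $\mathcal X^*\subset\mathcal X^M$: $\{X\in\mathcal X^*\text{ i.o.}\}=\bigcap_{k\ge1}\bigcup_{l\ge k}\{X_{l:l+M-1}\in\mathcal X^*\}$. *)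

theory Defs
  imports "HOL-Probability.Probability"
begin

text \<open>
  The state space is \<open>UNIV \<times> {1..m}\<close> over the type \<open>'x \<times> nat\<close>, where the separable metric space
  is the type \<open>'x\<close> (a metric space is separable iff it is second countable) and \<open>m\<close> is the number
  of labels. The topology of \<open>nat\<close> is discrete, and \<open>UNIV \<times> {1..m}\<close> is open in \<open>'x \<times> nat\<close>.
  The transition density is written \<open>q z z'\<close> for $q(z|z')$: the new state comes first.
\<close>

definition state_algebra :: "nat \<Rightarrow> ('x::{metric_space, second_countable_topology} \<times> nat) measure"
  where "state_algebra m = borel \<Otimes>\<^sub>M count_space {1..m}"

definition trans_kernel ::
  "'x::{metric_space, second_countable_topology} measure \<Rightarrow> nat \<Rightarrow> ('x \<times> nat \<Rightarrow> 'x \<times> nat \<Rightarrow> real)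
    \<Rightarrow> 'x \<times> nat \<Rightarrow> ('x \<times> nat) measure"
  where "trans_kernel \<mu> m q z' = density (\<mu> \<Otimes>\<^sub>M count_space {1..m}) (\<lambda>z. ennreal (q z z'))"

locale pairwise_markov_model =
  prob_space \<Omega> + mu: sigma_finite_measure \<mu>
  for \<Omega> :: "'w measure"
    and \<mu> :: "'x::{metric_space, second_countable_topology} measure" +
  fixes m :: nat
    and q :: "'x \<times> nat \<Rightarrow> 'x \<times> nat \<Rightarrow> real"
    and Z :: "nat \<Rightarrow> 'w \<Rightarrow> 'x \<times> nat"
  assumes m_pos: "m \<ge> 1"
    and sets_mu: "sets \<mu> = sets borel"
    and q_nonneg: "\<And>z z'. z \<in> space (state_algebra m) \<Longrightarrow> z' \<in> space (state_algebra m) \<Longrightarrow> 0 \<le> q z z'"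
    and q_measurable:
      "(\<lambda>(z, z'). q z z') \<in> borel_measurable (state_algebra m \<Otimes>\<^sub>M state_algebra m)"
    and q_density: "\<And>z'. z' \<in> space (state_algebra m) \<Longrightarrow>
      (\<integral>\<^sup>+ z. ennreal (q z z') \<partial>(\<mu> \<Otimes>\<^sub>M count_space {1..m})) = 1"
    and Z_measurable: "\<And>k. k \<ge> 1 \<Longrightarrow> Z k \<in> measurable \<Omega> (state_algebra m)"
    and Z_initial: "\<exists>\<nu> f. sigma_finite_measure \<nu> \<and> sets \<nu> = sets borel \<and>
      f \<in> borel_measurable (\<nu> \<Otimes>\<^sub>M count_space {1..m}) \<and>
      distr \<Omega> (state_algebra m) (Z 1) = density (\<nu> \<Otimes>\<^sub>M count_space {1..m}) f"
    \<comment> \<open>the Markov property with respect to the \<open>\<sigma>\<close>-field generated by \<open>Z 1, \<dots>, Z k\<close>\<close>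
    and Z_markov: "\<And>k A. k \<ge> 1 \<Longrightarrow> A \<in> sets (state_algebra m) \<Longrightarrow>
      AE \<omega> in \<Omega>.
        real_cond_exp \<Omega>
          (vimage_algebra (space \<Omega>) (\<lambda>\<omega>. \<lambda>i\<in>{1..k}. Z i \<omega>) (\<Pi>\<^sub>M i\<in>{1..k}. state_algebra m))
          (\<lambda>\<omega>. indicator A (Z (k + 1) \<omega>)) \<omega>
        = measure (trans_kernel \<mu> m q (Z k \<omega>)) A"

text \<open>
  The law of the chain started at \<open>z\<close>, i.e. $P(\,\cdot\,|Z_1=z)$, as the Ionescu-Tulcea measure on
  path space. Paths are indexed from 0, so coordinate \<open>i\<close> of a path is $Z_{i+1}$.
\<close>
definition chain_law ::
  "'x::{metric_space, second_countable_topology} measure \<Rightarrow> nat \<Rightarrow> ('x \<times> nat \<Rightarrow> 'x \<times> nat \<Rightarrow> real)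
    \<Rightarrow> 'x \<times> nat \<Rightarrow> (nat \<Rightarrow> 'x \<times> nat) measure"
  where "chain_law \<mu> m q z =
    projective_family.lim UNIV
      (Ionescu_Tulcea.CI
        (\<lambda>i \<omega>. case i of 0 \<Rightarrow> return (state_algebra m) z | Suc j \<Rightarrow> trans_kernel \<mu> m q (\<omega> j))
        (\<lambda>_. state_algebra m))
      (\<lambda>_. state_algebra m)"

text \<open>$P(Z_k \in A|Z_1=z)$ for \<open>k \<ge> 1\<close>\<close>
definition step_prob ::
  "'x::{metric_space, second_countable_topology} measure \<Rightarrow> nat \<Rightarrow> ('x \<times> nat \<Rightarrow> 'x \<times> nat \<Rightarrow> real)
    \<Rightarrow> nat \<Rightarrow> 'x \<times> nat \<Rightarrow> ('x \<times> nat) set \<Rightarrow> ennreal"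
  where "step_prob \<mu> m q k z A =
    emeasure (chain_law \<mu> m q z) {\<omega> \<in> space (chain_law \<mu> m q z). \<omega> (k - 1) \<in> A}"

definition reachable ::
  "'x::{metric_space, second_countable_topology} measure \<Rightarrow> nat \<Rightarrow> ('x \<times> nat \<Rightarrow> 'x \<times> nat \<Rightarrow> real)
    \<Rightarrow> 'x \<times> nat \<Rightarrow> bool"
  where "reachable \<mu> m q z \<longleftrightarrow> z \<in> space (state_algebra m) \<and>
    (\<forall>G. open G \<and> G \<subseteq> space (state_algebra m) \<and> z \<in> G \<longrightarrow>
      (\<forall>z'\<in>space (state_algebra m). (\<Sum>k. step_prob \<mu> m q (k + 2) z' G) > 0))"

definition irreducible_wrt ::
  "'x::{metric_space, second_countable_topology} measure \<Rightarrow> nat \<Rightarrow> ('x \<times> nat \<Rightarrow> 'x \<times> nat \<Rightarrow> real)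
    \<Rightarrow> ('x \<times> nat) measure \<Rightarrow> bool"
  where "irreducible_wrt \<mu> m q \<phi> \<longleftrightarrow>
    sigma_finite_measure \<phi> \<and> sets \<phi> = sets (state_algebra m) \<and>
    (\<forall>A\<in>sets (state_algebra m). emeasure \<phi> A > 0 \<longrightarrow>
      (\<forall>z\<in>space (state_algebra m). (\<Sum>k. step_prob \<mu> m q (k + 2) z A) > 0))"

definition maximal_irreducibility_measure ::
  "'x::{metric_space, second_countable_topology} measure \<Rightarrow> nat \<Rightarrow> ('x \<times> nat \<Rightarrow> 'x \<times> nat \<Rightarrow> real)
    \<Rightarrow> ('x \<times> nat) measure \<Rightarrow> bool"
  where "maximal_irreducibility_measure \<mu> m q \<psi> \<longleftrightarrow>
    irreducible_wrt \<mu> m q \<psi> \<and>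
    (\<forall>\<phi>. irreducible_wrt \<mu> m q \<phi> \<longrightarrow> absolutely_continuous \<psi> \<phi>)"

definition harris_recurrent ::
  "'x::{metric_space, second_countable_topology} measure \<Rightarrow> nat \<Rightarrow> ('x \<times> nat \<Rightarrow> 'x \<times> nat \<Rightarrow> real)
    \<Rightarrow> bool"
  where "harris_recurrent \<mu> m q \<longleftrightarrow>
    (\<exists>\<psi>. maximal_irreducibility_measure \<mu> m q \<psi> \<and>
      (\<forall>A\<in>sets (state_algebra m). emeasure \<psi> A > 0 \<longrightarrow>
        (\<forall>z\<in>space (state_algebra m).
          emeasure (chain_law \<mu> m q z)
            {\<omega> \<in> space (chain_law \<mu> m q z). \<exists>\<^sub>\<infinity>k. \<omega> k \<in> A} = 1)))"

text \<open>
  A vector $x_{1:n}$ is an element of \<open>{1..n} \<rightarrow>\<^sub>E UNIV\<close>, so that $\mathcal X^n$ carries the library's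
  product topology.
\<close>

abbreviation power_topology :: "nat \<Rightarrow> (nat \<Rightarrow> 'x::topological_space) topology"
  where "power_topology n \<equiv> product_topology (\<lambda>_. euclidean) {1..n}"

definition coord :: "(nat \<Rightarrow> 'x) set \<Rightarrow> nat \<Rightarrow> 'x set"
  where "coord A k = (\<lambda>x. x k) ` A"

text \<open>$A_{(k,l)}$; its elements are again indexed from 1, with length \<open>l + 1 - k\<close>.\<close>
definition slice :: "(nat \<Rightarrow> 'x) set \<Rightarrow> nat \<Rightarrow> nat \<Rightarrow> (nat \<Rightarrow> 'x) set"
  where "slice A k l = (\<lambda>x. \<lambda>i\<in>{1..l + 1 - k}. x (k + i - 1)) ` A"

text \<open>$p_{ij}(x_{1:n})$ for \<open>n \<ge> 2\<close>\<close>
definition pmax ::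
  "nat \<Rightarrow> ('x \<times> nat \<Rightarrow> 'x \<times> nat \<Rightarrow> real) \<Rightarrow> nat \<Rightarrow> (nat \<Rightarrow> 'x) \<Rightarrow> nat \<Rightarrow> nat \<Rightarrow> real"
  where "pmax m q n x i j =
    Max ((\<lambda>y. \<Prod>k=2..n. q (x k, y k) (x (k - 1), y (k - 1))) `
      {y \<in> {1..n} \<rightarrow>\<^sub>E {1..m}. y 1 = i \<and> y n = j})"

definition Yplus ::
  "nat \<Rightarrow> ('x \<times> nat \<Rightarrow> 'x \<times> nat \<Rightarrow> real) \<Rightarrow> nat \<Rightarrow> (nat \<Rightarrow> 'x) \<Rightarrow> (nat \<times> nat) set"
  where "Yplus m q n x = {(i, j) \<in> {1..m} \<times> {1..m}. pmax m q n x i j > 0}"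

definition cond_A1 ::
  "nat \<Rightarrow> ('x \<times> nat \<Rightarrow> 'x \<times> nat \<Rightarrow> real) \<Rightarrow> nat \<Rightarrow> (nat \<Rightarrow> nat) \<Rightarrow> real \<Rightarrow> (nat \<Rightarrow> 'x) set \<Rightarrow> bool"
  where "cond_A1 m q N n \<epsilon> Xs \<longleftrightarrow>
    N \<ge> 2 \<and> n 1 \<ge> 1 \<and> strict_mono_on {1..2 * N + 2} n \<and>
    Xs \<subseteq> {1..n (2 * N + 2)} \<rightarrow>\<^sub>E UNIV \<and> \<epsilon> > 0 \<and>
    (\<forall>k\<in>{1..2 * N}. \<forall>x\<in>slice Xs (n k) (n (k + 1)).
      let p = pmax m q (n (k + 1) + 1 - n k) x in
        (\<forall>i\<in>{1..m}. p 1 1 \<ge> p i 1) \<and>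
        (\<forall>i\<in>{1..m}. p 1 1 \<ge> p 1 i) \<and>
        (\<forall>i\<in>{1..m} - {1}. \<forall>j\<in>{1..m} - {1}. p 1 1 * (1 - \<epsilon>) > p i j))"

definition cond_A1' ::
  "nat \<Rightarrow> ('x \<times> nat \<Rightarrow> 'x \<times> nat \<Rightarrow> real) \<Rightarrow> nat \<Rightarrow> (nat \<Rightarrow> nat) \<Rightarrow> real \<Rightarrow> (nat \<Rightarrow> 'x) set \<Rightarrow> bool"
  where "cond_A1' m q N n \<epsilon> Xs \<longleftrightarrow> cond_A1 m q N n \<epsilon> Xs \<and>
    ((\<forall>k\<in>{1..2 * N}. \<forall>x\<in>slice Xs (n k) (n (k + 1)).
        let p = pmax m q (n (k + 1) + 1 - n k) x in \<forall>i\<in>{1..m} - {1}. p 1 1 > p i 1) \<or>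
     (\<forall>k\<in>{1..2 * N}. \<forall>x\<in>slice Xs (n k) (n (k + 1)).
        let p = pmax m q (n (k + 1) + 1 - n k) x in \<forall>i\<in>{1..m} - {1}. p 1 1 > p 1 i))"

definition cond_A2 ::
  "nat \<Rightarrow> ('x \<times> nat \<Rightarrow> 'x \<times> nat \<Rightarrow> real) \<Rightarrow> nat \<Rightarrow> (nat \<Rightarrow> nat) \<Rightarrow> real \<Rightarrow> real
    \<Rightarrow> (nat \<Rightarrow> 'x) set \<Rightarrow> bool"
  where "cond_A2 m q N n \<delta> \<Delta> Xs \<longleftrightarrow>
    n 1 \<ge> 2 \<and> 0 < \<delta> \<and> \<delta> \<le> \<Delta> \<and>
    (\<forall>x\<in>slice Xs 1 (n 1).
      let p = pmax m q (n 1) x; Yp = Yplus m q (n 1) x in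
        (\<forall>i\<in>{1..m}. \<forall>j\<in>{1..m}. p i j \<le> \<Delta>) \<and> Yp \<noteq> {} \<and> (\<forall>i\<in>fst ` Yp. p i 1 \<ge> \<delta>)) \<and>
    (\<forall>x\<in>slice Xs (n (2 * N + 1)) (n (2 * N + 2)).
      let L = n (2 * N + 2) + 1 - n (2 * N + 1); p = pmax m q L x; Yp = Yplus m q L x in
        (\<forall>i\<in>{1..m}. \<forall>j\<in>{1..m}. p i j \<le> \<Delta>) \<and> Yp \<noteq> {} \<and> (\<forall>j\<in>snd ` Yp. p 1 j \<ge> \<delta>))"

definition cond_A3 :: "nat \<Rightarrow> real \<Rightarrow> real \<Rightarrow> real \<Rightarrow> bool"
  where "cond_A3 N \<epsilon> \<delta> \<Delta> \<longleftrightarrow> \<Delta> / \<delta> * (1 - \<epsilon>) ^ N < 1"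

text \<open>\<open>C\<close> is the strong center part, with \<open>2 * N\<close> cycles, of the set \<open>Xs\<close>.\<close>
definition strong_center_part ::
  "nat \<Rightarrow> ('x \<times> nat \<Rightarrow> 'x \<times> nat \<Rightarrow> real) \<Rightarrow> nat \<Rightarrow> (nat \<Rightarrow> nat) \<Rightarrow> real \<Rightarrow> (nat \<Rightarrow> 'x) set
    \<Rightarrow> (nat \<Rightarrow> 'x) set \<Rightarrow> bool"
  where "strong_center_part m q N n \<epsilon> Xs C \<longleftrightarrow>
    cond_A1' m q N n \<epsilon> Xs \<and> C = slice Xs (n 1) (n (2 * N + 1))"

definition cond_B1 ::
  "'x::{metric_space, second_countable_topology} measure \<Rightarrow> nat \<Rightarrow> ('x \<times> nat \<Rightarrow> 'x \<times> nat \<Rightarrow> real)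
    \<Rightarrow> bool"
  where "cond_B1 \<mu> m q \<longleftrightarrow>
    (\<exists>l\<ge>2. \<exists>E Yp. openin (power_topology l) E \<and>
      (\<forall>x\<in>E. Yplus m q l x = Yp) \<and>
      (\<forall>i\<in>fst ` Yp. \<forall>j\<in>snd ` Yp. (i, j) \<in> Yp) \<and>
      (\<exists>xE iE. xE \<in> coord E 1 \<and> iE \<in> fst ` Yp \<and> reachable \<mu> m q (xE, iE)))"

text \<open>
  \<open>S\<close> is the set $\mathcal X^*_{(n_1)}$; like \<open>\<epsilon>\<close> and \<open>K\<close> it is chosen before \<open>N\<close>.
\<close>
definition cond_B2 ::
  "'x::{metric_space, second_countable_topology} measure \<Rightarrow> nat \<Rightarrow> ('x \<times> nat \<Rightarrow> 'x \<times> nat \<Rightarrow> real)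
    \<Rightarrow> bool"
  where "cond_B2 \<mu> m q \<longleftrightarrow>
    (\<exists>\<epsilon> S K. compact K \<and>
      (\<forall>N\<ge>2. \<exists>n Xs C. strong_center_part m q N n \<epsilon> Xs C \<and>
        openin (power_topology (n (2 * N + 1) + 1 - n 1)) C \<and> C \<noteq> {} \<and>
        coord Xs (n 1) = S \<and> coord Xs (n (2 * N + 1)) \<subseteq> K) \<and>
      (\<exists>x\<in>S. reachable \<mu> m q (x, 1)))"

text \<open>The textbook \<open>\<epsilon>\<close>-neighbourhood form of lower semi-continuity.\<close>
definition lower_semicontinuous :: "('a::topological_space \<Rightarrow> real) \<Rightarrow> bool"
  where "lower_semicontinuous f \<longleftrightarrow> (\<forall>a. \<forall>t<f a. \<forall>\<^sub>F x in nhds a. t < f x)"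

definition strictly_positive_measure :: "'a::topological_space measure \<Rightarrow> bool"
  where "strictly_positive_measure \<mu> \<longleftrightarrow> (\<forall>G. open G \<and> G \<noteq> {} \<longrightarrow> emeasure \<mu> G > 0)"

text \<open>$\{X \in \mathcal X^*\ \mathrm{i.o.}\}$ for $\mathcal X^* \subseteq \mathcal X^M$, with $X_k$ the first component of $Z_k$\<close>
definition io_event ::
  "'w measure \<Rightarrow> (nat \<Rightarrow> 'w \<Rightarrow> 'x \<times> nat) \<Rightarrow> nat \<Rightarrow> (nat \<Rightarrow> 'x) set \<Rightarrow> 'w set"
  where "io_event \<Omega> Z M Xs =
    (\<Inter>k\<in>{1..}. \<Union>l\<in>{k..}. {\<omega> \<in> space \<Omega>. (\<lambda>i\<in>{1..M}. fst (Z (l + i - 1) \<omega>)) \<in> Xs})"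

end

theory Submission
  imports Defs
begin

text \<open>
  The set is found as an open box around one well-chosen trajectory. A labelled walk with positive
  densities along this trajectory is made of three pieces. The first piece starts at the reachable
  point \<open>(x\<^sub>E, i\<^sub>E)\<close>, runs through \<open>E\<close> and then walks, by reachability of \<open>(x\<^sup>*, 1)\<close>, to a point near
  \<open>x\<^sup>*\<close> with label 1, at which the center begins. The second piece runs through the center with label 1 at the ends of all cycles.
  The third one walks back from the end of the center to \<open>E\<close>. The rectangle property of \<open>\<Y>\<^sup>+\<close> on \<open>E\<close>
  turns one positive walk into walks between label 1 and all labels that A2 speaks of
  (\<open>entrance_exists\<close>, \<open>departure_exists\<close>), and lower semi-continuity keeps finitely many such walks above
  a common \<open>\<delta> > 0\<close> on a neighbourhood of the trajectory (\<open>linked_stable_finite\<close>). Boundedness of the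
  density gives \<open>\<Delta>\<close>. The constants must not depend on \<open>N\<close>, although the end of the center does; since
  it stays in a compact set, finitely many third pieces suffice, and afterwards \<open>N\<close> is chosen so large
  that A3 holds (\<open>barrier_exists_several_labels\<close>). All conditions pass to subsets, so one may shrink to
  a box (\<open>barrier_assembly\<close>). If there is only one label, the center conditions are vacuous and do not
  yield positive walks; this case is treated directly (\<open>barrier_exists_single_label\<close>).

  The box is visited infinitely often for the following reason. It consists of open sets around a
  positive walk that starts at a reachable point, so lower semi-continuity and strict positivity of
  \<open>\<mu>\<close> make the probability of running through it positive from a neighbourhood of that point, hence
  from everywhere after a delay. Countably many sets, each with a fixed delay and a uniform lower
  bound for this probability, cover the state space, so a maximal irreducibility measure, which is
  nonzero, charges one of them. Harris recurrence makes the chain return to that set infinitely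
  often, and a conditional Borel-Cantelli argument (\<open>never_after_geometric\<close>) makes one of the resulting
  attempts succeed after every time (\<open>box_visited_infinitely_often\<close>). Harris recurrence is a statement
  about the canonical chain, and it is carried over to \<open>Z\<close> through path probabilities of the kernel
  (\<open>emeasure_occurs\<close>, \<open>AE_hits_infinitely_often\<close>).
\<close>

section \<open>Path probabilities of a Markov kernel\<close>

text \<open>
  The probability that the first \<open>n\<close> positions of the chain started at \<open>z\<close>, position 0 being \<open>z\<close>
  itself, lie in \<open>A 0, \<dots>, A (n - 1)\<close>. It is defined by recursion through the kernel, so that the
  model and the canonical chain can be compared without comparing measures on path space.
\<close>
primrec path_prob :: "('a \<Rightarrow> 'a measure) \<Rightarrow> nat \<Rightarrow> (nat \<Rightarrow> 'a set) \<Rightarrow> 'a \<Rightarrow> ennreal"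
  where
    "path_prob \<kappa> 0 A z = 1"
  | "path_prob \<kappa> (Suc n) A z =
       indicator (A 0) z * (\<integral>\<^sup>+ w. path_prob \<kappa> n (\<lambda>i. A (Suc i)) w \<partial>\<kappa> z)"

lemma path_prob_cong:
  assumes "\<And>i. i < n \<Longrightarrow> A i = B i"
  shows "path_prob \<kappa> n A z = path_prob \<kappa> n B z"
  using assms
proof (induction n arbitrary: A B z)
  case (Suc n)
  have "path_prob \<kappa> n (\<lambda>i. A (Suc i)) w = path_prob \<kappa> n (\<lambda>i. B (Suc i)) w" for w
    by (rule Suc.IH) (use Suc.prems in auto)
  then show ?case
    using Suc.prems[of 0] by simp
qed simp

locale markov_kernel =
  fixes S :: "'a measure" and \<kappa> :: "'a \<Rightarrow> 'a measure"
  assumes kernel [measurable]: "\<kappa> \<in> S \<rightarrow>\<^sub>M prob_algebra S"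
begin

lemma kernel_subprob [measurable]: "\<kappa> \<in> S \<rightarrow>\<^sub>M subprob_algebra S"
  using kernel by (rule measurable_prob_algebraD)

lemma
  assumes "z \<in> space S"
  shows prob_space_kernel: "prob_space (\<kappa> z)"
    and sets_kernel: "sets (\<kappa> z) = sets S"
    and space_kernel: "space (\<kappa> z) = space S"
proof -
  have "\<kappa> z \<in> space (prob_algebra S)"
    using kernel assms by (rule measurable_space)
  then show "prob_space (\<kappa> z)" "sets (\<kappa> z) = sets S"
    by (auto simp: space_prob_algebra)
  then show "space (\<kappa> z) = space S"
    by (intro sets_eq_imp_space_eq)
qed

lemma kernel_integral_measurable [measurable]:
  assumes "\<phi> \<in> borel_measurable S"
  shows "(\<lambda>z. \<integral>\<^sup>+ w. \<phi> w \<partial>\<kappa> z) \<in> borel_measurable S"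
  using measurable_compose[OF kernel_subprob nn_integral_measurable_subprob_algebra[OF assms]] .

lemma path_prob_measurable:
  assumes "\<And>i. A i \<in> sets S"
  shows "path_prob \<kappa> n A \<in> borel_measurable S"
  using assms
proof (induction n arbitrary: A)
  case 0
  show ?case by simp
next
  case (Suc n)
  have [measurable]: "path_prob \<kappa> n (\<lambda>i. A (Suc i)) \<in> borel_measurable S" "A 0 \<in> sets S"
    using Suc by auto
  show ?case
    unfolding path_prob.simps by measurable
qed

lemma path_prob_le_1:
  assumes "z \<in> space S"
  shows "path_prob \<kappa> n A z \<le> 1"
  using assms
proof (induction n arbitrary: A z)
  case (Suc n)
  interpret k: prob_space "\<kappa> z" using Suc.prems by (rule prob_space_kernel)
  have "(\<integral>\<^sup>+ w. path_prob \<kappa> n (\<lambda>i. A (Suc i)) w \<partial>\<kappa> z) \<le> (\<integral>\<^sup>+ w. 1 \<partial>\<kappa> z)"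
    by (rule nn_integral_mono) (use Suc in \<open>auto simp: space_kernel\<close>)
  also have "\<dots> = 1" by (simp add: k.emeasure_space_1)
  finally show ?case
    by (auto simp: indicator_def)
qed simp

text \<open>
  A chain that reaches \<open>A k\<close> with positive probability, and that can follow \<open>B\<close> from every point of
  \<open>A k\<close>, can do both in a row: otherwise the continuation would vanish almost surely after the first
  step, and by induction so would the probability of reaching \<open>A k\<close>.
\<close>
lemma path_prob_pos_append:
  assumes A: "\<And>i. A i \<in> sets S" and B: "\<And>i. B i \<in> sets S" and z: "z \<in> space S"
    and pos: "0 < path_prob \<kappa> (Suc k) A z"
    and cont: "\<And>w. w \<in> A k \<Longrightarrow> 0 < path_prob \<kappa> n B w"
  shows "0 < path_prob \<kappa> (k + n) (\<lambda>i. if i < k then A i else B (i - k)) z"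
  using A z pos cont
proof (induction k arbitrary: A z)
  case 0
  from 0 have "z \<in> A 0"
    by (cases "z \<in> A 0") auto
  with 0 show ?case by simp
next
  case (Suc k)
  let ?A = "\<lambda>i. A (Suc i)"
  let ?C = "\<lambda>i. if i < k then ?A i else B (i - k)"
  have meas [measurable]: "path_prob \<kappa> n' ?A \<in> borel_measurable S"
    "path_prob \<kappa> n' ?C \<in> borel_measurable S" for n'
    using Suc.prems(1) B by (auto intro!: path_prob_measurable)
  have "z \<in> A 0"
    using Suc.prems(3) by (cases "z \<in> A 0") simp_all
  moreover from this have "0 < (\<integral>\<^sup>+ w. path_prob \<kappa> (Suc k) ?A w \<partial>\<kappa> z)"
    using Suc.prems(3) unfolding path_prob.simps(2)[of _ "Suc k"] by (simp del: path_prob.simps)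
  moreover have "(\<integral>\<^sup>+ w. path_prob \<kappa> (Suc k) ?A w \<partial>\<kappa> z) = 0"
    if "(\<integral>\<^sup>+ w. path_prob \<kappa> (k + n) ?C w \<partial>\<kappa> z) = 0"
  proof -
    have mz: "f \<in> borel_measurable (\<kappa> z)" if "f \<in> borel_measurable S" for f :: "_ \<Rightarrow> ennreal"
      using that sets_kernel[OF Suc.prems(2)] by (simp cong: measurable_cong_sets)
    have "AE w in \<kappa> z. path_prob \<kappa> (k + n) ?C w = 0"
      using that by (subst (asm) nn_integral_0_iff_AE) (auto intro!: mz meas)
    then have "AE w in \<kappa> z. path_prob \<kappa> (Suc k) ?A w = 0"
    proof (rule AE_mp, intro AE_I2 impI)
      fix w assume "w \<in> space (\<kappa> z)" and 0: "path_prob \<kappa> (k + n) ?C w = 0"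
      then have w: "w \<in> space S" using Suc.prems(2) by (simp add: space_kernel)
      have "0 < path_prob \<kappa> (k + n) ?C w" if "0 < path_prob \<kappa> (Suc k) ?A w"
        by (rule Suc.IH[OF _ w that]) (use Suc.prems in auto)
      with 0 show "path_prob \<kappa> (Suc k) ?A w = 0"
        by (metis less_irrefl zero_less_iff_neq_zero)
    qed
    then show ?thesis
      by (subst nn_integral_0_iff_AE) (auto intro!: mz meas simp del: path_prob.simps)
  qed
  ultimately have "0 < (\<integral>\<^sup>+ w. path_prob \<kappa> (k + n) ?C w \<partial>\<kappa> z)"
    by (metis zero_less_iff_neq_zero)
  moreover have "path_prob \<kappa> (Suc k + n) (\<lambda>i. if i < Suc k then A i else B (i - Suc k)) z
      = indicator (A 0) z * (\<integral>\<^sup>+ w. path_prob \<kappa> (k + n) ?C w \<partial>\<kappa> z)"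
    by (simp only: add_Suc path_prob.simps(2) Suc_less_eq diff_Suc_Suc zero_less_Suc if_True)
  ultimately show ?case
    using \<open>z \<in> A 0\<close> by (simp add: indicator_def)
qed

end

section \<open>Recurrence of patterns in a Markov process\<close>

text \<open>
  Only one-step transitions on events of the past are required. In this form the property is easy to
  check both for \<open>Z\<close>, where it comes from conditional expectations, and for the Ionescu-Tulcea measure.
\<close>
locale markov_process = markov_kernel S \<kappa> + prob_space P
  for S :: "'a measure" and \<kappa> :: "'a \<Rightarrow> 'a measure" and P :: "'w measure" +
  fixes F :: "nat \<Rightarrow> 'w measure" and W :: "nat \<Rightarrow> 'w \<Rightarrow> 'a"
  assumes filtration_sub: "subalgebra P (F k)"
    and filtration_mono: "sets (F k) \<subseteq> sets (F (Suc k))"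
    and adapted: "W k \<in> F k \<rightarrow>\<^sub>M S"
    and markov_event: "\<And>B A. B \<in> sets (F k) \<Longrightarrow> A \<in> sets S \<Longrightarrow>
      emeasure P (B \<inter> {\<omega> \<in> space P. W (Suc k) \<omega> \<in> A}) =
        (\<integral>\<^sup>+ \<omega>. indicator B \<omega> * emeasure (\<kappa> (W k \<omega>)) A \<partial>P)"
begin

lemma space_filtration: "space (F k) = space P"
  using filtration_sub by (auto simp: subalgebra_def)

lemma filtration_event: "B \<in> sets (F k) \<Longrightarrow> B \<in> sets P"
  using filtration_sub by (auto simp: subalgebra_def)

lemma filtration_le:
  assumes "k \<le> l" shows "sets (F k) \<subseteq> sets (F l)"
  using assms by (rule lift_Suc_mono_le[of "\<lambda>k. sets (F k)", OF filtration_mono])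

lemma W_measurable [measurable]: "W k \<in> P \<rightarrow>\<^sub>M S"
  using measurable_from_subalg[OF filtration_sub adapted] .

lemma W_space: "\<omega> \<in> space P \<Longrightarrow> W k \<omega> \<in> space S"
  using W_measurable by (rule measurable_space)

lemma W_event:
  assumes "A \<in> sets S" "k \<le> l"
  shows "{\<omega> \<in> space P. W k \<omega> \<in> A} \<in> sets (F l)"
proof -
  have "{\<omega> \<in> space P. W k \<omega> \<in> A} = W k -` A \<inter> space (F k)"
    by (auto simp: space_filtration)
  also have "\<dots> \<in> sets (F k)"
    using adapted assms(1) by (rule measurable_sets)
  finally show ?thesis using filtration_le[OF assms(2)] by auto
qed

lemma markov_integral:
  assumes B: "B \<in> sets (F k)" and \<phi>: "\<phi> \<in> borel_measurable S"
  shows "(\<integral>\<^sup>+ \<omega>. indicator B \<omega> * \<phi> (W (Suc k) \<omega>) \<partial>P) =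
    (\<integral>\<^sup>+ \<omega>. indicator B \<omega> * (\<integral>\<^sup>+ w. \<phi> w \<partial>\<kappa> (W k \<omega>)) \<partial>P)"
proof -
  have BP [measurable]: "B \<in> sets P" using B by (rule filtration_event)
  have mk: "f \<in> borel_measurable (\<kappa> (W k \<omega>))" if "\<omega> \<in> space P" "f \<in> borel_measurable S"
    for f :: "_ \<Rightarrow> ennreal" and \<omega>
    using that sets_kernel[OF W_space[OF that(1)]] by (simp cong: measurable_cong_sets)
  have [measurable]: "(\<lambda>\<omega>. \<integral>\<^sup>+ w. f w \<partial>\<kappa> (W k \<omega>)) \<in> borel_measurable P"
    if "f \<in> borel_measurable S" for f
    using kernel_integral_measurable[OF that] by measurable
  show ?thesis
    using \<phi>
  proof (induction rule: borel_measurable_induct)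
    case (cong f g)
    have "(\<integral>\<^sup>+ w. f w \<partial>\<kappa> (W k \<omega>)) = (\<integral>\<^sup>+ w. g w \<partial>\<kappa> (W k \<omega>))" if "\<omega> \<in> space P" for \<omega>
      by (rule nn_integral_cong) (use cong that in \<open>auto simp: space_kernel[OF W_space]\<close>)
    then have "(\<integral>\<^sup>+ \<omega>. indicator B \<omega> * (\<integral>\<^sup>+ w. f w \<partial>\<kappa> (W k \<omega>)) \<partial>P) =
       (\<integral>\<^sup>+ \<omega>. indicator B \<omega> * (\<integral>\<^sup>+ w. g w \<partial>\<kappa> (W k \<omega>)) \<partial>P)"
      by (intro nn_integral_cong) simp
    moreover have "(\<integral>\<^sup>+ \<omega>. indicator B \<omega> * f (W (Suc k) \<omega>) \<partial>P) =
       (\<integral>\<^sup>+ \<omega>. indicator B \<omega> * g (W (Suc k) \<omega>) \<partial>P)"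
      by (intro nn_integral_cong) (use cong W_space in simp)
    ultimately show ?case using cong by simp
  next
    case (set A)
    have "(\<integral>\<^sup>+ \<omega>. indicator B \<omega> * indicator A (W (Suc k) \<omega>) \<partial>P) =
        (\<integral>\<^sup>+ \<omega>. indicator (B \<inter> {\<omega> \<in> space P. W (Suc k) \<omega> \<in> A}) \<omega> \<partial>P)"
      by (intro nn_integral_cong) (auto simp: indicator_def)
    also have "\<dots> = emeasure P (B \<inter> {\<omega> \<in> space P. W (Suc k) \<omega> \<in> A})"
      using set by (intro nn_integral_indicator sets.Int BP filtration_event[OF W_event[OF _ order.refl]])
    also have "\<dots> = (\<integral>\<^sup>+ \<omega>. indicator B \<omega> * emeasure (\<kappa> (W k \<omega>)) A \<partial>P)"
      using markov_event[OF B set] .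
    also have "\<dots> = (\<integral>\<^sup>+ \<omega>. indicator B \<omega> * (\<integral>\<^sup>+ w. indicator A w \<partial>\<kappa> (W k \<omega>)) \<partial>P)"
      by (intro nn_integral_cong) (use set sets_kernel[OF W_space] in simp)
    finally show ?case .
  next
    case (mult u c)
    note mult(2) [measurable]
    have "(\<integral>\<^sup>+ \<omega>. indicator B \<omega> * (c * u (W (Suc k) \<omega>)) \<partial>P) =
       (\<integral>\<^sup>+ \<omega>. c * (indicator B \<omega> * u (W (Suc k) \<omega>)) \<partial>P)"
      by (simp add: ac_simps)
    also have "\<dots> = c * (\<integral>\<^sup>+ \<omega>. indicator B \<omega> * u (W (Suc k) \<omega>) \<partial>P)"
      by (subst nn_integral_cmult) (use mult in measurable)
    also have "\<dots> = c * (\<integral>\<^sup>+ \<omega>. indicator B \<omega> * (\<integral>\<^sup>+ w. u w \<partial>\<kappa> (W k \<omega>)) \<partial>P)"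
      using mult by simp
    also have "\<dots> = (\<integral>\<^sup>+ \<omega>. c * (indicator B \<omega> * (\<integral>\<^sup>+ w. u w \<partial>\<kappa> (W k \<omega>))) \<partial>P)"
      by (subst nn_integral_cmult) (use mult in measurable)
    also have "\<dots> = (\<integral>\<^sup>+ \<omega>. indicator B \<omega> * (\<integral>\<^sup>+ w. c * u w \<partial>\<kappa> (W k \<omega>)) \<partial>P)"
      by (intro nn_integral_cong) (simp add: nn_integral_cmult[OF mk[OF _ mult(2)]] mult.left_commute)
    finally show ?case .
  next
    case (add u v)
    have u [measurable]: "u \<in> borel_measurable S" and v [measurable]: "v \<in> borel_measurable S"
      by fact+
    have "(\<integral>\<^sup>+ \<omega>. indicator B \<omega> * (v (W (Suc k) \<omega>) + u (W (Suc k) \<omega>)) \<partial>P) =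
       (\<integral>\<^sup>+ \<omega>. indicator B \<omega> * v (W (Suc k) \<omega>) \<partial>P) + (\<integral>\<^sup>+ \<omega>. indicator B \<omega> * u (W (Suc k) \<omega>) \<partial>P)"
      unfolding distrib_left by (subst nn_integral_add) (use add in measurable)
    also have "\<dots> = (\<integral>\<^sup>+ \<omega>. indicator B \<omega> * (\<integral>\<^sup>+ w. v w \<partial>\<kappa> (W k \<omega>)) \<partial>P) +
       (\<integral>\<^sup>+ \<omega>. indicator B \<omega> * (\<integral>\<^sup>+ w. u w \<partial>\<kappa> (W k \<omega>)) \<partial>P)"
      using add by simp
    also have "\<dots> = (\<integral>\<^sup>+ \<omega>. indicator B \<omega> * (\<integral>\<^sup>+ w. v w \<partial>\<kappa> (W k \<omega>)) +
       indicator B \<omega> * (\<integral>\<^sup>+ w. u w \<partial>\<kappa> (W k \<omega>)) \<partial>P)"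
      by (subst nn_integral_add) (use add in measurable)
    also have "\<dots> = (\<integral>\<^sup>+ \<omega>. indicator B \<omega> * (\<integral>\<^sup>+ w. v w + u w \<partial>\<kappa> (W k \<omega>)) \<partial>P)"
      by (intro nn_integral_cong)
         (simp add: nn_integral_add[OF mk[OF _ v] mk[OF _ u]] distrib_left)
    finally show ?case .
  next
    case (seq U)
    note seq(1) [measurable]
    have mono: "incseq U" using seq by simp
    have "(\<integral>\<^sup>+ \<omega>. indicator B \<omega> * (SUP i. U i) (W (Suc k) \<omega>) \<partial>P) =
       (\<integral>\<^sup>+ \<omega>. (SUP i. indicator B \<omega> * U i (W (Suc k) \<omega>)) \<partial>P)"
      by (simp add: SUP_mult_left_ennreal SUP_apply image_image)
    also have "\<dots> = (SUP i. \<integral>\<^sup>+ \<omega>. indicator B \<omega> * U i (W (Suc k) \<omega>) \<partial>P)"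
      using seq mono
      by (intro nn_integral_monotone_convergence_SUP)
         (auto simp: incseq_def le_fun_def intro!: mult_left_mono)
    also have "\<dots> = (SUP i. \<integral>\<^sup>+ \<omega>. indicator B \<omega> * (\<integral>\<^sup>+ w. U i w \<partial>\<kappa> (W k \<omega>)) \<partial>P)"
      using seq by simp
    also have "\<dots> = (\<integral>\<^sup>+ \<omega>. (SUP i. indicator B \<omega> * (\<integral>\<^sup>+ w. U i w \<partial>\<kappa> (W k \<omega>))) \<partial>P)"
      using seq mono
      by (intro nn_integral_monotone_convergence_SUP[symmetric])
         (auto simp: incseq_def le_fun_def intro!: mult_left_mono nn_integral_mono)
    also have "\<dots> = (\<integral>\<^sup>+ \<omega>. indicator B \<omega> * (\<integral>\<^sup>+ w. (SUP i. U i) w \<partial>\<kappa> (W k \<omega>)) \<partial>P)"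
    proof (rule nn_integral_cong)
      fix \<omega> assume \<omega>: "\<omega> \<in> space P"
      have "(\<integral>\<^sup>+ w. (SUP i. U i) w \<partial>\<kappa> (W k \<omega>)) = (SUP i. \<integral>\<^sup>+ w. U i w \<partial>\<kappa> (W k \<omega>))"
        using nn_integral_monotone_convergence_SUP[OF mono mk[OF \<omega> seq(1)]]
        by (simp add: SUP_apply image_image)
      then show "(SUP i. indicator B \<omega> * (\<integral>\<^sup>+ w. U i w \<partial>\<kappa> (W k \<omega>))) =
          indicator B \<omega> * (\<integral>\<^sup>+ w. (SUP i. U i) w \<partial>\<kappa> (W k \<omega>))"
        by (simp add: SUP_mult_left_ennreal)
    qed
    finally show ?case .
  qed
qed

definition occurs :: "nat \<Rightarrow> (nat \<Rightarrow> 'a set) \<Rightarrow> nat \<Rightarrow> 'w set"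
  where "occurs n A t = {\<omega> \<in> space P. \<forall>i<n. W (t + i) \<omega> \<in> A i}"

lemma occurs_filtration:
  assumes "\<And>i. A i \<in> sets S"
  shows "occurs n A t \<in> sets (F (t + n))"
proof -
  have "occurs n A t = space (F (t + n)) \<inter> (\<Inter>i\<in>{..<n}. {\<omega> \<in> space P. W (t + i) \<omega> \<in> A i}) \<inter> space (F (t + n))"
    by (auto simp: occurs_def space_filtration)
  also have "\<dots> \<in> sets (F (t + n))"
  proof (cases "n = 0")
    case False
    then have "(\<Inter>i\<in>{..<n}. {\<omega> \<in> space P. W (t + i) \<omega> \<in> A i}) \<in> sets (F (t + n))"
      using assms by (intro sets.finite_INT) (auto intro!: W_event)
    then show ?thesis by auto
  qed simp
  finally show ?thesis .
qed

text \<open>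
  The Markov property at a fixed time for finitely many future positions, by induction over these: the
  first constraint is absorbed into the event of the past, and one step is integrated out. It is the
  only form of the Markov property that the recurrence argument uses.
\<close>
lemma emeasure_occurs:
  assumes "B \<in> sets (F t)" and "\<And>i. A i \<in> sets S"
  shows "emeasure P (B \<inter> occurs n A t) =
    (\<integral>\<^sup>+ \<omega>. indicator B \<omega> * path_prob \<kappa> n A (W t \<omega>) \<partial>P)"
  using assms
proof (induction n arbitrary: B t A)
  case 0
  have "B \<inter> space P = B" "B \<in> sets P"
    using filtration_event[OF 0(1)] sets.sets_into_space by auto
  then show ?case by (simp add: occurs_def)
next
  case (Suc n)
  let ?A = "\<lambda>i. A (Suc i)"
  let ?B = "B \<inter> {\<omega> \<in> space P. W t \<omega> \<in> A 0}"
  have B: "?B \<in> sets (F t)"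
    using Suc.prems W_event by auto
  have "B \<inter> occurs (Suc n) A t = ?B \<inter> occurs n ?A (Suc t)"
    by (auto simp: occurs_def less_Suc_eq_0_disj)
  also have "emeasure P \<dots> = (\<integral>\<^sup>+ \<omega>. indicator ?B \<omega> * path_prob \<kappa> n ?A (W (Suc t) \<omega>) \<partial>P)"
    using B filtration_mono Suc.prems(2) by (intro Suc.IH) auto
  also have "\<dots> = (\<integral>\<^sup>+ \<omega>. indicator ?B \<omega> * (\<integral>\<^sup>+ w. path_prob \<kappa> n ?A w \<partial>\<kappa> (W t \<omega>)) \<partial>P)"
    using B Suc.prems(2) by (intro markov_integral path_prob_measurable) auto
  also have "\<dots> = (\<integral>\<^sup>+ \<omega>. indicator B \<omega> * path_prob \<kappa> (Suc n) A (W t \<omega>) \<partial>P)"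
    by (intro nn_integral_cong) (auto simp: indicator_def)
  finally show ?case .
qed

text \<open>
  Whether \<open>A\<close> is hit after time \<open>t\<close> depends on the process only through the position at time \<open>t\<close>, since
  the probability of avoiding \<open>A\<close> for \<open>n\<close> steps is the integral of an avoidance probability of the
  kernel. Dominated convergence then transfers recurrence from the kernel to every process that it
  drives.
\<close>
lemma AE_hits_infinitely_often:
  assumes A: "A \<in> sets S"
    and escape: "\<And>z. z \<in> space S \<Longrightarrow> (\<lambda>n. path_prob \<kappa> n (\<lambda>_. space S - A) z) \<longlonglongrightarrow> 0"
  shows "AE \<omega> in P. \<forall>t. \<exists>k\<ge>t. W k \<omega> \<in> A"
proof -
  let ?A = "\<lambda>_::nat. space S - A"
  have A': "?A i \<in> sets S" for i using A by auto
  have "AE \<omega> in P. \<exists>k\<ge>t. W k \<omega> \<in> A" for t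
  proof -
    let ?N = "{\<omega> \<in> space P. \<forall>k\<ge>t. W k \<omega> \<notin> A}"
    have "?N = (\<Inter>n. occurs n ?A t)"
      by (auto simp: occurs_def W_space) (metis le_iff_add lessI)
    have [measurable]: "A \<in> sets S" by fact
    have N: "?N \<in> sets P" by measurable
    have le: "emeasure P ?N \<le> (\<integral>\<^sup>+ \<omega>. path_prob \<kappa> n ?A (W t \<omega>) \<partial>P)" for n
    proof -
      have "emeasure P ?N \<le> emeasure P (space P \<inter> occurs n ?A t)"
        using filtration_event[OF occurs_filtration[OF A']]
        by (intro emeasure_mono) (auto simp: occurs_def W_space)
      also have "\<dots> = (\<integral>\<^sup>+ \<omega>. indicator (space P) \<omega> * path_prob \<kappa> n ?A (W t \<omega>) \<partial>P)"
        using A' sets.top[of "F t"] by (intro emeasure_occurs) (auto simp: space_filtration)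
      also have "\<dots> = (\<integral>\<^sup>+ \<omega>. path_prob \<kappa> n ?A (W t \<omega>) \<partial>P)"
        by (intro nn_integral_cong) simp
      finally show ?thesis .
    qed
    have "(\<lambda>n. \<integral>\<^sup>+ \<omega>. path_prob \<kappa> n ?A (W t \<omega>) \<partial>P) \<longlonglongrightarrow> (\<integral>\<^sup>+ \<omega>. 0 \<partial>P)"
    proof (rule nn_integral_dominated_convergence[where w="\<lambda>_. 1"])
      show "(\<lambda>\<omega>. path_prob \<kappa> n ?A (W t \<omega>)) \<in> borel_measurable P" for n
        using path_prob_measurable[OF A'] by measurable
    qed (auto simp: emeasure_space_1 intro!: AE_I2 path_prob_le_1 escape W_space)
    then have "emeasure P ?N \<le> (\<integral>\<^sup>+ \<omega>. 0 \<partial>P)"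
      by (rule Lim_bounded2) (use le in auto)
    then have "emeasure P ?N = 0" by simp
    then show ?thesis
      using N by (intro AE_I[of _ _ ?N]) auto
  qed
  then show ?thesis by (simp add: AE_all_countable)
qed

definition never_after :: "nat \<Rightarrow> (nat \<Rightarrow> 'a set) \<Rightarrow> nat \<Rightarrow> 'w set"
  where "never_after n A t = {\<omega> \<in> space P. \<forall>l\<ge>t. \<omega> \<notin> occurs n A l}"

lemma never_after_sets:
  assumes "\<And>i. A i \<in> sets S"
  shows "never_after n A t \<in> sets P"
proof -
  have [measurable]: "occurs n A l \<in> sets P" for l
    using occurs_filtration[OF assms] by (rule filtration_event)
  show ?thesis unfolding never_after_def by measurable
qed

text \<open>
  The conditional Borel-Cantelli lemma in quantitative form. At the first visit to \<open>A\<close> after time \<open>t\<close> the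
  pattern starts with conditional probability at least \<open>\<eta>\<close>; if it fails, the argument restarts once the
  window of the pattern has passed. Each of the \<open>j\<close> rounds costs a factor \<open>1 - \<eta>\<close>. Decomposing over the
  deterministic value of the first visit avoids stopping times.
\<close>
lemma never_after_geometric:
  assumes A: "A \<in> sets S" and D: "\<And>i. D i \<in> sets S"
    and hit: "AE \<omega> in P. \<forall>t. \<exists>k\<ge>t. W k \<omega> \<in> A"
    and \<eta>: "0 \<le> \<eta>" "\<eta> \<le> 1"
    and lower: "\<And>z. z \<in> A \<Longrightarrow> ennreal \<eta> \<le> path_prob \<kappa> n D z"
    and G: "G \<in> sets (F t)"
  shows "emeasure P (G \<inter> never_after n D t) \<le> ennreal (1 - \<eta>) ^ j * emeasure P G"
  using G
proof (induction j arbitrary: G t)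
  case 0
  then show ?case
    using filtration_event[OF 0] by (auto intro!: emeasure_mono)
next
  case (Suc j)
  note GF = Suc.prems
  have [measurable]: "G \<in> sets P" using GF by (rule filtration_event)
  have [measurable]: "A \<in> sets S" by fact
  \<comment> \<open>\<open>H k\<close>: the first visit to \<open>A\<close> at a time \<open>\<ge> t\<close> is at time \<open>t + k\<close>\<close>
  define H where "H k = G \<inter> occurs k (\<lambda>_. space S - A) t \<inter> {\<omega> \<in> space P. W (t + k) \<omega> \<in> A}" for k
  have HF: "H k \<in> sets (F (t + k))" for k
  proof -
    have "G \<in> sets (F (t + k))" using GF filtration_le[of t "t + k"] by auto
    then show ?thesis
      unfolding H_def using A by (intro sets.Int occurs_filtration W_event) auto
  qed
  have HP [measurable]: "H k \<in> sets P" for k using HF by (rule filtration_event)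
  have occP [measurable]: "occurs n D l \<in> sets P" for l
    using occurs_filtration[OF D] by (rule filtration_event)
  define R where "R k = H k - occurs n D (t + k)" for k
  have RF: "R k \<in> sets (F (t + k + n))" for k
    unfolding R_def using HF[of k] filtration_le[of "t + k" "t + k + n"] occurs_filtration[OF D]
    by (intro sets.Diff) auto
  have R_le: "emeasure P (R k) \<le> ennreal (1 - \<eta>) * emeasure P (H k)" for k
  proof -
    have "emeasure P (H k \<inter> occurs n D (t + k)) =
        (\<integral>\<^sup>+ \<omega>. indicator (H k) \<omega> * path_prob \<kappa> n D (W (t + k) \<omega>) \<partial>P)"
      using HF D by (rule emeasure_occurs)
    also have "\<dots> \<ge> (\<integral>\<^sup>+ \<omega>. ennreal \<eta> * indicator (H k) \<omega> \<partial>P)"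
      by (intro nn_integral_mono) (auto simp: H_def indicator_def intro!: lower)
    also have "(\<integral>\<^sup>+ \<omega>. ennreal \<eta> * indicator (H k) \<omega> \<partial>P) = ennreal \<eta> * emeasure P (H k)"
      by (intro nn_integral_cmult_indicator) measurable
    finally have "\<eta> * prob (H k) \<le> prob (H k \<inter> occurs n D (t + k))"
      using \<eta> by (simp add: emeasure_eq_measure flip: ennreal_mult')
    moreover have "prob (R k) = prob (H k) - prob (H k \<inter> occurs n D (t + k))"
      unfolding R_def by (rule finite_measure_Diff') measurable
    ultimately have "prob (R k) \<le> (1 - \<eta>) * prob (H k)"
      by (simp add: algebra_simps)
    then show ?thesis
      using \<eta> by (simp add: emeasure_eq_measure flip: ennreal_mult')
  qed
  have nvP [measurable]: "never_after n D l \<in> sets P" for l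
    using D by (rule never_after_sets)
  have sub: "AE \<omega> in P. \<omega> \<in> G \<inter> never_after n D t \<longrightarrow> \<omega> \<in> (\<Union>k. R k \<inter> never_after n D (t + k + n))"
    using hit AE_space
  proof eventually_elim
    case (elim \<omega>)
    show ?case
    proof
      assume \<omega>: "\<omega> \<in> G \<inter> never_after n D t"
      have "\<exists>k. W (t + k) \<omega> \<in> A"
        using elim(1) by (metis le_iff_add)
      then obtain k where k: "W (t + k) \<omega> \<in> A" "\<And>i. i < k \<Longrightarrow> W (t + i) \<omega> \<notin> A"
        using exists_least_iff[of "\<lambda>k. W (t + k) \<omega> \<in> A"] by blast
      then have "\<omega> \<in> H k"
        using \<omega> elim(2) by (auto simp: H_def occurs_def W_space)
      moreover have "\<omega> \<notin> occurs n D (t + k)" "\<omega> \<in> never_after n D (t + k + n)"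
        using \<omega> by (auto simp: never_after_def)
      ultimately show "\<omega> \<in> (\<Union>k. R k \<inter> never_after n D (t + k + n))"
        by (auto simp: R_def)
    qed
  qed
  have RP [measurable]: "R k \<in> sets P" for k using RF by (rule filtration_event)
  have "emeasure P (G \<inter> never_after n D t) \<le> emeasure P (\<Union>k. R k \<inter> never_after n D (t + k + n))"
    by (rule emeasure_mono_AE[OF sub]) measurable
  also have "\<dots> \<le> (\<Sum>k. emeasure P (R k \<inter> never_after n D (t + k + n)))"
    by (rule emeasure_subadditive_countably) auto
  also have "\<dots> \<le> (\<Sum>k. ennreal (1 - \<eta>) ^ Suc j * emeasure P (H k))"
  proof (intro suminf_le summableI)
    fix k
    have "emeasure P (R k \<inter> never_after n D (t + k + n)) \<le> ennreal (1 - \<eta>) ^ j * emeasure P (R k)"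
      by (rule Suc.IH) (rule RF)
    also have "\<dots> \<le> ennreal (1 - \<eta>) ^ j * (ennreal (1 - \<eta>) * emeasure P (H k))"
      by (intro mult_left_mono R_le) auto
    finally show "emeasure P (R k \<inter> never_after n D (t + k + n)) \<le>
        ennreal (1 - \<eta>) ^ Suc j * emeasure P (H k)"
      by (simp add: ac_simps)
  qed
  also have "\<dots> = ennreal (1 - \<eta>) ^ Suc j * (\<Sum>k. emeasure P (H k))"
    by (rule ennreal_suminf_cmult)
  also have "(\<Sum>k. emeasure P (H k)) = emeasure P (\<Union>k. H k)"
  proof (rule suminf_emeasure)
    show "disjoint_family H"
      unfolding disjoint_family_on_def
    proof (intro ballI impI)
      fix k l :: nat assume "k \<noteq> l"
      then consider "k < l" | "l < k" by linarith
      then show "H k \<inter> H l = {}"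
        by cases (auto simp: H_def occurs_def)
    qed
  qed auto
  also have "ennreal (1 - \<eta>) ^ Suc j * emeasure P (\<Union>k. H k) \<le> ennreal (1 - \<eta>) ^ Suc j * emeasure P G"
    by (intro mult_left_mono emeasure_mono) (auto simp: H_def)
  finally show ?case .
qed

theorem occurs_infinitely_often:
  assumes A: "A \<in> sets S" and D: "\<And>i. D i \<in> sets S"
    and hit: "AE \<omega> in P. \<forall>t. \<exists>k\<ge>t. W k \<omega> \<in> A"
    and \<eta>: "0 < \<eta>" "\<eta> \<le> 1"
    and lower: "\<And>z. z \<in> A \<Longrightarrow> ennreal \<eta> \<le> path_prob \<kappa> n D z"
  shows "AE \<omega> in P. \<forall>t. \<exists>l\<ge>t. \<omega> \<in> occurs n D l"
proof -
  have "AE \<omega> in P. \<exists>l\<ge>t. \<omega> \<in> occurs n D l" for t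
  proof -
    have G: "space P \<in> sets (F t)"
      using sets.top[of "F t"] unfolding space_filtration .
    have sub: "space P \<inter> never_after n D t = never_after n D t"
      unfolding never_after_def by blast
    have "emeasure P (never_after n D t) \<le> ennreal ((1 - \<eta>) ^ j)" for j
    proof -
      have "emeasure P (space P \<inter> never_after n D t) \<le> ennreal (1 - \<eta>) ^ j * emeasure P (space P)"
        by (rule never_after_geometric[OF A D hit _ \<eta>(2) lower G]) (use \<eta> in auto)
      then show ?thesis
        using \<eta> by (simp only: sub emeasure_space_1 ennreal_power mult_1_right)
    qed
    moreover have "(\<lambda>j. ennreal ((1 - \<eta>) ^ j)) \<longlonglongrightarrow> ennreal 0"
      using \<eta> by (intro tendsto_ennrealI LIMSEQ_realpow_zero) auto
    ultimately have "emeasure P (never_after n D t) \<le> ennreal 0"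
      using LIMSEQ_le_const by blast
    then have "emeasure P (never_after n D t) = 0" by simp
    moreover have "never_after n D t \<in> sets P"
      using D by (rule never_after_sets)
    ultimately show ?thesis
      by (intro AE_I[where N = "never_after n D t"]) (auto simp only: never_after_def)
  qed
  then show ?thesis by (simp add: AE_all_countable)
qed

end

section \<open>The model and the canonical chain as Markov processes\<close>

text \<open>
  This makes the histories below increasing: a shorter history is a restriction of a longer one.
\<close>
lemma sets_vimage_algebra_subset:
  assumes f: "f \<in> X \<rightarrow> space N" and g: "g \<in> N \<rightarrow>\<^sub>M N'" and h: "\<And>x. x \<in> X \<Longrightarrow> h x = g (f x)"
  shows "sets (vimage_algebra X h N') \<subseteq> sets (vimage_algebra X f N)"
proof -
  have h': "h \<in> X \<rightarrow> space N'"
    using measurable_space[OF g] f by (auto simp: h Pi_iff)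
  show ?thesis
    unfolding sets_vimage_algebra2[OF f] sets_vimage_algebra2[OF h']
  proof
    fix B assume "B \<in> {h -` A \<inter> X |A. A \<in> sets N'}"
    then obtain A where A: "A \<in> sets N'" and B: "B = h -` A \<inter> X"
      by blast
    have "B = f -` (g -` A \<inter> space N) \<inter> X"
      using f h by (auto simp: B)
    moreover have "g -` A \<inter> space N \<in> sets N"
      using g A by (rule measurable_sets)
    ultimately show "B \<in> {f -` A \<inter> X |A. A \<in> sets N}"
      by blast
  qed
qed

context pairwise_markov_model
begin

abbreviation "S \<equiv> state_algebra m :: ('x \<times> nat) measure"
abbreviation "K \<equiv> trans_kernel \<mu> m q"

lemma space_S: "space S = UNIV \<times> {1..m}"
  by (simp add: state_algebra_def space_pair_measure)

lemma sets_base [measurable_cong]: "sets (\<mu> \<Otimes>\<^sub>M count_space {1..m}) = sets S"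
  unfolding state_algebra_def by (intro sets_pair_measure_cong sets_mu refl)

lemma space_base: "space (\<mu> \<Otimes>\<^sub>M count_space {1..m}) = space S"
  by (rule sets_eq_imp_space_eq[OF sets_base])

lemma sigma_finite_base: "sigma_finite_measure (\<mu> \<Otimes>\<^sub>M count_space {1..m})"
proof -
  interpret c: sigma_finite_measure "count_space {1..m}"
    by (rule sigma_finite_measure_count_space_finite) simp
  interpret pair_sigma_finite \<mu> "count_space {1..m}" ..
  show ?thesis ..
qed

lemma q_section_measurable:
  assumes "z' \<in> space S"
  shows "(\<lambda>z. ennreal (q z z')) \<in> borel_measurable (\<mu> \<Otimes>\<^sub>M count_space {1..m})"
proof -
  have "(\<lambda>z. (\<lambda>(z, z'). q z z') (z, z')) \<in> borel_measurable S"
    by (rule measurable_compose[OF _ q_measurable]) (use assms in measurable)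
  then have "(\<lambda>z. ennreal (q z z')) \<in> borel_measurable S"
    by simp
  then show ?thesis by (simp cong: measurable_cong_sets add: sets_base)
qed

lemma nn_integral_K:
  assumes "z' \<in> space S" and "f \<in> borel_measurable S"
  shows "(\<integral>\<^sup>+ z. f z \<partial>K z') = (\<integral>\<^sup>+ z. ennreal (q z z') * f z \<partial>(\<mu> \<Otimes>\<^sub>M count_space {1..m}))"
  unfolding trans_kernel_def
  by (rule nn_integral_density[OF q_section_measurable[OF assms(1)]])
     (use assms(2) in \<open>simp cong: measurable_cong_sets add: sets_base\<close>)

lemma K_measurable: "K \<in> S \<rightarrow>\<^sub>M prob_algebra S"
proof (rule measurable_prob_algebraI)
  have sets_K: "sets (K z') = sets S" for z'
    unfolding trans_kernel_def sets_density by (rule sets_base)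
  show prob: "prob_space (K z')" if "z' \<in> space S" for z'
  proof
    have "emeasure (K z') (space (K z')) = (\<integral>\<^sup>+ z. 1 \<partial>K z')" by simp
    also have "\<dots> = 1"
      using nn_integral_K[OF that, of "\<lambda>_. 1"] q_density[OF that] by simp
    finally show "emeasure (K z') (space (K z')) = 1" .
  qed
  show "K \<in> S \<rightarrow>\<^sub>M subprob_algebra S"
  proof (rule measurable_subprob_algebra)
    fix A assume A [measurable]: "A \<in> sets S"
    interpret b: sigma_finite_measure "\<mu> \<Otimes>\<^sub>M count_space {1..m}" by (rule sigma_finite_base)
    have "(\<lambda>(z', z). (\<lambda>(z, z'). q z z') (z, z')) \<in> borel_measurable (S \<Otimes>\<^sub>M S)"
      unfolding split_beta' by (rule measurable_compose[OF _ q_measurable[unfolded split_beta']]) measurable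
    then have [measurable]: "(\<lambda>p. q (snd p) (fst p)) \<in> borel_measurable (S \<Otimes>\<^sub>M S)"
      by (simp add: split_beta')
    have "(\<lambda>p. ennreal (q (snd p) (fst p)) * indicator A (snd p)) \<in> borel_measurable (S \<Otimes>\<^sub>M S)"
      by measurable
    then have "(\<lambda>(z', z). ennreal (q z z') * indicator A z)
        \<in> borel_measurable (S \<Otimes>\<^sub>M (\<mu> \<Otimes>\<^sub>M count_space {1..m}))"
      unfolding split_beta' by (simp cong: measurable_cong_sets sets_pair_measure_cong add: sets_base)
    then have "(\<lambda>z'. \<integral>\<^sup>+ z. ennreal (q z z') * indicator A z \<partial>(\<mu> \<Otimes>\<^sub>M count_space {1..m}))
        \<in> borel_measurable S"
      by (rule b.borel_measurable_nn_integral)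
    also have "?this \<longleftrightarrow> (\<lambda>z'. emeasure (K z') A) \<in> borel_measurable S"
    proof (rule measurable_cong)
      fix z' assume "z' \<in> space S"
      then show "(\<integral>\<^sup>+ z. ennreal (q z z') * indicator A z \<partial>(\<mu> \<Otimes>\<^sub>M count_space {1..m})) = emeasure (K z') A"
        using nn_integral_K[of z' "indicator A"] A by (simp add: sets_K)
    qed
    finally show "(\<lambda>z'. emeasure (K z') A) \<in> borel_measurable S" .
  qed (auto simp: sets_K prob intro: prob_space_imp_subprob_space)
qed

sublocale kernel: markov_kernel S K
  by standard (rule K_measurable)

text \<open>
  Positions are counted from 0 in a Markov process, so the history at time \<open>k\<close> is generated by
  \<open>Z 1, \<dots>, Z (k + 1)\<close>.
\<close>
definition history :: "nat \<Rightarrow> 'w measure"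
  where "history k =
    vimage_algebra (space \<Omega>) (\<lambda>\<omega>. \<lambda>i\<in>{1..k + 1}. Z i \<omega>) (\<Pi>\<^sub>M i\<in>{1..k + 1}. S)"

lemma Z_vector_measurable: "(\<lambda>\<omega>. \<lambda>i\<in>{1..k}. Z i \<omega>) \<in> \<Omega> \<rightarrow>\<^sub>M (\<Pi>\<^sub>M i\<in>{1..k}. S)"
  by (intro measurable_restrict Z_measurable) auto

theorem Z_markov_process: "markov_process S K \<Omega> history (\<lambda>k. Z (k + 1))"
proof
  fix k
  have Zf: "(\<lambda>\<omega>. \<lambda>i\<in>{1..l}. Z i \<omega>) \<in> space \<Omega> \<rightarrow> space (\<Pi>\<^sub>M i\<in>{1..l}. S)" for l
    using Z_vector_measurable[of l, THEN measurable_space] by blast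
  show sub: "subalgebra \<Omega> (history k)"
    unfolding subalgebra_def history_def
    unfolding sets_vimage_algebra2[OF Zf]
    using measurable_sets[OF Z_vector_measurable] by auto
  show "sets (history k) \<subseteq> sets (history (Suc k))"
    unfolding history_def
  proof (rule sets_vimage_algebra_subset[OF Zf])
    show "(\<lambda>f. restrict f {1..k + 1}) \<in> (\<Pi>\<^sub>M i\<in>{1..Suc k + 1}. S) \<rightarrow>\<^sub>M (\<Pi>\<^sub>M i\<in>{1..k + 1}. S)"
      by (rule measurable_restrict_subset) auto
  qed auto
  show "Z (k + 1) \<in> history k \<rightarrow>\<^sub>M S"
  proof -
    have "(\<lambda>\<omega>. \<lambda>i\<in>{1..k+1}. Z i \<omega>) \<in> history k \<rightarrow>\<^sub>M (\<Pi>\<^sub>M i\<in>{1..k+1}. S)"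
      unfolding history_def by (rule measurable_vimage_algebra1[OF Zf])
    from measurable_compose[OF this measurable_component_singleton[of "k+1"]] show ?thesis
      by simp
  qed
  fix B A assume B: "B \<in> sets (history k)" and A: "A \<in> sets S"
  interpret fm: finite_measure_subalgebra \<Omega> "history k"
    by standard (rule sub)
  have BO [measurable]: "B \<in> sets \<Omega>" using B sub by (auto simp: subalgebra_def)
  have [measurable]: "Z (Suc k + 1) \<in> \<Omega> \<rightarrow>\<^sub>M S" "Z (k + 1) \<in> \<Omega> \<rightarrow>\<^sub>M S" "A \<in> sets S"
    using A by (auto intro: Z_measurable)
  have ZA: "{\<omega> \<in> space \<Omega>. Z (Suc k + 1) \<omega> \<in> A} \<in> sets \<Omega>" by measurable
  have Km [measurable]: "(\<lambda>\<omega>. measure (K (Z (k + 1) \<omega>)) A) \<in> borel_measurable \<Omega>"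
    using measurable_compose[OF \<open>Z (k + 1) \<in> \<Omega> \<rightarrow>\<^sub>M S\<close>
        measurable_compose[OF kernel.kernel_subprob measurable_measure_subprob_algebra[OF A]]]
    by simp
  have Kp: "prob_space (K (Z (k + 1) \<omega>))" if "\<omega> \<in> space \<Omega>" for \<omega>
    using measurable_space[OF \<open>Z (k + 1) \<in> \<Omega> \<rightarrow>\<^sub>M S\<close> that] by (rule kernel.prob_space_kernel)
  have "measure \<Omega> (B \<inter> {\<omega> \<in> space \<Omega>. Z (Suc k + 1) \<omega> \<in> A}) =
      (\<integral>\<omega>\<in>B. indicator A (Z (Suc k + 1) \<omega>) \<partial>\<Omega>)"
  proof -
    have "measure \<Omega> (B \<inter> {\<omega> \<in> space \<Omega>. Z (Suc k + 1) \<omega> \<in> A}) =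
        (\<integral>\<omega>. indicator (B \<inter> {\<omega> \<in> space \<Omega>. Z (Suc k + 1) \<omega> \<in> A}) \<omega> \<partial>\<Omega>)"
      using ZA by simp
    also have "\<dots> = (\<integral>\<omega>\<in>B. indicator A (Z (Suc k + 1) \<omega>) \<partial>\<Omega>)"
      unfolding set_lebesgue_integral_def
      by (intro Bochner_Integration.integral_cong) (auto simp: indicator_def)
    finally show ?thesis .
  qed
  also have "\<dots> = (\<integral>\<omega>\<in>B. real_cond_exp \<Omega> (history k) (\<lambda>\<omega>. indicator A (Z (Suc k + 1) \<omega>)) \<omega> \<partial>\<Omega>)"
    using B
  proof (rule fm.real_cond_exp_intA[rotated])
    show "integrable \<Omega> (\<lambda>\<omega>. indicator A (Z (Suc k + 1) \<omega>) :: real)"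
    proof (rule integrable_const_bound[where B=1])
      have "(\<lambda>z. indicator A z :: real) \<in> borel_measurable S" by measurable
      from measurable_compose[OF \<open>Z (Suc k + 1) \<in> \<Omega> \<rightarrow>\<^sub>M S\<close> this]
      show "(\<lambda>\<omega>. indicator A (Z (Suc k + 1) \<omega>) :: real) \<in> borel_measurable \<Omega>" .
    qed auto
  qed
  also have "\<dots> = (\<integral>\<omega>\<in>B. measure (K (Z (k + 1) \<omega>)) A \<partial>\<Omega>)"
    unfolding set_lebesgue_integral_def
  proof (rule integral_cong_AE)
    show "AE \<omega> in \<Omega>. indicator B \<omega> *\<^sub>R
        real_cond_exp \<Omega> (history k) (\<lambda>\<omega>. indicator A (Z (Suc k + 1) \<omega>)) \<omega> =
        indicator B \<omega> *\<^sub>R measure (K (Z (k + 1) \<omega>)) A"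
      using Z_markov[of "k + 1", OF _ A] unfolding history_def by auto
  qed measurable
  finally have "emeasure \<Omega> (B \<inter> {\<omega> \<in> space \<Omega>. Z (Suc k + 1) \<omega> \<in> A}) =
      ennreal (\<integral>\<omega>. indicator B \<omega> *\<^sub>R measure (K (Z (k + 1) \<omega>)) A \<partial>\<Omega>)"
    by (simp add: emeasure_eq_measure set_lebesgue_integral_def)
  also have "\<dots> = (\<integral>\<^sup>+ \<omega>. ennreal (indicator B \<omega> *\<^sub>R measure (K (Z (k + 1) \<omega>)) A) \<partial>\<Omega>)"
  proof (rule nn_integral_eq_integral[symmetric])
    show "integrable \<Omega> (\<lambda>\<omega>. indicator B \<omega> *\<^sub>R measure (K (Z (k + 1) \<omega>)) A)"
    proof (rule integrable_const_bound[where B=1])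
      show "(\<lambda>\<omega>. indicator B \<omega> *\<^sub>R measure (K (Z (k + 1) \<omega>)) A) \<in> borel_measurable \<Omega>"
        by measurable
      show "AE \<omega> in \<Omega>. norm (indicator B \<omega> *\<^sub>R measure (K (Z (k + 1) \<omega>)) A) \<le> 1"
        using prob_space.prob_le_1[OF Kp] by (intro AE_I2) (auto simp: indicator_def)
    qed
  qed auto
  also have "\<dots> = (\<integral>\<^sup>+ \<omega>. indicator B \<omega> * emeasure (K (Z (k + 1) \<omega>)) A \<partial>\<Omega>)"
  proof (rule nn_integral_cong)
    fix \<omega> assume "\<omega> \<in> space \<Omega>"
    then interpret k: prob_space "K (Z (k + 1) \<omega>)" by (rule Kp)
    show "ennreal (indicator B \<omega> *\<^sub>R measure (K (Z (k + 1) \<omega>)) A) =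
        indicator B \<omega> * emeasure (K (Z (k + 1) \<omega>)) A"
      unfolding k.emeasure_eq_measure by (simp add: indicator_def)
  qed
  finally show "emeasure \<Omega> (B \<inter> {\<omega> \<in> space \<Omega>. Z (Suc k + 1) \<omega> \<in> A}) =
      (\<integral>\<^sup>+ \<omega>. indicator B \<omega> * emeasure (K (Z (k + 1) \<omega>)) A \<partial>\<Omega>)" .
qed

definition path_history :: "nat \<Rightarrow> (nat \<Rightarrow> 'x \<times> nat) measure"
  where "path_history k = vimage_algebra (space (\<Pi>\<^sub>M i\<in>UNIV. S))
    (\<lambda>\<omega>. restrict \<omega> {0..<Suc k}) (\<Pi>\<^sub>M i\<in>{0..<Suc k}. S)"

context
  fixes z assumes z: "z \<in> space S"
begin

interpretation IT: Ionescu_Tulcea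
  "\<lambda>i \<omega>. case i of 0 \<Rightarrow> return S z | Suc j \<Rightarrow> K (\<omega> j)" "\<lambda>_. S"
proof (rule Ionescu_Tulcea.intro)
  fix i :: nat
  show "(\<lambda>\<omega>. case i of 0 \<Rightarrow> return S z | Suc j \<Rightarrow> K (\<omega> j)) \<in> (\<Pi>\<^sub>M j\<in>{0..<i}. S) \<rightarrow>\<^sub>M subprob_algebra S"
  proof (cases i)
    case 0
    then show ?thesis
      using z measurable_space[OF return_measurable z] by simp
  next
    case (Suc j)
    have "(\<lambda>\<omega>. \<omega> j) \<in> (\<Pi>\<^sub>M j\<in>{0..<i}. S) \<rightarrow>\<^sub>M S"
      by (rule measurable_component_singleton) (simp add: Suc)
    from measurable_compose[OF this kernel.kernel_subprob] show ?thesis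
      by (simp add: Suc)
  qed
next
  fix i :: nat and \<omega> :: "nat \<Rightarrow> 'x \<times> nat"
  assume \<omega>: "\<omega> \<in> space (\<Pi>\<^sub>M j\<in>{0..<i}. S)"
  show "prob_space (case i of 0 \<Rightarrow> return S z | Suc j \<Rightarrow> K (\<omega> j))"
  proof (cases i)
    case (Suc j)
    with \<omega> have "\<omega> j \<in> space S" by (auto simp: space_PiM PiE_iff)
    then show ?thesis by (simp add: Suc kernel.prob_space_kernel)
  qed (simp add: prob_space_return z)
qed

lemma chain_law_eq_lim: "chain_law \<mu> m q z = IT.PF.lim"
  by (simp add: chain_law_def)

lemma space_chain_law: "space (chain_law \<mu> m q z) = space (\<Pi>\<^sub>M i\<in>UNIV. S)"
  and sets_chain_law: "sets (chain_law \<mu> m q z) = sets (\<Pi>\<^sub>M i\<in>UNIV. S)"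
  by (simp_all add: chain_law_eq_lim)

lemma restrict_chain_law:
  "(\<lambda>\<omega>. restrict \<omega> J) \<in> chain_law \<mu> m q z \<rightarrow>\<^sub>M (\<Pi>\<^sub>M i\<in>J. S)"
  by (simp cong: measurable_cong_sets add: sets_chain_law measurable_restrict_subset)

lemma chain_law_marginal:
  "distr (chain_law \<mu> m q z) (\<Pi>\<^sub>M i\<in>{0..<n}. S) (\<lambda>\<omega>. restrict \<omega> {0..<n}) = IT.C 0 n (\<lambda>_. undefined)"
  unfolding chain_law_eq_lim IT.distr_lim[OF finite_atLeastLessThan]
proof (rule measure_eqI)
  show "sets (IT.CI {0..<n}) = sets (IT.C 0 n (\<lambda>_. undefined))"
    by (simp add: IT.CI_def IT.sets_C)
  fix X assume "X \<in> sets (IT.CI {0..<n})"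
  then have "X \<in> sets (\<Pi>\<^sub>M i\<in>{0..<n}. S)" by (simp add: IT.CI_def)
  then show "emeasure (IT.CI {0..<n}) X = emeasure (IT.C 0 n (\<lambda>_. undefined)) X"
    using sets.sets_into_space[of X "\<Pi>\<^sub>M i\<in>{0..<n}. S"]
    by (simp add: IT.emeasure_CI[of _ n] prod_emb_id space_PiM)
qed

lemma chain_law_initial:
  assumes f: "f \<in> borel_measurable S"
  shows "(\<integral>\<^sup>+ \<omega>. f (\<omega> 0) \<partial>chain_law \<mu> m q z) = f z"
proof -
  have [measurable]: "(\<lambda>\<omega>. f (\<omega> 0)) \<in> borel_measurable (\<Pi>\<^sub>M i\<in>{0..<Suc 0}. S)"
    by (rule measurable_compose[OF _ f]) (rule measurable_component_singleton, simp)
  have u: "(\<lambda>_. undefined) \<in> space (\<Pi>\<^sub>M i\<in>{0..<0::nat}. S)" by (simp add: space_PiM)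
  have "(\<integral>\<^sup>+ \<omega>. f (\<omega> 0) \<partial>chain_law \<mu> m q z) = (\<integral>\<^sup>+ \<omega>. f (restrict \<omega> {0..<Suc 0} 0) \<partial>chain_law \<mu> m q z)"
    by simp
  also have "\<dots> = (\<integral>\<^sup>+ \<omega>. f (\<omega> 0)
      \<partial>distr (chain_law \<mu> m q z) (\<Pi>\<^sub>M i\<in>{0..<Suc 0}. S) (\<lambda>\<omega>. restrict \<omega> {0..<Suc 0}))"
    by (rule nn_integral_distr[OF restrict_chain_law, symmetric]) measurable
  also have "\<dots> = (\<integral>\<^sup>+ \<omega>. f (\<omega> 0) \<partial>IT.C 0 (Suc 0) (\<lambda>_. undefined))"
    by (simp only: chain_law_marginal)
  also have "IT.C 0 (Suc 0) (\<lambda>_. undefined) = IT.eP 0 (\<lambda>_. undefined)"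
    using bind_return[OF IT.measurable_eP[of 0] u] by simp
  also have "(\<integral>\<^sup>+ \<omega>. f (\<omega> 0) \<partial>IT.eP 0 (\<lambda>_. undefined)) = f z"
    using IT.nn_integral_eP[OF u \<open>(\<lambda>\<omega>. f (\<omega> 0)) \<in> borel_measurable (\<Pi>\<^sub>M i\<in>{0..<Suc 0}. S)\<close>]
    by (simp add: nn_integral_return[OF z f])
  finally show ?thesis .
qed

text \<open>
  The Ionescu-Tulcea measure has the marginals \<open>C 0 n\<close>, which grow by binding the one-step kernel; the
  event \<open>\<omega> (Suc k) \<in> A\<close> joined to an event of the past is a cylinder, and its measure is read off from
  the last bind.
\<close>
theorem chain_law_markov_process:
  "markov_process S K (chain_law \<mu> m q z) path_history (\<lambda>k \<omega>. \<omega> k)"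
proof -
  let ?P = "chain_law \<mu> m q z" and ?Pi = "\<lambda>n. \<Pi>\<^sub>M i\<in>{0..<n::nat}. S"
  have rp: "(\<lambda>\<omega>. restrict \<omega> J) \<in> space ?P \<rightarrow> space (\<Pi>\<^sub>M i\<in>J. S)" for J
    using measurable_space[OF restrict_chain_law] by blast
  have "prob_space (distr ?P (?Pi 0) (\<lambda>\<omega>. restrict \<omega> {0..<0}))"
    unfolding chain_law_marginal by (rule IT.prob_space_C) (simp add: space_PiM)
  then interpret P: prob_space ?P
    by (rule prob_space_distrD[OF restrict_chain_law])
  have hist: "path_history k =
      vimage_algebra (space ?P) (\<lambda>\<omega>. restrict \<omega> {0..<Suc k}) (?Pi (Suc k))" for k
    by (simp add: path_history_def space_chain_law)
  show ?thesis
  proof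
    fix k
    show sub: "subalgebra ?P (path_history k)"
      unfolding subalgebra_def hist
      using measurable_sets[OF restrict_chain_law]
      by (auto simp: sets_vimage_algebra2[OF rp])
    show "sets (path_history k) \<subseteq> sets (path_history (Suc k))"
      unfolding hist
    proof (rule sets_vimage_algebra_subset[OF rp])
      show "(\<lambda>f. restrict f {0..<Suc k}) \<in> ?Pi (Suc (Suc k)) \<rightarrow>\<^sub>M ?Pi (Suc k)"
        by (rule measurable_restrict_subset) auto
    qed auto
    show "(\<lambda>\<omega>. \<omega> k) \<in> path_history k \<rightarrow>\<^sub>M S"
    proof -
      have "(\<lambda>\<omega>. restrict \<omega> {0..<Suc k}) \<in> path_history k \<rightarrow>\<^sub>M ?Pi (Suc k)"
        unfolding hist by (rule measurable_vimage_algebra1[OF rp])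
      from measurable_compose[OF this measurable_component_singleton[of k]] show ?thesis
        by simp
    qed
    fix B A assume "B \<in> sets (path_history k)" and A [measurable]: "A \<in> sets S"
    then obtain X where X [measurable]: "X \<in> sets (?Pi (Suc k))"
      and B: "B = (\<lambda>\<omega>. restrict \<omega> {0..<Suc k}) -` X \<inter> space ?P"
      by (auto simp: hist sets_vimage_algebra2[OF rp])
    let ?Y = "{x \<in> space (?Pi (Suc (Suc k))). restrict x {0..<Suc k} \<in> X \<and> x (Suc k) \<in> A}"
    let ?C = "\<lambda>n. IT.C 0 n (\<lambda>_. undefined)"
    have u: "(\<lambda>_. undefined) \<in> space (?Pi 0)" by (simp add: space_PiM)
    have [measurable]: "(\<lambda>x. restrict x {0..<Suc k}) \<in> ?Pi (Suc (Suc k)) \<rightarrow>\<^sub>M ?Pi (Suc k)"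
      by (rule measurable_restrict_subset) auto
    have [measurable]: "(\<lambda>x. x (Suc k)) \<in> ?Pi (Suc (Suc k)) \<rightarrow>\<^sub>M S"
      by (rule measurable_component_singleton) auto
    have Y: "?Y \<in> sets (?Pi (Suc (Suc k)))" by measurable
    have comp: "(\<lambda>x. x k) \<in> ?Pi (Suc k) \<rightarrow>\<^sub>M S"
      by (rule measurable_component_singleton) auto
    have KA: "(\<lambda>x. emeasure (K (x k)) A) \<in> borel_measurable (?Pi (Suc k))"
      by (rule measurable_compose[OF comp
            measurable_compose[OF kernel.kernel_subprob measurable_emeasure_subprob_algebra[OF A]]])
    have "emeasure ?P (B \<inter> {\<omega> \<in> space ?P. \<omega> (Suc k) \<in> A}) =
        emeasure ?P ((\<lambda>\<omega>. restrict \<omega> {0..<Suc (Suc k)}) -` ?Y \<inter> space ?P)"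
      using rp[of "{0..<Suc (Suc k)}"]
      by (intro arg_cong[where f="emeasure ?P"]) (auto simp: B Int_absorb1)
    also have "\<dots> = emeasure (distr ?P (?Pi (Suc (Suc k))) (\<lambda>\<omega>. restrict \<omega> {0..<Suc (Suc k)})) ?Y"
      by (rule emeasure_distr[OF restrict_chain_law Y, symmetric])
    also have "\<dots> = emeasure (?C (Suc k) \<bind> IT.eP (Suc k)) ?Y"
      by (simp only: chain_law_marginal IT.C.simps(2)[of 0 "Suc k"] add_0)
    also have "\<dots> = (\<integral>\<^sup>+ x. emeasure (IT.eP (Suc k) x) ?Y \<partial>?C (Suc k))"
    proof (rule emeasure_bind[OF _ _ Y])
      show "space (?C (Suc k)) \<noteq> {}"
        using prob_space.not_empty[OF IT.prob_space_C[OF u]] .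
      show "IT.eP (Suc k) \<in> ?C (Suc k) \<rightarrow>\<^sub>M subprob_algebra (?Pi (Suc (Suc k)))"
        using IT.measurable_eP[of "Suc k"] IT.sets_C[OF u, of "Suc k"]
        by (simp cong: measurable_cong_sets)
    qed
    also have "\<dots> = (\<integral>\<^sup>+ x. indicator X x * emeasure (K (x k)) A \<partial>?C (Suc k))"
    proof (rule nn_integral_cong)
      fix x assume "x \<in> space (?C (Suc k))"
      then have x: "x \<in> space (?Pi (Suc k))" using IT.space_C[OF u, of "Suc k"] by simp
      then have xk: "x k \<in> space S" and xr: "restrict x {0..<Suc k} = x"
        by (auto simp: space_PiM PiE_iff extensional_restrict)
      have "restrict (x(Suc k := w)) {0..<Suc k} = x" for w
        using xr by (auto simp: fun_eq_iff restrict_def split: if_splits)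
      moreover have "x(Suc k := w) \<in> space (?Pi (Suc (Suc k)))" if "w \<in> space S" for w
        using x that by (auto simp: space_PiM PiE_iff extensional_def)
      ultimately have "fun_upd x (Suc k) -` ?Y \<inter> space S = (if x \<in> X then A else {})"
        using sets.sets_into_space[OF A] by auto
      moreover have "emeasure (IT.eP (Suc k) x) ?Y = emeasure (K (x k)) (fun_upd x (Suc k) -` ?Y \<inter> space S)"
        using IT.emeasure_eP[OF x Y] by simp
      ultimately show "emeasure (IT.eP (Suc k) x) ?Y = indicator X x * emeasure (K (x k)) A"
        by simp
    qed
    also have "\<dots> = (\<integral>\<^sup>+ \<omega>. indicator X (restrict \<omega> {0..<Suc k}) *
        emeasure (K (restrict \<omega> {0..<Suc k} k)) A \<partial>?P)"
      unfolding chain_law_marginal[symmetric]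
      by (rule nn_integral_distr[OF restrict_chain_law]) (use KA in measurable)
    also have "\<dots> = (\<integral>\<^sup>+ \<omega>. indicator B \<omega> * emeasure (K (\<omega> k)) A \<partial>?P)"
      by (intro nn_integral_cong) (auto simp: B indicator_def)
    finally show "emeasure ?P (B \<inter> {\<omega> \<in> space ?P. \<omega> (Suc k) \<in> A}) =
        (\<integral>\<^sup>+ \<omega>. indicator B \<omega> * emeasure (K (\<omega> k)) A \<partial>?P)" .
  qed
qed

end

end

section \<open>Reachability, irreducibility and visits to open boxes\<close>

context pairwise_markov_model
begin

lemma box_measurable:
  assumes "open U" "I \<subseteq> {1..m}"
  shows "U \<times> I \<in> sets S"
  unfolding state_algebra_def using assms by (intro pair_measureI) auto

lemma emeasure_chain_law_path:
  assumes z: "z \<in> space S" and A: "\<And>i. A i \<in> sets S"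
  shows "emeasure (chain_law \<mu> m q z) {\<omega> \<in> space (chain_law \<mu> m q z). \<forall>i<n. \<omega> i \<in> A i} = path_prob K n A z"
proof -
  let ?P = "chain_law \<mu> m q z"
  interpret C: markov_process S K ?P path_history "\<lambda>k \<omega>. \<omega> k"
    using z by (rule chain_law_markov_process)
  have "{\<omega> \<in> space ?P. \<forall>i<n. \<omega> i \<in> A i} = space ?P \<inter> C.occurs n A 0"
    unfolding C.occurs_def add_0 by blast
  also have "emeasure ?P \<dots> = (\<integral>\<^sup>+ \<omega>. indicator (space ?P) \<omega> * path_prob K n A (\<omega> 0) \<partial>?P)"
    using sets.top[of "path_history 0"] A
    by (intro C.emeasure_occurs) (simp_all add: C.space_filtration)
  also have "\<dots> = (\<integral>\<^sup>+ \<omega>. path_prob K n A (\<omega> 0) \<partial>?P)"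
    by (intro nn_integral_cong) simp
  also have "\<dots> = path_prob K n A z"
    using z kernel.path_prob_measurable[OF A] by (rule chain_law_initial)
  finally show ?thesis .
qed

lemma step_prob_eq_path_prob:
  assumes z: "z \<in> space S" and G: "G \<in> sets S"
  shows "step_prob \<mu> m q (Suc k) z G = path_prob K (Suc k) (\<lambda>i. if i < k then space S else G) z"
proof -
  let ?P = "chain_law \<mu> m q z"
  interpret C: markov_process S K ?P path_history "\<lambda>k \<omega>. \<omega> k"
    by (rule chain_law_markov_process[OF z])
  have "{\<omega> \<in> space ?P. \<omega> (Suc k - 1) \<in> G} =
      {\<omega> \<in> space ?P. \<forall>i<Suc k. \<omega> i \<in> (if i < k then space S else G)}"
    by (auto simp: less_Suc_eq C.W_space)
  then show ?thesis
    unfolding step_prob_def using G by (simp only:) (rule emeasure_chain_law_path[OF z], auto)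
qed

lemma suminf_pos_obtain:
  fixes f :: "nat \<Rightarrow> ennreal"
  assumes "0 < (\<Sum>k. f k)"
  obtains k where "0 < f k"
proof -
  have "\<exists>k. f k \<noteq> 0" using assms by (rule contrapos_pp) simp
  then show thesis using that by (auto simp: zero_less_iff_neq_zero)
qed

lemma reachable_path_prob:
  assumes "reachable \<mu> m q (x, i)" "open U" "x \<in> U" and z: "z \<in> space S"
  obtains k where "0 < path_prob K (Suc (Suc k)) (\<lambda>l. if l < Suc k then space S else U \<times> {i}) z"
proof -
  have i: "i \<in> {1..m}" using assms(1) by (simp add: reachable_def space_S)
  have "open (U \<times> {i})" using assms(2) by (auto intro!: open_Times intro: discrete_topology_class.open_discrete)
  moreover have "U \<times> {i} \<subseteq> space S" using i by (auto simp: space_S)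
  ultimately have "0 < (\<Sum>k. step_prob \<mu> m q (k + 2) z (U \<times> {i}))"
    using assms by (auto simp: reachable_def)
  then obtain k where "0 < step_prob \<mu> m q (k + 2) z (U \<times> {i})"
    by (rule suminf_pos_obtain)
  then show thesis
    using step_prob_eq_path_prob[OF z box_measurable[OF assms(2)], of "{i}" "Suc k"] i that
    by simp
qed

text \<open>
  A reachable point can be visited from everywhere, so whatever can be followed from a whole
  neighbourhood of it can be followed, after a delay, from everywhere.
\<close>
lemma reach_then_follow:
  assumes "reachable \<mu> m q (x, i)" "open U" "x \<in> U" and z: "z \<in> space S"
    and B: "\<And>l. B l \<in> sets S" and pos: "\<And>u. u \<in> U \<Longrightarrow> 0 < path_prob K n B (u, i)"
  obtains k where "0 < path_prob K (Suc k + n) (\<lambda>l. if l < Suc k then space S else B (l - Suc k)) z"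
proof -
  have i: "i \<in> {1..m}" using assms(1) by (simp add: reachable_def space_S)
  let ?A = "\<lambda>k l. if l < Suc k then space S else U \<times> {i}"
  obtain k where k: "0 < path_prob K (Suc (Suc k)) (?A k) z"
    using reachable_path_prob[OF assms(1-4)] .
  have "?A k l \<in> sets S" for l
    using box_measurable[OF assms(2), of "{i}"] i by simp
  then have "0 < path_prob K (Suc k + n) (\<lambda>l. if l < Suc k then ?A k l else B (l - Suc k)) z"
    using B z k by (rule kernel.path_prob_pos_append) (use pos in auto)
  also have "path_prob K (Suc k + n) (\<lambda>l. if l < Suc k then ?A k l else B (l - Suc k)) z =
      path_prob K (Suc k + n) (\<lambda>l. if l < Suc k then space S else B (l - Suc k)) z"
    by (rule path_prob_cong) auto
  finally show thesis by (rule that)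
qed

lemma successor_exists:
  assumes "z \<in> space S"
  shows "\<exists>w\<in>space S. 0 < q w z"
proof (rule ccontr)
  assume "\<not> ?thesis"
  then have "(\<integral>\<^sup>+ w. ennreal (q w z) \<partial>(\<mu> \<Otimes>\<^sub>M count_space {1..m})) = (\<integral>\<^sup>+ w. 0 \<partial>(\<mu> \<Otimes>\<^sub>M count_space {1..m}))"
    by (intro nn_integral_cong) (auto simp: space_base[simplified] ennreal_eq_0_iff not_less)
  with q_density[OF assms] show False by simp
qed

text \<open>
  The probabilities of avoiding \<open>A\<close> for \<open>n\<close> steps decrease to the probability of never visiting \<open>A\<close>,
  which is zero when \<open>A\<close> is visited infinitely often.
\<close>
lemma harris_escape:
  assumes A: "A \<in> sets S" and z: "z \<in> space S"
    and io: "emeasure (chain_law \<mu> m q z) {\<omega> \<in> space (chain_law \<mu> m q z). \<exists>\<^sub>\<infinity>k. \<omega> k \<in> A} = 1"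
  shows "(\<lambda>n. path_prob K n (\<lambda>_. space S - A) z) \<longlonglongrightarrow> 0"
proof -
  let ?P = "chain_law \<mu> m q z"
  interpret C: markov_process S K ?P path_history "\<lambda>k \<omega>. \<omega> k"
    by (rule chain_law_markov_process[OF z])
  have A': "A \<in> sets S" "space S - A \<in> sets S" using A by auto
  define N where "N n = {\<omega> \<in> space ?P. \<forall>i<n. \<omega> i \<in> space S - A}" for n :: nat
  have N: "N n \<in> sets ?P" for n
  proof -
    have "N n = {\<omega> \<in> space ?P. \<forall>i\<in>{..<n}. \<omega> i \<in> space S - A}"
      unfolding N_def by blast
    also have "\<dots> \<in> sets ?P"
      using C.filtration_event[OF C.W_event[OF A'(2) order.refl]]
      by (intro sets.sets_Collect_finite_All) auto
    finally show ?thesis .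
  qed
  define I where "I = {\<omega> \<in> space ?P. \<exists>\<^sub>\<infinity>k. \<omega> k \<in> A}"
  have I1: "emeasure ?P I = 1" using io by (simp only: I_def)
  then have I: "I \<in> sets ?P"
    using emeasure_notin_sets[of I ?P] by fastforce
  have "emeasure ?P (space ?P - I) = 0"
    using I1 emeasure_compl[OF I] by (simp add: C.emeasure_space_1)
  moreover have "(\<Inter>n. N n) \<subseteq> space ?P - I"
    unfolding N_def I_def INFM_nat by blast
  moreover have "space ?P - I \<in> sets ?P" using I by blast
  ultimately have "emeasure ?P (\<Inter>n. N n) = 0"
    using emeasure_mono[of "\<Inter>n. N n" "space ?P - I" ?P] by (metis le_zero_eq)
  moreover have "(\<lambda>n. emeasure ?P (N n)) \<longlonglongrightarrow> emeasure ?P (\<Inter>n. N n)"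
  proof (rule Lim_emeasure_decseq)
    show "range N \<subseteq> sets ?P" using N by blast
    show "decseq N" unfolding decseq_def N_def by (blast intro: less_le_trans)
  qed (simp only: C.emeasure_finite not_False_eq_True infinity_ennreal_def)
  moreover have "emeasure ?P (N n) = path_prob K n (\<lambda>_. space S - A) z" for n
    unfolding N_def by (rule emeasure_chain_law_path[OF z A'(2)])
  ultimately show ?thesis by simp
qed

text \<open>
  Positivity of transition probabilities is read off from the density: it has to be positive, together
  with the integrand, on a set of positive base measure.
\<close>
lemma K_integral_pos:
  assumes z: "z \<in> space S" and f: "f \<in> borel_measurable S"
    and A: "A \<in> sets S" "0 < emeasure (\<mu> \<Otimes>\<^sub>M count_space {1..m}) A"
    and pos: "\<And>w. w \<in> A \<Longrightarrow> 0 < q w z \<and> 0 < f w"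
  shows "0 < (\<integral>\<^sup>+ w. f w \<partial>K z)"
proof (rule ccontr)
  let ?b = "\<mu> \<Otimes>\<^sub>M count_space {1..m}"
  have "(\<lambda>w. ennreal (q w z) * f w) \<in> borel_measurable ?b"
    using q_section_measurable[OF z] f
    by (intro borel_measurable_times_ennreal) (simp_all cong: measurable_cong_sets add: sets_base[simplified])
  moreover assume "\<not> 0 < (\<integral>\<^sup>+ w. f w \<partial>K z)"
  then have "(\<integral>\<^sup>+ w. ennreal (q w z) * f w \<partial>?b) = 0"
    using nn_integral_K[OF z f] by (simp add: zero_less_iff_neq_zero)
  ultimately have "AE w in ?b. ennreal (q w z) * f w = 0"
    using nn_integral_0_iff_AE by blast
  then have "AE w in ?b. w \<notin> A"
    by eventually_elim (use pos in \<open>fastforce simp: ennreal_eq_0_iff\<close>)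
  then have "emeasure ?b A = 0"
    using A(1) sets.sets_into_space[OF A(1)]
    by (subst (asm) AE_iff_measurable[where N=A]) (auto simp: sets_base[simplified] space_base[simplified])
  with A(2) show False by simp
qed

end

locale lsc_pairwise_markov_model = pairwise_markov_model \<Omega> \<mu> m q Z
  for \<Omega> :: "'w measure" and \<mu> :: "'x::{metric_space, second_countable_topology} measure"
    and m q Z +
  assumes mu_pos: "strictly_positive_measure \<mu>"
    and q_lsc: "\<And>i j. i \<in> {1..m} \<Longrightarrow> j \<in> {1..m} \<Longrightarrow>
      lower_semicontinuous (\<lambda>(x, x'). q (x, i) (x', j))"
begin

lemma q_positive_nbhd:
  assumes "i \<in> {1..m}" "j \<in> {1..m}" "0 < q (x, i) (x', j)"
  obtains U V where "open U" "open V" "x \<in> U" "x' \<in> V"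
    "\<And>u v. u \<in> U \<Longrightarrow> v \<in> V \<Longrightarrow> 0 < q (u, i) (v, j)"
proof -
  have "\<forall>\<^sub>F p in nhds (x, x'). 0 < (\<lambda>(x, x'). q (x, i) (x', j)) p"
    using q_lsc[OF assms(1,2)] assms(3) unfolding lower_semicontinuous_def by auto
  then obtain T where T: "open T" "(x, x') \<in> T" "\<And>p. p \<in> T \<Longrightarrow> 0 < (\<lambda>(x, x'). q (x, i) (x', j)) p"
    unfolding eventually_nhds by blast
  obtain U V where UV: "open U" "open V" "x \<in> U" "x' \<in> V" "U \<times> V \<subseteq> T"
    using T(1,2) by (rule open_prod_elim) blast
  have "0 < q (u, i) (v, j)" if "u \<in> U" "v \<in> V" for u v
    using T(3)[of "(u, v)"] UV(5) that by auto
  with UV show thesis by (intro that[of U V])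
qed

lemma emeasure_base_open_pos:
  assumes "open U" "U \<noteq> {}" "j \<in> {1..m}"
  shows "0 < emeasure (\<mu> \<Otimes>\<^sub>M count_space {1..m}) (U \<times> {j})"
proof -
  interpret c: sigma_finite_measure "count_space {1..m}"
    by (rule sigma_finite_measure_count_space_finite) simp
  have "emeasure (\<mu> \<Otimes>\<^sub>M count_space {1..m}) (U \<times> {j}) = emeasure \<mu> U * emeasure (count_space {1..m}) {j}"
    using assms by (intro c.emeasure_pair_measure_Times) (auto simp: sets_mu)
  with assms mu_pos show ?thesis
    by (simp add: strictly_positive_measure_def)
qed

text \<open>
  By lower semi-continuity every edge of a positive walk stays positive when both ends move a little,
  and open sets are charged by \<open>\<mu>\<close>. Hence a positive walk through open sets is followed with positive
  probability, and this remains true for all starting points near the first one.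
\<close>
lemma path_prob_pos_nbhd:
  assumes "\<And>i. i \<in> {1..M} \<Longrightarrow> open (U i) \<and> x i \<in> U i \<and> y i \<in> {1..m}"
    and "\<And>i. i \<in> {2..M} \<Longrightarrow> 0 < q (x i, y i) (x (i - 1), y (i - 1))"
    and "1 \<le> M"
  shows "\<exists>V. open V \<and> x 1 \<in> V \<and>
    (\<forall>u\<in>V. 0 < path_prob K M (\<lambda>i. if i < M then U (Suc i) \<times> {1..m} else {}) (u, y 1))"
  using assms
proof (induction M arbitrary: x y U)
  case (Suc M)
  have U1: "open (U 1)" "x 1 \<in> U 1" "y 1 \<in> {1..m}"
    using Suc.prems(1)[of 1] by auto
  show ?case
  proof (cases "M = 0")
    case True
    have "0 < path_prob K (Suc 0) (\<lambda>i. if i < Suc 0 then U (Suc i) \<times> {1..m} else {}) (u, y 1)"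
      if "u \<in> U 1" for u
      using kernel.prob_space_kernel[of "(u, y 1)"] U1 that
      by (simp add: prob_space.emeasure_space_1 space_S)
    then show ?thesis
      using U1 by (intro exI[of _ "U 1"]) (simp add: True)
  next
    case False
    let ?A = "\<lambda>i. if i < M then U (Suc (Suc i)) \<times> {1..m} else {}"
    have "\<exists>V. open V \<and> x (Suc 1) \<in> V \<and> (\<forall>u\<in>V. 0 < path_prob K M ?A (u, y (Suc 1)))"
    proof (rule Suc.IH[of "\<lambda>i. U (Suc i)" "\<lambda>i. x (Suc i)" "\<lambda>i. y (Suc i)"])
      show "open (U (Suc i)) \<and> x (Suc i) \<in> U (Suc i) \<and> y (Suc i) \<in> {1..m}" if "i \<in> {1..M}" for i
        using that by (intro Suc.prems(1)) auto
      show "0 < q (x (Suc i), y (Suc i)) (x (Suc (i - 1)), y (Suc (i - 1)))" if "i \<in> {2..M}" for i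
        using that Suc.prems(2)[of "Suc i"] by (simp add: Suc_diff_Suc numeral_2_eq_2 Suc_le_eq)
    qed (use False in auto)
    then obtain V where V: "open V" "x 2 \<in> V" "\<And>u. u \<in> V \<Longrightarrow> 0 < path_prob K M ?A (u, y 2)"
      by (auto simp: numeral_2_eq_2)
    have y2: "y 2 \<in> {1..m}" and q: "0 < q (x 2, y 2) (x 1, y 1)"
      using Suc.prems(1)[of 2] Suc.prems(2)[of 2] False by auto
    obtain U2 V1 where UV: "open U2" "open V1" "x 2 \<in> U2" "x 1 \<in> V1"
      "\<And>u v. u \<in> U2 \<Longrightarrow> v \<in> V1 \<Longrightarrow> 0 < q (u, y 2) (v, y 1)"
      using q_positive_nbhd[OF y2 U1(3) q] by metis
    have "0 < path_prob K (Suc M) (\<lambda>i. if i < Suc M then U (Suc i) \<times> {1..m} else {}) (u, y 1)"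
      if u: "u \<in> V1 \<inter> U 1" for u
    proof -
      have mA: "?A i \<in> sets S" for i
        using Suc.prems(1)[of "Suc (Suc i)"] by (auto intro!: box_measurable)
      have "0 < (\<integral>\<^sup>+ w. path_prob K M ?A w \<partial>K (u, y 1))"
      proof (rule K_integral_pos[where A="(U2 \<inter> V) \<times> {y 2}"])
        show "0 < emeasure (\<mu> \<Otimes>\<^sub>M count_space {1..m}) ((U2 \<inter> V) \<times> {y 2})"
          using UV V y2 by (intro emeasure_base_open_pos) auto
        show "(U2 \<inter> V) \<times> {y 2} \<in> sets S"
          using UV V y2 by (intro box_measurable) auto
      qed (use u UV V U1 in \<open>auto simp: space_S intro!: kernel.path_prob_measurable mA\<close>)
      then show ?thesis
        using u U1 by (simp add: indicator_def)
    qed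
    then show ?thesis
      using UV U1 by (intro exI[of _ "V1 \<inter> U 1"]) auto
  qed
qed simp

text \<open>
  If one step leads with positive density from a neighbourhood \<open>V\<close> of a reachable point onto \<open>U\<close>, then
  from everywhere the chain first reaches \<open>V\<close> and then enters any prescribed subset of \<open>U\<close> that has
  positive base measure.
\<close>
lemma irreducible_restricted_base:
  assumes "reachable \<mu> m q (x, i)" and UV: "open U" "open V" "x \<in> V" and j: "j \<in> {1..m}"
    and pos: "\<And>u v. u \<in> U \<Longrightarrow> v \<in> V \<Longrightarrow> 0 < q (u, j) (v, i)"
  shows "irreducible_wrt \<mu> m q (density (\<mu> \<Otimes>\<^sub>M count_space {1..m}) (indicator (U \<times> {j})))"
proof -
  let ?b = "\<mu> \<Otimes>\<^sub>M count_space {1..m}"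
  interpret b: sigma_finite_measure ?b by (rule sigma_finite_base)
  have i: "i \<in> {1..m}" using assms(1) by (simp add: reachable_def space_S)
  have Uj: "U \<times> {j} \<in> sets S" using UV j by (intro box_measurable) auto
  then have Ujb: "U \<times> {j} \<in> sets ?b" by (simp add: sets_base[simplified])
  have dens: "emeasure (density ?b (indicator (U \<times> {j}))) A = emeasure ?b (A \<inter> U \<times> {j})" if "A \<in> sets S" for A
  proof -
    have "A \<in> sets ?b" using that by (simp add: sets_base[simplified])
    with Ujb show ?thesis
      by (simp only: emeasure_restricted Int_commute)
  qed
  have "0 < (\<Sum>k. step_prob \<mu> m q (k + 2) z A)"
    if A: "A \<in> sets S" "0 < emeasure (density ?b (indicator (U \<times> {j}))) A" and z: "z \<in> space S" for A z
  proof -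
    let ?B = "\<lambda>l. if l = (0::nat) then space S else A"
    have "0 < path_prob K 2 ?B (v, i)" if v: "v \<in> V" for v
    proof -
      have vi: "(v, i) \<in> space S" using i by (simp add: space_S)
      have Kw: "emeasure (K w) (space (K w)) = 1" if "w \<in> A" for w
        using kernel.prob_space_kernel[of w] sets.sets_into_space[OF A(1)] that
        by (auto intro: prob_space.emeasure_space_1)
      have "0 < (\<integral>\<^sup>+ w. path_prob K (Suc 0) (\<lambda>_. A) w \<partial>K (v, i))"
      proof (rule K_integral_pos[OF vi, where A="A \<inter> U \<times> {j}"])
        show "0 < emeasure ?b (A \<inter> U \<times> {j})" using A dens by simp
      qed (use A Uj pos v in \<open>auto intro!: kernel.path_prob_measurable simp: Kw simp del: path_prob.simps(2),
            auto simp: Kw\<close>)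
      then show ?thesis using vi by (simp add: numeral_2_eq_2)
    qed
    moreover have "?B l \<in> sets S" for l using A by auto
    ultimately obtain k where
      "0 < path_prob K (Suc k + 2) (\<lambda>l. if l < Suc k then space S else ?B (l - Suc k)) z"
      using reach_then_follow[OF assms(1) UV(2,3) z, of ?B 2] by auto
    also have "path_prob K (Suc k + 2) (\<lambda>l. if l < Suc k then space S else ?B (l - Suc k)) z =
        path_prob K (Suc (k + 2)) (\<lambda>l. if l < k + 2 then space S else A) z"
      unfolding add_Suc by (rule path_prob_cong) auto
    also have "\<dots> = step_prob \<mu> m q (Suc k + 2) z A"
      using step_prob_eq_path_prob[OF z A(1), of "k + 2"] by simp
    also have "\<dots> \<le> (\<Sum>k. step_prob \<mu> m q (k + 2) z A)"
      using sum_le_suminf[of "\<lambda>k. step_prob \<mu> m q (k + 2) z A" "{Suc k}"] by simp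
    finally show ?thesis .
  qed
  moreover have "sigma_finite_measure (density ?b (indicator (U \<times> {j})))"
  proof -
    have ind: "(indicator (U \<times> {j}) :: _ \<Rightarrow> ennreal) \<in> borel_measurable ?b"
      using Ujb by (rule borel_measurable_indicator)
    have "AE w in ?b. (indicator (U \<times> {j}) w :: ennreal) \<noteq> \<infinity>"
      by (rule AE_I2) (simp add: indicator_def)
    with b.sigma_finite_iff_density_finite[OF ind] show ?thesis by (simp only:)
  qed
  ultimately show ?thesis
    unfolding irreducible_wrt_def sets_density sets_base by blast
qed

text \<open>
  The zero measure is trivially an irreducibility measure, so Harris recurrence says something only
  once some irreducibility measure is nonzero. A reachable point has a successor of positive density,
  and the base measure near that successor is such a measure.
\<close>
lemma maximal_irreducibility_measure_nonzero:
  assumes z0: "reachable \<mu> m q z0" and \<psi>: "maximal_irreducibility_measure \<mu> m q \<psi>"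
  shows "0 < emeasure \<psi> (space S)"
proof -
  let ?b = "\<mu> \<Otimes>\<^sub>M count_space {1..m}"
  obtain x i where xi: "z0 = (x, i)" by fastforce
  have z0S: "z0 \<in> space S" using z0 by (simp add: reachable_def)
  obtain u j where uj: "(u, j) \<in> space S" "0 < q (u, j) (x, i)"
    using successor_exists[OF z0S] by (auto simp: xi)
  then obtain U V where UV: "open U" "open V" "u \<in> U" "x \<in> V"
      "\<And>u v. u \<in> U \<Longrightarrow> v \<in> V \<Longrightarrow> 0 < q (u, j) (v, i)"
    using q_positive_nbhd[of j i u x] z0S by (auto simp: space_S xi)
  have j: "j \<in> {1..m}" using uj by (simp add: space_S)
  let ?\<phi> = "density ?b (indicator (U \<times> {j}))"
  have "irreducible_wrt \<mu> m q ?\<phi>"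
    by (rule irreducible_restricted_base[OF z0[unfolded xi] UV(1,2,4) j UV(5)])
  then have ac: "absolutely_continuous \<psi> ?\<phi>" and sets\<psi>: "sets \<psi> = sets S"
    using \<psi> by (auto simp: maximal_irreducibility_measure_def irreducible_wrt_def)
  have Uj: "U \<times> {j} \<in> sets S" using UV j by (intro box_measurable) auto
  have "emeasure ?\<phi> (U \<times> {j}) = emeasure ?b (U \<times> {j})"
    using Uj emeasure_restricted[of "U \<times> {j}" ?b "U \<times> {j}"] by (simp add: sets_base[simplified])
  then have "emeasure ?\<phi> (U \<times> {j}) \<noteq> 0"
    using emeasure_base_open_pos[of U j] UV j by force
  then have "0 < emeasure \<psi> (U \<times> {j})"
    unfolding zero_less_iff_neq_zero
    using ac Uj sets\<psi> by (auto simp: absolutely_continuous_def null_sets_def)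
  also have "emeasure \<psi> (U \<times> {j}) \<le> emeasure \<psi> (space S)"
    using Uj sets\<psi> sets.sets_into_space[OF Uj] by (intro emeasure_mono) auto
  finally show ?thesis .
qed

text \<open>
  From every point the box is visited, with some delay \<open>r\<close>, with positive probability. Sorting the
  points by the delay and by a lower bound \<open>1 / (n + 1)\<close> of this probability splits the state space into
  countably many sets \<open>A r n\<close>, one of which is charged by the nonzero maximal irreducibility measure.
  Harris recurrence brings the chain back to that set infinitely often, and each visit is a new chance
  of at least \<open>1 / (n + 1)\<close> to run through the box.
\<close>
theorem box_visited_infinitely_often:
  assumes harris: "harris_recurrent \<mu> m q"
    and U: "\<And>i. i \<in> {1..M} \<Longrightarrow> open (U i) \<and> x i \<in> U i \<and> y i \<in> {1..m}"
    and walk: "\<And>i. i \<in> {2..M} \<Longrightarrow> 0 < q (x i, y i) (x (i - 1), y (i - 1))"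
    and M: "1 \<le> M" and start: "reachable \<mu> m q (x 1, y 1)"
  shows "measure \<Omega> (io_event \<Omega> Z M (PiE {1..M} U)) = 1"
proof -
  obtain \<psi> where \<psi>: "maximal_irreducibility_measure \<mu> m q \<psi>"
    and io: "\<And>A z. A \<in> sets S \<Longrightarrow> 0 < emeasure \<psi> A \<Longrightarrow> z \<in> space S \<Longrightarrow>
        emeasure (chain_law \<mu> m q z) {\<omega> \<in> space (chain_law \<mu> m q z). \<exists>\<^sub>\<infinity>k. \<omega> k \<in> A} = 1"
    using harris unfolding harris_recurrent_def by blast
  have sets\<psi>: "sets \<psi> = sets S"
    using \<psi> by (auto simp: maximal_irreducibility_measure_def irreducible_wrt_def)
  let ?B = "\<lambda>i. if i < M then U (Suc i) \<times> {1..m} else {}"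
  let ?D = "\<lambda>r i. if i < r then space S else ?B (i - r)"
  have B: "?B i \<in> sets S" for i
    using U[of "Suc i"] by (auto intro!: box_measurable)
  have D: "?D r i \<in> sets S" for r i
    using B by auto
  obtain V where V: "open V" "x 1 \<in> V" "\<And>u. u \<in> V \<Longrightarrow> 0 < path_prob K M ?B (u, y 1)"
    using path_prob_pos_nbhd[of M U x y, OF U walk M] by blast
  \<comment> \<open>\<open>?D r\<close> is the box preceded by \<open>r\<close> unconstrained positions\<close>
  have some: "\<exists>r. 0 < path_prob K (r + M) (?D r) z" if "z \<in> space S" for z
    using reach_then_follow[OF start V(1,2) that B V(3)] by blast
  define A where "A r n = {z \<in> space S. ennreal (1 / real (Suc n)) \<le> path_prob K (r + M) (?D r) z}" for r n
  have A: "A r n \<in> sets S" for r n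
  proof -
    have [measurable]: "path_prob K (r + M) (?D r) \<in> borel_measurable S"
      using D by (rule kernel.path_prob_measurable)
    show ?thesis unfolding A_def by measurable
  qed
  have "\<exists>r n. 0 < emeasure \<psi> (A r n)"
  proof (rule ccontr)
    assume "\<not> ?thesis"
    then have "A r n \<in> null_sets \<psi>" for r n
      using A sets\<psi> by (auto simp: zero_less_iff_neq_zero)
    then have "(\<Union>r. \<Union>n. A r n) \<in> null_sets \<psi>"
      by (intro null_sets_UN) auto
    moreover have "space S \<subseteq> (\<Union>r. \<Union>n. A r n)"
    proof
      fix z assume z: "z \<in> space S"
      then obtain r where r: "0 < path_prob K (r + M) (?D r) z" using some by blast
      have "path_prob K (r + M) (?D r) z \<le> 1"
        using z by (rule kernel.path_prob_le_1)
      then obtain p where p: "path_prob K (r + M) (?D r) z = ennreal p" "0 \<le> p"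
        by (cases "path_prob K (r + M) (?D r) z") (auto simp: top_unique)
      with r have "0 < p" by simp
      then obtain n where "inverse (real (Suc n)) < p"
        using reals_Archimedean by blast
      then have "z \<in> A r n"
        using z p by (simp add: A_def inverse_eq_divide)
      then show "z \<in> (\<Union>r. \<Union>n. A r n)" by blast
    qed
    ultimately have "emeasure \<psi> (space S) = 0"
      by (metis null_setsD1 null_sets_subset sets.top sets\<psi>)
    with maximal_irreducibility_measure_nonzero[OF start \<psi>] show False by simp
  qed
  then obtain r n where rn: "0 < emeasure \<psi> (A r n)" by blast
  interpret Zm: markov_process S K \<Omega> history "\<lambda>k. Z (k + 1)"
    by (rule Z_markov_process)
  have "AE \<omega> in \<Omega>. \<forall>t. \<exists>l\<ge>t. \<omega> \<in> Zm.occurs (r + M) (?D r) l"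
  proof (rule Zm.occurs_infinitely_often)
    show "AE \<omega> in \<Omega>. \<forall>t. \<exists>k\<ge>t. Z (k + 1) \<omega> \<in> A r n"
      by (rule Zm.AE_hits_infinitely_often) (use A rn io in \<open>auto intro!: harris_escape\<close>)
    show "ennreal (1 / real (Suc n)) \<le> path_prob K (r + M) (?D r) z" if "z \<in> A r n" for z
      using that by (simp add: A_def)
  qed (use A D in auto)
  then have "AE \<omega> in \<Omega>. \<omega> \<in> io_event \<Omega> Z M (PiE {1..M} U)"
    using AE_space
  proof eventually_elim
    case (elim \<omega>)
    have "\<exists>l\<ge>k. (\<lambda>i\<in>{1..M}. fst (Z (l + i - 1) \<omega>)) \<in> PiE {1..M} U" if "1 \<le> k" for k
    proof -
      obtain l where l: "k \<le> l" "\<omega> \<in> Zm.occurs (r + M) (?D r) l" using elim(1) by blast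
      have "fst (Z (l + r + 1 + i - 1) \<omega>) \<in> U i" if i: "i \<in> {1..M}" for i
      proof -
        have "r + (i - 1) < r + M" using i by auto
        with l(2) have "Z (l + (r + (i - 1)) + 1) \<omega> \<in> ?D r (r + (i - 1))"
          unfolding Zm.occurs_def by blast
        moreover have "?D r (r + (i - 1)) = U i \<times> {1..m}"
          using i by auto
        moreover have "l + (r + (i - 1)) + 1 = l + r + 1 + i - 1"
          using i by auto
        ultimately show ?thesis by (metis mem_Times_iff)
      qed
      then show ?thesis
        using l(1) by (intro exI[of _ "l + r + 1"]) auto
    qed
    with elim(2) show ?case by (auto simp: io_event_def)
  qed
  moreover have "io_event \<Omega> Z M (PiE {1..M} U) \<in> sets \<Omega>"
  proof -
    have window: "{\<omega> \<in> space \<Omega>. (\<lambda>i\<in>{1..M}. fst (Z (l + i - 1) \<omega>)) \<in> PiE {1..M} U} \<in> sets \<Omega>"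
      if "1 \<le> l" for l
    proof -
      have "{\<omega> \<in> space \<Omega>. (\<lambda>i\<in>{1..M}. fst (Z (l + i - 1) \<omega>)) \<in> PiE {1..M} U} =
          {\<omega> \<in> space \<Omega>. \<forall>i\<in>{1..M}. Z (l + i - 1) \<omega> \<in> U i \<times> {1..m}}"
        using that measurable_space[OF Z_measurable] by (auto simp: space_S PiE_iff mem_Times_iff)
      also have "\<dots> \<in> sets \<Omega>"
      proof (rule sets.sets_Collect_finite_All')
        fix i assume i: "i \<in> {1..M}"
        have "U i \<times> {1..m} \<in> sets S" using U[OF i] by (intro box_measurable) auto
        with Z_measurable[of "l + i - 1"] i that
        show "{\<omega> \<in> space \<Omega>. Z (l + i - 1) \<omega> \<in> U i \<times> {1..m}} \<in> sets \<Omega>"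
          by (auto simp: measurable_def vimage_def Int_def conj_commute)
      qed (use M in auto)
      finally show ?thesis .
    qed
    have "(\<Union>l\<in>{k..}. {\<omega> \<in> space \<Omega>. (\<lambda>i\<in>{1..M}. fst (Z (l + i - 1) \<omega>)) \<in> PiE {1..M} U}) \<in> sets \<Omega>"
      if "1 \<le> k" for k
    proof (rule sets.countable_UN'')
      fix l assume "l \<in> {k..}"
      then show "{\<omega> \<in> space \<Omega>. (\<lambda>i\<in>{1..M}. fst (Z (l + i - 1) \<omega>)) \<in> PiE {1..M} U} \<in> sets \<Omega>"
        using that by (intro window) simp
    qed simp
    then show ?thesis
      unfolding io_event_def by (intro sets.countable_INT') blast+
  qed
  ultimately show ?thesis
    by (subst prob_eq_1)
qed

end

section \<open>Positive label paths and their stability\<close>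

context pairwise_markov_model
begin

text \<open>
  Labels along \<open>x a, \<dots>, x b\<close> that start with \<open>i\<close>, end with \<open>j\<close> and use only edges of positive density.
  The positivity of \<open>p\<^sub>i\<^sub>j\<close> is a relation of this kind, and unlike the maximum it can be cut, glued and
  shifted freely.
\<close>
definition linked :: "(nat \<Rightarrow> 'x) \<Rightarrow> nat \<Rightarrow> nat \<Rightarrow> nat \<Rightarrow> nat \<Rightarrow> bool"
  where "linked x a b i j \<longleftrightarrow> (\<exists>y. y a = i \<and> y b = j \<and> (\<forall>k\<in>{a..b}. y k \<in> {1..m}) \<and>
    (\<forall>k\<in>{a<..b}. 0 < q (x k, y k) (x (k - 1), y (k - 1))))"

lemma linked_labels: "linked x a b i j \<Longrightarrow> a \<le> b \<Longrightarrow> i \<in> {1..m} \<and> j \<in> {1..m}"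
  unfolding linked_def by force

lemma linked_cong:
  assumes "\<And>k. k \<in> {a..b} \<Longrightarrow> x k = x' k"
  shows "linked x a b i j \<longleftrightarrow> linked x' a b i j"
proof -
  have "x k = x' k \<and> x (k - 1) = x' (k - 1)" if "k \<in> {a<..b}" for k
  proof -
    have "k \<in> {a..b}" "k - 1 \<in> {a..b}" using that by auto
    then show ?thesis using assms by blast
  qed
  then have "(\<forall>k\<in>{a<..b}. 0 < q (x k, y k) (x (k - 1), y (k - 1))) \<longleftrightarrow>
      (\<forall>k\<in>{a<..b}. 0 < q (x' k, y k) (x' (k - 1), y (k - 1)))" for y
    by (intro ball_cong) simp_all
  then show ?thesis unfolding linked_def by (simp only:)
qed

lemma linked_trans:
  assumes "linked x a b i j" "linked x b c j k" "a \<le> b" "b \<le> c"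
  shows "linked x a c i k"
proof -
  obtain y where y: "y a = i" "y b = j" "\<forall>k\<in>{a..b}. y k \<in> {1..m}"
    "\<forall>k\<in>{a<..b}. 0 < q (x k, y k) (x (k - 1), y (k - 1))"
    using assms(1) unfolding linked_def by blast
  obtain z where z: "z b = j" "z c = k" "\<forall>k\<in>{b..c}. z k \<in> {1..m}"
    "\<forall>k\<in>{b<..c}. 0 < q (x k, z k) (x (k - 1), z (k - 1))"
    using assms(2) unfolding linked_def by blast
  let ?w = "\<lambda>k. if k \<le> b then y k else z k"
  have "?w a = i" "?w c = k" using y z assms by auto
  moreover have "?w l \<in> {1..m}" if "l \<in> {a..c}" for l
    using y(3) z(3) that by auto
  moreover have "0 < q (x l, ?w l) (x (l - 1), ?w (l - 1))" if "l \<in> {a<..c}" for l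
  proof (cases "l \<le> b")
    case True
    then show ?thesis using y(4) that by auto
  next
    case False
    then have "?w (l - 1) = z (l - 1)" using y(2) z(1) by (cases "l - 1 = b") auto
    then show ?thesis using False z(4) that by auto
  qed
  ultimately show ?thesis unfolding linked_def by (intro exI[of _ ?w] conjI ballI)
qed

lemma linked_split:
  assumes "linked x a c i k" "a \<le> b" "b \<le> c"
  obtains j where "linked x a b i j" "linked x b c j k"
proof -
  obtain y where y: "y a = i" "y c = k" "\<forall>k\<in>{a..c}. y k \<in> {1..m}"
    "\<forall>k\<in>{a<..c}. 0 < q (x k, y k) (x (k - 1), y (k - 1))"
    using assms(1) unfolding linked_def by blast
  have "linked x a b i (y b)" "linked x b c (y b) k"
    unfolding linked_def using y assms by (auto intro!: exI[of _ y])
  then show thesis by (rule that)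
qed

lemma linked_shift: "linked (\<lambda>k. x (k + d)) a b i j \<longleftrightarrow> linked x (a + d) (b + d) i j"
proof
  assume "linked (\<lambda>k. x (k + d)) a b i j"
  then obtain y where y: "y a = i" "y b = j" "\<forall>k\<in>{a..b}. y k \<in> {1..m}"
    "\<forall>k\<in>{a<..b}. 0 < q (x (k + d), y k) (x (k - 1 + d), y (k - 1))"
    unfolding linked_def by blast
  have "0 < q (x k, y (k - d)) (x (k - 1), y (k - 1 - d))" if "k \<in> {a + d<..b + d}" for k
  proof -
    have "k - d \<in> {a<..b}" "k - d + d = k" "k - d - 1 + d = k - 1" "k - 1 - d = k - d - 1"
      using that by auto
    then show ?thesis using y(4) by metis
  qed
  moreover have "y (k - d) \<in> {1..m}" if "k \<in> {a + d..b + d}" for k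
  proof -
    have "k - d \<in> {a..b}" using that by auto
    then show ?thesis using y(3) by blast
  qed
  ultimately show "linked x (a + d) (b + d) i j"
    unfolding linked_def using y(1,2) by (intro exI[of _ "\<lambda>k. y (k - d)"] conjI ballI) simp_all
next
  assume "linked x (a + d) (b + d) i j"
  then obtain y where y: "y (a + d) = i" "y (b + d) = j" "\<forall>k\<in>{a + d..b + d}. y k \<in> {1..m}"
    "\<forall>k\<in>{a + d<..b + d}. 0 < q (x k, y k) (x (k - 1), y (k - 1))"
    unfolding linked_def by blast
  have "0 < q (x (k + d), y (k + d)) (x (k - 1 + d), y (k - 1 + d))" if "k \<in> {a<..b}" for k
  proof -
    have "k + d \<in> {a + d<..b + d}" "k - 1 + d = k + d - 1" using that by auto
    then show ?thesis using y(4) by metis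
  qed
  then show "linked (\<lambda>k. x (k + d)) a b i j"
    unfolding linked_def using y by (intro exI[of _ "\<lambda>k. y (k + d)"]) auto
qed

definition path_weight :: "nat \<Rightarrow> (nat \<Rightarrow> 'x) \<Rightarrow> (nat \<Rightarrow> nat) \<Rightarrow> real"
  where "path_weight n x y = (\<Prod>k=2..n. q (x k, y k) (x (k - 1), y (k - 1)))"

lemma path_weight_cong:
  assumes "\<And>k. k \<in> {1..n} \<Longrightarrow> x k = x' k" "\<And>k. k \<in> {1..n} \<Longrightarrow> y k = y' k"
  shows "path_weight n x y = path_weight n x' y'"
  unfolding path_weight_def
proof (rule prod.cong)
  fix k assume "k \<in> {2..n}"
  then have "k \<in> {1..n}" "k - 1 \<in> {1..n}" by auto
  then show "q (x k, y k) (x (k - 1), y (k - 1)) = q (x' k, y' k) (x' (k - 1), y' (k - 1))"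
    using assms by simp
qed simp

abbreviation label_paths :: "nat \<Rightarrow> nat \<Rightarrow> nat \<Rightarrow> (nat \<Rightarrow> nat) set"
  where "label_paths n i j \<equiv> {y \<in> {1..n} \<rightarrow>\<^sub>E {1..m}. y 1 = i \<and> y n = j}"

lemma pmax_eq: "pmax m q n x i j = Max (path_weight n x ` label_paths n i j)"
  by (simp add: pmax_def path_weight_def)

lemma finite_label_paths: "finite (label_paths n i j)"
  by (rule finite_subset[of _ "{1..n} \<rightarrow>\<^sub>E {1..m}"]) (auto intro: finite_PiE)

lemma pmax_cong:
  assumes "\<And>k. k \<in> {1..n} \<Longrightarrow> x k = x' k"
  shows "pmax m q n x = pmax m q n x'"
proof (intro ext)
  fix i j
  have "path_weight n x y = path_weight n x' y" for y
    using assms by (intro path_weight_cong) auto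
  then show "pmax m q n x i j = pmax m q n x' i j"
    by (simp add: pmax_eq)
qed

lemma path_weight_le_pmax:
  assumes "\<And>k. k \<in> {1..n} \<Longrightarrow> y k \<in> {1..m}" "1 \<le> n"
  shows "path_weight n x y \<le> pmax m q n x (y 1) (y n)"
proof -
  have "path_weight n x y = path_weight n x (restrict y {1..n})"
    by (rule path_weight_cong) auto
  moreover have "restrict y {1..n} \<in> label_paths n (y 1) (y n)"
    using assms by auto
  ultimately show ?thesis
    unfolding pmax_eq using finite_label_paths by (intro Max_ge) auto
qed

lemma pmax_attained:
  assumes "2 \<le> n" "i \<in> {1..m}" "j \<in> {1..m}"
  obtains y where "y \<in> label_paths n i j" "pmax m q n x i j = path_weight n x y"
proof -
  have "(\<lambda>k\<in>{1..n}. if k = 1 then i else j) \<in> label_paths n i j"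
    using assms by auto
  then have "path_weight n x ` label_paths n i j \<noteq> {}" by blast
  then have "pmax m q n x i j \<in> path_weight n x ` label_paths n i j"
    unfolding pmax_eq using finite_label_paths by (intro Max_in) auto
  with that show thesis by blast
qed

lemma q_nonneg': "i \<in> {1..m} \<Longrightarrow> j \<in> {1..m} \<Longrightarrow> 0 \<le> q (x, i) (x', j)"
  by (rule q_nonneg) (auto simp: space_S)

lemma pmax_pos_iff_linked:
  assumes "2 \<le> n" "i \<in> {1..m}" "j \<in> {1..m}"
  shows "0 < pmax m q n x i j \<longleftrightarrow> linked x 1 n i j"
proof
  assume pos: "0 < pmax m q n x i j"
  obtain y where y: "y \<in> label_paths n i j" "pmax m q n x i j = path_weight n x y"
    using assms by (rule pmax_attained)
  have "0 < q (x k, y k) (x (k - 1), y (k - 1))" if k: "k \<in> {1<..n}" for k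
  proof -
    have "k \<in> {2..n}" using k by auto
    have "q (x k, y k) (x (k - 1), y (k - 1)) \<noteq> 0"
    proof
      assume "q (x k, y k) (x (k - 1), y (k - 1)) = 0"
      with \<open>k \<in> {2..n}\<close> have "path_weight n x y = 0"
        unfolding path_weight_def by (intro prod_zero) auto
      with pos y show False by simp
    qed
    moreover have "k \<in> {1..n}" "k - 1 \<in> {1..n}" using k by auto
    then have "y k \<in> {1..m}" "y (k - 1) \<in> {1..m}"
      using y(1) by blast+
    ultimately show ?thesis using q_nonneg'[of "y k" "y (k - 1)" "x k" "x (k - 1)"] by simp
  qed
  then show "linked x 1 n i j"
    unfolding linked_def using y(1) by (intro exI[of _ y]) (auto simp: PiE_iff)
next
  assume "linked x 1 n i j"
  then obtain y where y: "y 1 = i" "y n = j" "\<forall>k\<in>{1..n}. y k \<in> {1..m}"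
    "\<forall>k\<in>{1<..n}. 0 < q (x k, y k) (x (k - 1), y (k - 1))"
    unfolding linked_def by blast
  have "0 < path_weight n x y"
    unfolding path_weight_def by (rule prod_pos) (use y(4) in auto)
  also have "\<dots> \<le> pmax m q n x i j"
    using path_weight_le_pmax[of n y x] y assms(1) by auto
  finally show "0 < pmax m q n x i j" .
qed

lemma pmax_nonneg:
  assumes "2 \<le> n" "i \<in> {1..m}" "j \<in> {1..m}"
  shows "0 \<le> pmax m q n x i j"
proof -
  obtain y where y: "y \<in> label_paths n i j" "pmax m q n x i j = path_weight n x y"
    using assms by (rule pmax_attained)
  show ?thesis
    unfolding y(2) path_weight_def
  proof (rule prod_nonneg, rule q_nonneg')
    fix k assume "k \<in> {2..n}"
    then have "k \<in> {1..n}" "k - 1 \<in> {1..n}" by auto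
    then show "y k \<in> {1..m}" "y (k - 1) \<in> {1..m}" using y(1) by blast+
  qed
qed

lemma pmax_le_power:
  assumes n: "2 \<le> n" "i \<in> {1..m}" "j \<in> {1..m}"
    and Q: "\<And>x x' i j. i \<in> {1..m} \<Longrightarrow> j \<in> {1..m} \<Longrightarrow> q (x, i) (x', j) \<le> Q"
  shows "pmax m q n x i j \<le> Q ^ (n - 1)"
proof -
  obtain y where y: "y \<in> label_paths n i j" "pmax m q n x i j = path_weight n x y"
    using n by (rule pmax_attained)
  have "path_weight n x y \<le> (\<Prod>k=2..n. Q)"
    unfolding path_weight_def
  proof (rule prod_mono)
    fix k assume "k \<in> {2..n}"
    then have "k \<in> {1..n}" "k - 1 \<in> {1..n}" by auto
    then have "y k \<in> {1..m}" "y (k - 1) \<in> {1..m}" using y(1) by blast+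
    then show "0 \<le> q (x k, y k) (x (k - 1), y (k - 1)) \<and> q (x k, y k) (x (k - 1), y (k - 1)) \<le> Q"
      using q_nonneg' Q by blast
  qed
  also have "\<dots> = Q ^ (n - 1)" by simp
  finally show ?thesis using y(2) by simp
qed

lemma mem_Yplus_iff:
  assumes "2 \<le> n"
  shows "(i, j) \<in> Yplus m q n x \<longleftrightarrow> linked x 1 n i j"
  using pmax_pos_iff_linked[OF assms] linked_labels[of x 1 n i j] assms by (auto simp: Yplus_def)

lemma path_prob_pos_walk:
  assumes "z \<in> space S" "0 < path_prob K (Suc n) A z"
  shows "\<exists>w. w 0 = z \<and> (\<forall>i\<le>n. w i \<in> A i \<and> w i \<in> space S) \<and> (\<forall>i<n. 0 < q (w (Suc i)) (w i))"
  using assms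
proof (induction n arbitrary: A z)
  case 0
  then have "z \<in> A 0" by (cases "z \<in> A 0") auto
  with 0 show ?case by auto
next
  case (Suc n)
  let ?A = "\<lambda>i. A (Suc i)"
  have z: "z \<in> A 0" using Suc.prems(2) by (cases "z \<in> A 0") simp_all
  have pos: "0 < (\<integral>\<^sup>+ w. path_prob K (Suc n) ?A w \<partial>K z)"
    using Suc.prems(2) z unfolding path_prob.simps(2)[of _ "Suc n"] by (simp del: path_prob.simps)
  have "\<exists>w\<in>space S. 0 < q w z \<and> 0 < path_prob K (Suc n) ?A w"
  proof (rule ccontr)
    assume contra: "\<not> ?thesis"
    have "AE w in K z. path_prob K (Suc n) ?A w = 0"
      unfolding trans_kernel_def AE_density[OF q_section_measurable[OF Suc.prems(1)]]
    proof (rule AE_I2, rule impI)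
      fix w assume "w \<in> space (\<mu> \<Otimes>\<^sub>M count_space {1..m})" "0 < ennreal (q w z)"
      then have "w \<in> space S" "0 < q w z"
        by (simp_all only: space_base ennreal_less_zero_iff)
      with contra show "path_prob (\<lambda>z'. density (\<mu> \<Otimes>\<^sub>M count_space {1..m}) (\<lambda>z. ennreal (q z z'))) (Suc n) ?A w = 0"
        unfolding trans_kernel_def[symmetric] by (meson not_gr_zero)
    qed
    then have "(\<integral>\<^sup>+ w. path_prob K (Suc n) ?A w \<partial>K z) = (\<integral>\<^sup>+ w. 0 \<partial>K z)"
      by (rule nn_integral_cong_AE)
    with pos show False by (simp del: path_prob.simps)
  qed
  then obtain u where u: "u \<in> space S" "0 < q u z" "0 < path_prob K (Suc n) ?A u" by blast
  obtain w where w: "w 0 = u" "\<forall>i\<le>n. w i \<in> ?A i \<and> w i \<in> space S" "\<forall>i<n. 0 < q (w (Suc i)) (w i)"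
    using Suc.IH[OF u(1,3)] by blast
  show ?case
  proof (intro exI[of _ "case_nat z w"] conjI allI impI)
    fix i assume "i \<le> Suc n"
    then show "case_nat z w i \<in> A i" "case_nat z w i \<in> space S"
      using z Suc.prems(1) w(2) by (cases i; simp)+
  next
    fix i assume "i < Suc n"
    then show "0 < q (case_nat z w (Suc i)) (case_nat z w i)"
      using u(2) w(1,3) by (cases i) simp_all
  qed simp
qed

text \<open>
  Reachability provides positive walks with a prescribed end: a positive probability of being in
  \<open>U \<times> {i}\<close> can only come from trajectories all of whose edges have positive density.
\<close>
lemma reachable_linked:
  assumes "reachable \<mu> m q (x, i)" "open U" "x \<in> U" "j \<in> {1..m}"
  obtains n w where "2 \<le> n" "w 1 = x'" "w n \<in> U" "linked w 1 n j i"
proof -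
  have z: "(x', j) \<in> space S" using assms by (simp add: space_S)
  obtain k where k: "0 < path_prob K (Suc (Suc k)) (\<lambda>l. if l < Suc k then space S else U \<times> {i}) (x', j)"
    using reachable_path_prob[OF assms(1-3) z] .
  obtain w where w: "w 0 = (x', j)" "\<And>l. l \<le> Suc k \<Longrightarrow> w l \<in> space S"
    "w (Suc k) \<in> U \<times> {i}" "\<And>l. l < Suc k \<Longrightarrow> 0 < q (w (Suc l)) (w l)"
    using path_prob_pos_walk[OF z k] by (metis le_refl less_irrefl)
  show thesis
  proof (rule that[of "k + 2" "\<lambda>l. fst (w (l - 1))"])
    show "linked (\<lambda>l. fst (w (l - 1))) 1 (k + 2) j i"
      unfolding linked_def
    proof (intro exI[of _ "\<lambda>l. snd (w (l - 1))"] conjI ballI)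
      fix l assume "l \<in> {1..k + 2}"
      then show "snd (w (l - 1)) \<in> {1..m}"
        using w(2)[of "l - 1"] by (auto simp: space_S mem_Times_iff)
    next
      fix l assume "l \<in> {1<..k + 2}"
      then show "0 < q (fst (w (l - 1)), snd (w (l - 1))) (fst (w (l - 1 - 1)), snd (w (l - 1 - 1)))"
      proof -
        have "l - 2 < Suc k" "Suc (l - 2) = l - 1" "l - 1 - 1 = l - 2"
          using \<open>l \<in> {1<..k + 2}\<close> by auto
        then show ?thesis using w(4)[of "l - 2"] by simp
      qed
    qed (use w in auto)
  qed (use w in auto)
qed

end

lemma eventually_nhds_coordinate:
  assumes "open U" "x k \<in> U"
  shows "\<forall>\<^sub>F \<xi> in nhds x. (\<xi> k :: 'a :: topological_space) \<in> U"
proof -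
  have "open ((\<lambda>\<xi>. \<xi> k) -` U)"
    using assms(1) by (intro open_vimage continuous_on_product_coordinates)
  with assms(2) show ?thesis unfolding eventually_nhds by blast
qed

text \<open>
  Shrinks neighbourhoods in the product topology to boxes. The coordinates outside \<open>I\<close> can be reset to
  those of \<open>x\<close> without affecting \<open>P\<close>, so only the sides of the box in \<open>I\<close> matter.
\<close>
lemma eventually_nhds_box:
  fixes x :: "nat \<Rightarrow> 'a :: topological_space"
  assumes ev: "eventually P (nhds x)"
    and local: "\<And>\<xi> \<xi>'. (\<And>k. k \<in> I \<Longrightarrow> \<xi> k = \<xi>' k) \<Longrightarrow> P \<xi> \<Longrightarrow> P \<xi>'"
  shows "\<exists>U. (\<forall>k. open (U k)) \<and> (\<forall>k. x k \<in> U k) \<and> (\<forall>\<xi>. (\<forall>k\<in>I. \<xi> k \<in> U k) \<longrightarrow> P \<xi>)"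
proof -
  obtain T where T: "open T" "x \<in> T" "\<And>\<xi>. \<xi> \<in> T \<Longrightarrow> P \<xi>"
    using ev unfolding eventually_nhds by blast
  have "openin (product_topology (\<lambda>_. euclidean) UNIV) T"
    using T(1) by (simp add: open_fun_def)
  from product_topology_open_contains_basis[OF this T(2)] obtain U where
    U: "x \<in> PiE UNIV U" "\<And>k. open (U k)" "PiE UNIV U \<subseteq> T"
    by auto
  have "P \<xi>" if "\<forall>k\<in>I. \<xi> k \<in> U k" for \<xi>
  proof (rule local)
    show "P (\<lambda>k. if k \<in> I then \<xi> k else x k)"
      using U that by (intro T(3) subsetD[OF U(3)]) (auto simp: PiE_iff)
  qed simp
  with U show ?thesis by (intro exI[of _ U]) (auto simp: PiE_iff)
qed

lemma power_topology_box:
  assumes "openin (power_topology l) E" "e \<in> E"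
  obtains U where "\<And>i. i \<in> {1..l} \<Longrightarrow> open (U i)" "\<And>i. i \<in> {1..l} \<Longrightarrow> e i \<in> U i" "PiE {1..l} U \<subseteq> E"
proof -
  from assms obtain U where "\<forall>i\<in>{1..l}. openin euclidean (U i)" "e \<in> PiE {1..l} U" "PiE {1..l} U \<subseteq> E"
    unfolding openin_product_topology_alt by blast
  then show thesis by (intro that[of U]) (simp_all only: open_openin PiE_iff)
qed

lemma eventually_window_in:
  fixes x :: "nat \<Rightarrow> 'a :: topological_space"
  assumes E: "openin (power_topology l) E" "(\<lambda>i\<in>{1..l}. x (i + d)) \<in> E"
  shows "\<forall>\<^sub>F \<xi> in nhds x. (\<lambda>i\<in>{1..l}. \<xi> (i + d)) \<in> E"
proof -
  obtain U where U: "\<And>i. i \<in> {1..l} \<Longrightarrow> open (U i)"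
    "\<And>i. i \<in> {1..l} \<Longrightarrow> (\<lambda>i\<in>{1..l}. x (i + d)) i \<in> U i" "PiE {1..l} U \<subseteq> E"
    using power_topology_box[OF E] by blast
  have "\<forall>\<^sub>F \<xi> in nhds x. \<forall>i\<in>{1..l}. \<xi> (i + d) \<in> U i"
    using U(1,2) by (intro eventually_ball_finite ballI eventually_nhds_coordinate) auto
  then show ?thesis
  proof eventually_elim
    case (elim \<xi>)
    then show ?case by (intro subsetD[OF U(3)]) auto
  qed
qed

context lsc_pairwise_markov_model
begin

lemma eventually_edge:
  assumes "i \<in> {1..m}" "j \<in> {1..m}" "t < q (x k, i) (x k', j)"
  shows "\<forall>\<^sub>F \<xi> in nhds x. t < q (\<xi> k, i) (\<xi> k', j)"
proof -
  have "\<forall>\<^sub>F p in nhds (x k, x k'). t < (\<lambda>(x, x'). q (x, i) (x', j)) p"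
    using q_lsc[OF assms(1,2)] assms(3) unfolding lower_semicontinuous_def by auto
  then obtain T where T: "open T" "(x k, x k') \<in> T" "\<And>p. p \<in> T \<Longrightarrow> t < (\<lambda>(x, x'). q (x, i) (x', j)) p"
    unfolding eventually_nhds by blast
  obtain U V where UV: "open U" "open V" "x k \<in> U" "x k' \<in> V" "U \<times> V \<subseteq> T"
    using T(1,2) by (rule open_prod_elim) blast
  have "\<forall>\<^sub>F \<xi> in nhds x. \<xi> k \<in> U" "\<forall>\<^sub>F \<xi> in nhds x. \<xi> k' \<in> V"
    using UV by (auto intro: eventually_nhds_coordinate)
  then show ?thesis
  proof eventually_elim
    case (elim \<xi>)
    then show ?case using T(3)[of "(\<xi> k, \<xi> k')"] UV(5) by auto
  qed
qed

text \<open>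
  The factor 2 leaves room on every edge of the walk, so that lower semi-continuity keeps the edge above
  half of its value; the product of these halves is the lower bound.
\<close>
lemma linked_stable:
  assumes "linked x 1 n i j" "2 \<le> n"
  shows "\<exists>\<delta>>0. \<forall>\<^sub>F \<xi> in nhds x. \<delta> \<le> pmax m q n \<xi> i j"
proof -
  obtain y where y: "y 1 = i" "y n = j" "\<forall>k\<in>{1..n}. y k \<in> {1..m}"
    "\<forall>k\<in>{1<..n}. 0 < q (x k, y k) (x (k - 1), y (k - 1))"
    using assms(1) unfolding linked_def by blast
  let ?e = "\<lambda>x k. q (x k, y k) (x (k - 1), y (k - 1))"
  have pos: "0 < ?e x k" if "k \<in> {2..n}" for k
    using y(4) that by auto
  have "\<forall>\<^sub>F \<xi> in nhds x. \<forall>k\<in>{2..n}. ?e x k / 2 < ?e \<xi> k"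
  proof (intro eventually_ball_finite ballI eventually_edge)
    fix k assume k: "k \<in> {2..n}"
    then have "k \<in> {1..n}" "k - 1 \<in> {1..n}" by auto
    then show "y k \<in> {1..m}" "y (k - 1) \<in> {1..m}" using y(3) by blast+
    show "?e x k / 2 < ?e x k" using pos[OF k] by simp
  qed simp
  then have "\<forall>\<^sub>F \<xi> in nhds x. (\<Prod>k=2..n. ?e x k / 2) \<le> pmax m q n \<xi> i j"
  proof eventually_elim
    case (elim \<xi>)
    have "(\<Prod>k=2..n. ?e x k / 2) \<le> path_weight n \<xi> y"
      unfolding path_weight_def using elim pos by (intro prod_mono) (auto intro: less_imp_le)
    also have "\<dots> \<le> pmax m q n \<xi> i j"
      using path_weight_le_pmax[of n y \<xi>] y assms(2) by auto
    finally show ?case .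
  qed
  moreover have "0 < (\<Prod>k=2..n. ?e x k / 2)"
    using pos by (intro prod_pos) auto
  ultimately show ?thesis by blast
qed

lemma linked_stable_finite:
  assumes "finite P" "\<And>i j. (i, j) \<in> P \<Longrightarrow> linked x 1 n i j" "2 \<le> n"
  shows "\<exists>\<delta>>0. \<forall>\<^sub>F \<xi> in nhds x. \<forall>(i, j)\<in>P. \<delta> \<le> pmax m q n \<xi> i j"
  using assms(1,2)
proof (induction P)
  case empty
  then show ?case by (intro exI[of _ 1]) simp
next
  case (insert p P)
  obtain \<delta> where \<delta>: "\<delta> > 0" "\<forall>\<^sub>F \<xi> in nhds x. \<forall>(i, j)\<in>P. \<delta> \<le> pmax m q n \<xi> i j"
    using insert by blast
  obtain i j where p: "p = (i, j)" by fastforce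
  obtain \<delta>' where \<delta>': "\<delta>' > 0" "\<forall>\<^sub>F \<xi> in nhds x. \<delta>' \<le> pmax m q n \<xi> i j"
    using linked_stable[OF insert.prems[of i j] assms(3)] p by blast
  have "\<forall>\<^sub>F \<xi> in nhds x. \<forall>(i, j)\<in>insert p P. min \<delta> \<delta>' \<le> pmax m q n \<xi> i j"
    using \<delta>(2) \<delta>'(2) by eventually_elim (auto simp: p min_le_iff_disj)
  then show ?case
    using \<delta>(1) \<delta>'(1) by (intro exI[of _ "min \<delta> \<delta>'"]) auto
qed

end

section \<open>Assembling a barrier from its three parts\<close>

context pairwise_markov_model
begin

definition cycle_ineqs :: "real \<Rightarrow> (nat \<Rightarrow> nat \<Rightarrow> real) \<Rightarrow> bool"
  where "cycle_ineqs \<epsilon> p \<longleftrightarrow>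
    (\<forall>i\<in>{1..m}. p 1 1 \<ge> p i 1) \<and> (\<forall>i\<in>{1..m}. p 1 1 \<ge> p 1 i) \<and>
    (\<forall>i\<in>{1..m} - {1}. \<forall>j\<in>{1..m} - {1}. p 1 1 * (1 - \<epsilon>) > p i j)"

definition strict_entry :: "(nat \<Rightarrow> nat \<Rightarrow> real) \<Rightarrow> bool"
  where "strict_entry p \<longleftrightarrow> (\<forall>i\<in>{1..m} - {1}. p 1 1 > p i 1)"

definition strict_exit :: "(nat \<Rightarrow> nat \<Rightarrow> real) \<Rightarrow> bool"
  where "strict_exit p \<longleftrightarrow> (\<forall>i\<in>{1..m} - {1}. p 1 1 > p 1 i)"

text \<open>
  The lower bounds that condition A2 demands from the initial part of a barrier; \<open>departure\<close> is the
  counterpart for the final part.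
\<close>
definition entrance :: "nat \<Rightarrow> real \<Rightarrow> (nat \<Rightarrow> 'x) \<Rightarrow> bool"
  where "entrance n \<delta> \<xi> \<longleftrightarrow> Yplus m q n \<xi> \<noteq> {} \<and> (\<forall>i\<in>fst ` Yplus m q n \<xi>. \<delta> \<le> pmax m q n \<xi> i 1)"

definition departure :: "nat \<Rightarrow> real \<Rightarrow> (nat \<Rightarrow> 'x) \<Rightarrow> bool"
  where "departure n \<delta> \<xi> \<longleftrightarrow> Yplus m q n \<xi> \<noteq> {} \<and> (\<forall>j\<in>snd ` Yplus m q n \<xi>. \<delta> \<le> pmax m q n \<xi> 1 j)"

text \<open>
  The function $(i,j) \mapsto p_{ij}$ of the block of \<open>\<xi>\<close> between the positions \<open>s k\<close> and \<open>s (k + 1)\<close>.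
\<close>
definition cycle_pmax :: "(nat \<Rightarrow> nat) \<Rightarrow> nat \<Rightarrow> (nat \<Rightarrow> 'x) \<Rightarrow> nat \<Rightarrow> nat \<Rightarrow> real"
  where "cycle_pmax s k \<xi> = pmax m q (s (k + 1) + 1 - s k) (\<lambda>i\<in>{1..s (k + 1) + 1 - s k}. \<xi> (s k + i - 1))"

text \<open>
  The conclusion of the theorem, which is reached separately for one label and for several labels.
\<close>
definition barrier_exists :: bool
  where "barrier_exists \<longleftrightarrow> (\<exists>N n \<epsilon> \<delta> \<Delta> Xs.
    Xs \<noteq> {} \<and> cond_A1' m q N n \<epsilon> Xs \<and> cond_A2 m q N n \<delta> \<Delta> Xs \<and> cond_A3 N \<epsilon> \<delta> \<Delta> \<and>
    (harris_recurrent \<mu> m q \<longrightarrow> measure \<Omega> (io_event \<Omega> Z (n (2 * N + 2)) Xs) = 1))"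

lemma Yplus_cong:
  assumes "\<And>k. k \<in> {1..n} \<Longrightarrow> x k = x' k"
  shows "Yplus m q n x = Yplus m q n x'"
  unfolding Yplus_def using pmax_cong[of n x x'] assms by simp

lemma entrance_cong:
  assumes "\<And>k. k \<in> {1..n} \<Longrightarrow> x k = x' k"
  shows "entrance n \<delta> x \<longleftrightarrow> entrance n \<delta> x'"
  unfolding entrance_def using pmax_cong[of n x x'] Yplus_cong[of n x x'] assms by simp

lemma departure_cong:
  assumes "\<And>k. k \<in> {1..n} \<Longrightarrow> x k = x' k"
  shows "departure n \<delta> x \<longleftrightarrow> departure n \<delta> x'"
  unfolding departure_def using pmax_cong[of n x x'] Yplus_cong[of n x x'] assms by simp

lemma departure_linked:
  assumes "departure n \<delta> x" "0 < \<delta>" "2 \<le> n"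
  obtains j where "linked x 1 n 1 j"
proof -
  obtain i j where ij: "(i, j) \<in> Yplus m q n x"
    using assms(1) unfolding departure_def by auto
  then have "\<delta> \<le> pmax m q n x 1 j"
    using assms(1) unfolding departure_def by force
  moreover have "j \<in> {1..m}" using ij by (auto simp: Yplus_def)
  ultimately have "linked x 1 n 1 j"
    using pmax_pos_iff_linked[of n 1 j x] assms(2,3) m_pos by auto
  then show thesis by (rule that)
qed

lemma slice_start: "slice X 1 n = (\<lambda>x. \<lambda>i\<in>{1..n}. x i) ` X"
  by (simp add: slice_def)

lemma cond_A1'_iff:
  "cond_A1' m q N n \<epsilon> X \<longleftrightarrow>
    N \<ge> 2 \<and> n 1 \<ge> 1 \<and> strict_mono_on {1..2 * N + 2} n \<and>
    X \<subseteq> {1..n (2 * N + 2)} \<rightarrow>\<^sub>E UNIV \<and> \<epsilon> > 0 \<and>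
    (\<forall>k\<in>{1..2 * N}. \<forall>x\<in>X. cycle_ineqs \<epsilon> (cycle_pmax n k x)) \<and>
    ((\<forall>k\<in>{1..2 * N}. \<forall>x\<in>X. strict_entry (cycle_pmax n k x)) \<or>
     (\<forall>k\<in>{1..2 * N}. \<forall>x\<in>X. strict_exit (cycle_pmax n k x)))"
proof -
  have image: "(\<forall>x\<in>slice X (n k) (n (k + 1)). R (pmax m q (n (k + 1) + 1 - n k) x)) \<longleftrightarrow>
      (\<forall>x\<in>X. R (cycle_pmax n k x))" for k and R :: "(nat \<Rightarrow> nat \<Rightarrow> real) \<Rightarrow> bool"
    unfolding slice_def cycle_pmax_def by blast
  show ?thesis
    unfolding image[of _ "cycle_ineqs \<epsilon>", symmetric] image[of _ strict_entry, symmetric]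
      image[of _ strict_exit, symmetric]
    unfolding cond_A1'_def cond_A1_def Let_def cycle_ineqs_def strict_entry_def strict_exit_def conj_assoc
    by (rule refl)
qed

lemma cond_A2I:
  assumes "2 \<le> n 1" "n (2 * N + 1) < n (2 * N + 2)" "0 < \<delta>" "\<delta> \<le> \<Delta>"
    and Q: "\<And>x x' i j. i \<in> {1..m} \<Longrightarrow> j \<in> {1..m} \<Longrightarrow> q (x, i) (x', j) \<le> Q"
    and \<Delta>: "Q ^ (n 1 - 1) \<le> \<Delta>" "Q ^ (n (2 * N + 2) - n (2 * N + 1)) \<le> \<Delta>"
    and entrance: "\<And>x. x \<in> X \<Longrightarrow> entrance (n 1) \<delta> x"
    and departure: "\<And>x. x \<in> X \<Longrightarrow>
      departure (n (2 * N + 2) + 1 - n (2 * N + 1)) \<delta> (\<lambda>i. x (n (2 * N + 1) + i - 1))"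
  shows "cond_A2 m q N n \<delta> \<Delta> X"
proof -
  let ?L = "n (2 * N + 2) + 1 - n (2 * N + 1)"
  have "pmax m q (n 1) x i j \<le> \<Delta>" if "i \<in> {1..m}" "j \<in> {1..m}" for x i j
    using pmax_le_power[OF assms(1) that Q, of x] \<Delta>(1) by simp
  moreover have "pmax m q ?L x i j \<le> \<Delta>" if "i \<in> {1..m}" "j \<in> {1..m}" for x i j
  proof -
    have "pmax m q ?L x i j \<le> Q ^ (?L - 1)"
      using that assms(2) by (intro pmax_le_power Q) auto
    with \<Delta>(2) assms(2) show ?thesis by simp
  qed
  moreover have "entrance (n 1) \<delta> x" if "x \<in> slice X 1 (n 1)" for x
  proof -
    obtain x' where x': "x' \<in> X" "x = (\<lambda>i\<in>{1..n 1}. x' i)"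
      using \<open>x \<in> slice X 1 (n 1)\<close> unfolding slice_start by blast
    have "entrance (n 1) \<delta> x \<longleftrightarrow> entrance (n 1) \<delta> x'"
      by (rule entrance_cong) (simp add: x'(2))
    with entrance[OF x'(1)] show ?thesis by simp
  qed
  moreover have "departure ?L \<delta> x" if "x \<in> slice X (n (2 * N + 1)) (n (2 * N + 2))" for x
  proof -
    obtain x' where x': "x' \<in> X" "x = (\<lambda>i\<in>{1..?L}. x' (n (2 * N + 1) + i - 1))"
      using \<open>x \<in> slice X (n (2 * N + 1)) (n (2 * N + 2))\<close> unfolding slice_def by blast
    have "departure ?L \<delta> x \<longleftrightarrow> departure ?L \<delta> (\<lambda>i. x' (n (2 * N + 1) + i - 1))"
      by (rule departure_cong) (simp add: x'(2))
    with departure[OF x'(1)] show ?thesis by simp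
  qed
  ultimately show ?thesis
    unfolding cond_A2_def Let_def entrance_def departure_def
    using assms(1,3,4) by blast
qed

end

context lsc_pairwise_markov_model
begin

text \<open>
  The three parts \<open>f\<close>, \<open>c\<close>, \<open>b\<close> of a positive walk share their end points, and each of them comes with a
  box on which the required inequalities hold. Overlaying the boxes, and intersecting them at the two
  common positions, gives a box around the concatenation \<open>g\<close>. Each inequality concerns only one of the
  parts, so all of them hold on the whole box. The walk along \<open>g\<close> starts at a reachable point, hence
  the box is visited infinitely often under Harris recurrence.
\<close>
theorem barrier_assembly:
  assumes Q: "\<And>x x' i j. i \<in> {1..m} \<Longrightarrow> j \<in> {1..m} \<Longrightarrow> q (x, i) (x', j) \<le> Q"
    and front: "2 \<le> n" "reachable \<mu> m q (f 1, i0)" "linked f 1 n i0 1"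
      "\<And>k. open (F k)" "\<And>k. f k \<in> F k"
      "\<And>\<xi>. (\<And>k. k \<in> {1..n} \<Longrightarrow> \<xi> k \<in> F k) \<Longrightarrow> entrance n \<delta> \<xi>"
    and center: "2 \<le> N" "0 < \<epsilon>" "s 1 = 1" "s (2 * N + 1) = h + 1" "strict_mono_on {1..2 * N + 1} s"
      "c 1 = f n" "linked c 1 (h + 1) 1 1"
      "\<And>k. k \<in> {1..h + 1} \<Longrightarrow> open (C k)" "\<And>k. k \<in> {1..h + 1} \<Longrightarrow> c k \<in> C k"
      "\<And>\<xi> k. (\<And>k. k \<in> {1..h + 1} \<Longrightarrow> \<xi> k \<in> C k) \<Longrightarrow> k \<in> {1..2 * N} \<Longrightarrow> cycle_ineqs \<epsilon> (cycle_pmax s k \<xi>)"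
    and strict: "(\<forall>\<xi>. (\<forall>k\<in>{1..h + 1}. \<xi> k \<in> C k) \<longrightarrow> (\<forall>k\<in>{1..2 * N}. strict_entry (cycle_pmax s k \<xi>))) \<or>
      (\<forall>\<xi>. (\<forall>k\<in>{1..h + 1}. \<xi> k \<in> C k) \<longrightarrow> (\<forall>k\<in>{1..2 * N}. strict_exit (cycle_pmax s k \<xi>)))"
    and rear: "2 \<le> L" "b 1 = c (h + 1)" "\<And>k. open (B k)" "\<And>k. b k \<in> B k"
      "\<And>\<xi>. (\<And>k. k \<in> {1..L} \<Longrightarrow> \<xi> k \<in> B k) \<Longrightarrow> departure L \<delta> \<xi>"
    and bounds: "0 < \<delta>" "\<delta> \<le> \<Delta>" "Q ^ (n - 1) \<le> \<Delta>" "Q ^ (L - 1) \<le> \<Delta>" "\<Delta> / \<delta> * (1 - \<epsilon>) ^ N < 1"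
  shows barrier_exists
proof -
  define M where "M = n + h + L - 1"
  define g where "g k = (if k \<le> n then f k else if k \<le> n + h then c (k - n + 1) else b (k - (n + h) + 1))" for k
  define W where "W k = (if k \<le> n then F k else UNIV) \<inter>
    (if n \<le> k \<and> k \<le> n + h then C (k + 1 - n) else UNIV) \<inter>
    (if n + h \<le> k then B (k + 1 - (n + h)) else UNIV)" for k
  define t where "t k = (if k \<le> 2 * N + 1 then s k + n - 1 else M)" for k
  let ?X = "PiE {1..M} W"
  have s_mono: "s k < s l" if "k < l" "1 \<le> k" "l \<le> 2 * N + 1" for k l
    using that center(5) by (auto simp: strict_mono_on_def)
  have s_pos: "1 \<le> s k" if "k \<in> {1..2 * N + 1}" for k
    using s_mono[of 1 k] center(3) that by (cases "k = 1") auto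
  have t1: "t 1 = n" and tN: "t (2 * N + 1) = n + h" and tM: "t (2 * N + 2) = M"
    using center(3,4) by (simp_all add: t_def)
  have t_mono: "strict_mono_on {1..2 * N + 2} t"
  proof (rule strict_mono_onI)
    fix k l assume kl: "k \<in> {1..2 * N + 2}" "l \<in> {1..2 * N + 2}" "k < l"
    show "t k < t l"
    proof (cases "l \<le> 2 * N + 1")
      case True
      then show ?thesis using s_mono[of k l] s_pos[of k] kl by (auto simp: t_def)
    next
      case False
      then have "s k \<le> h + 1"
        using kl s_mono[of k "2 * N + 1"] center(4) by (cases "k = 2 * N + 1") auto
      then show ?thesis using False kl rear(1) by (auto simp: t_def M_def)
    qed
  qed
  have g_front: "g k = f k" if "k \<in> {1..n}" for k
    using that by (simp add: g_def)
  have g_center: "g (k + (n - 1)) = c k" if "k \<in> {1..h + 1}" for k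
  proof (cases "k = 1")
    case True
    then show ?thesis using front(1) center(6) by (simp add: g_def)
  next
    case False
    with that front(1) have "\<not> k + (n - 1) \<le> n" "k + (n - 1) \<le> n + h" "k + (n - 1) - n + 1 = k"
      by auto
    then show ?thesis by (simp add: g_def)
  qed
  have g_back: "g (k + (n + h - 1)) = b k" if "k \<in> {1..L}" for k
  proof (cases "k = 1")
    case True
    then have "k + (n + h - 1) = h + 1 + (n - 1)" using front(1) by auto
    then show ?thesis using g_center[of "h + 1"] rear(2) True by simp
  next
    case False
    with that front(1) have "\<not> k + (n + h - 1) \<le> n" "\<not> k + (n + h - 1) \<le> n + h"
      "k + (n + h - 1) - (n + h) + 1 = k"
      by auto
    then show ?thesis by (simp add: g_def)
  qed
  have W_open: "open (W k)" for k
  proof -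
    have "open (C (k + 1 - n))" if "n \<le> k" "k \<le> n + h"
      using that by (intro center(8)) auto
    then show ?thesis
      unfolding W_def using front(4) rear(3) by (auto intro!: open_Int)
  qed
  have g_W: "g k \<in> W k" if "k \<in> {1..M}" for k
  proof -
    have "g k \<in> F k" if "k \<le> n"
      using that front(5) by (simp add: g_def)
    moreover have "g k \<in> C (k + 1 - n)" if "n \<le> k" "k \<le> n + h"
    proof -
      have "k + 1 - n \<in> {1..h + 1}" "k + 1 - n + (n - 1) = k" using that front(1) by auto
      then show ?thesis using g_center[of "k + 1 - n"] center(9)[of "k + 1 - n"] by simp
    qed
    moreover have "g k \<in> B (k + 1 - (n + h))" if "n + h \<le> k"
    proof -
      have "k + 1 - (n + h) \<in> {1..L}" "k + 1 - (n + h) + (n + h - 1) = k"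
        using that \<open>k \<in> {1..M}\<close> front(1) by (auto simp: M_def)
      then show ?thesis using g_back[of "k + 1 - (n + h)"] rear(4)[of "k + 1 - (n + h)"] by simp
    qed
    ultimately show ?thesis
      unfolding W_def by (intro IntI; split if_split; blast)
  qed
  have X_front: "\<xi> k \<in> F k" if "\<xi> \<in> ?X" "k \<in> {1..n}" for \<xi> k
  proof -
    have "k \<in> {1..M}" using that(2) rear(1) by (auto simp: M_def)
    then have "\<xi> k \<in> W k" using that(1) by blast
    then show ?thesis using that(2) by (simp add: W_def)
  qed
  have X_center: "\<xi> (k + (n - 1)) \<in> C k" if "\<xi> \<in> ?X" "k \<in> {1..h + 1}" for \<xi> k
  proof -
    have "k + (n - 1) \<in> {1..M}" using that(2) rear(1) front(1) by (auto simp: M_def)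
    then have "\<xi> (k + (n - 1)) \<in> W (k + (n - 1))" using that(1) by blast
    moreover have "n \<le> k + (n - 1)" "k + (n - 1) \<le> n + h" "k + (n - 1) + 1 - n = k"
      using that(2) front(1) by auto
    ultimately show ?thesis by (simp add: W_def)
  qed
  have X_back: "\<xi> (k + (n + h - 1)) \<in> B k" if "\<xi> \<in> ?X" "k \<in> {1..L}" for \<xi> k
  proof -
    have "k + (n + h - 1) \<in> {1..M}" using that(2) front(1) by (auto simp: M_def)
    then have "\<xi> (k + (n + h - 1)) \<in> W (k + (n + h - 1))" using that(1) by blast
    moreover have "n + h \<le> k + (n + h - 1)" "k + (n + h - 1) + 1 - (n + h) = k"
      using that(2) front(1) by auto
    ultimately show ?thesis by (simp add: W_def)
  qed
  have cycle_t: "cycle_pmax t k \<xi> = cycle_pmax s k (\<lambda>i. \<xi> (i + (n - 1)))" if k: "k \<in> {1..2 * N}" for k \<xi>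
  proof -
    have sk: "1 \<le> s k" "s k < s (k + 1)" using s_pos[of k] s_mono[of k "k + 1"] k by auto
    have tk: "t k = s k + n - 1" "t (k + 1) = s (k + 1) + n - 1" using k by (simp_all add: t_def)
    have len: "t (k + 1) + 1 - t k = s (k + 1) + 1 - s k"
      unfolding tk using sk front(1) by linarith
    show ?thesis
      unfolding cycle_pmax_def len
    proof (rule pmax_cong)
      fix i assume "i \<in> {1..s (k + 1) + 1 - s k}"
      moreover from this have "t k + i - 1 = s k + i - 1 + (n - 1)"
        unfolding tk using sk front(1) by auto
      ultimately show "(\<lambda>i\<in>{1..s (k + 1) + 1 - s k}. \<xi> (t k + i - 1)) i =
          (\<lambda>i\<in>{1..s (k + 1) + 1 - s k}. \<xi> (s k + i - 1 + (n - 1))) i"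
        by (simp only: restrict_apply')
    qed
  qed
  have A1': "cond_A1' m q N t \<epsilon> ?X"
    unfolding cond_A1'_iff tM t1
  proof (intro conjI)
    let ?w = "\<lambda>\<xi> i. \<xi> (i + (n - 1))"
    show "\<forall>k\<in>{1..2 * N}. \<forall>\<xi>\<in>?X. cycle_ineqs \<epsilon> (cycle_pmax t k \<xi>)"
    proof (intro ballI)
      fix k \<xi> assume k: "k \<in> {1..2 * N}" and \<xi>: "\<xi> \<in> ?X"
      show "cycle_ineqs \<epsilon> (cycle_pmax t k \<xi>)"
        unfolding cycle_t[OF k] by (rule center(10)[of "?w \<xi>", OF X_center[OF \<xi>] k])
    qed
    from strict show "(\<forall>k\<in>{1..2 * N}. \<forall>x\<in>?X. strict_entry (cycle_pmax t k x)) \<or>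
        (\<forall>k\<in>{1..2 * N}. \<forall>x\<in>?X. strict_exit (cycle_pmax t k x))"
    proof
      assume *: "\<forall>\<xi>. (\<forall>k\<in>{1..h + 1}. \<xi> k \<in> C k) \<longrightarrow> (\<forall>k\<in>{1..2 * N}. strict_entry (cycle_pmax s k \<xi>))"
      have "strict_entry (cycle_pmax t k \<xi>)" if k: "k \<in> {1..2 * N}" and \<xi>: "\<xi> \<in> ?X" for k \<xi>
        unfolding cycle_t[OF k] by (rule *[rule_format, of "?w \<xi>", OF X_center[OF \<xi>] k])
      then show ?thesis by blast
    next
      assume *: "\<forall>\<xi>. (\<forall>k\<in>{1..h + 1}. \<xi> k \<in> C k) \<longrightarrow> (\<forall>k\<in>{1..2 * N}. strict_exit (cycle_pmax s k \<xi>))"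
      have "strict_exit (cycle_pmax t k \<xi>)" if k: "k \<in> {1..2 * N}" and \<xi>: "\<xi> \<in> ?X" for k \<xi>
        unfolding cycle_t[OF k] by (rule *[rule_format, of "?w \<xi>", OF X_center[OF \<xi>] k])
      then show ?thesis by blast
    qed
  qed (use center(1,2) front(1) t_mono in auto)
  have A2: "cond_A2 m q N t \<delta> \<Delta> ?X"
  proof (rule cond_A2I)
    have len: "t (2 * N + 2) + 1 - t (2 * N + 1) = L"
      unfolding tM tN M_def using front(1) rear(1) by simp
    show "t (2 * N + 1) < t (2 * N + 2)"
      unfolding tM tN M_def using rear(1) by simp
    show "Q ^ (t 1 - 1) \<le> \<Delta>" using bounds(3) t1 by simp
    have "t (2 * N + 2) - t (2 * N + 1) = L - 1"
      unfolding tM tN M_def using front(1) rear(1) by simp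
    then show "Q ^ (t (2 * N + 2) - t (2 * N + 1)) \<le> \<Delta>" using bounds(4) by simp
    fix \<xi> assume \<xi>: "\<xi> \<in> ?X"
    show "entrance (t 1) \<delta> \<xi>"
      unfolding t1 using X_front[OF \<xi>] by (rule front(6))
    have "departure L \<delta> (\<lambda>i. \<xi> (i + (n + h - 1)))"
      using X_back[OF \<xi>] by (rule rear(5))
    moreover have "departure L \<delta> (\<lambda>i. \<xi> (t (2 * N + 1) + i - 1)) \<longleftrightarrow>
        departure L \<delta> (\<lambda>i. \<xi> (i + (n + h - 1)))"
    proof (rule departure_cong)
      fix k assume "k \<in> {1..L}"
      then have "n + h + k - 1 = k + (n + h - 1)" using front(1) by auto
      then show "\<xi> (t (2 * N + 1) + k - 1) = \<xi> (k + (n + h - 1))" unfolding tN by simp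
    qed
    ultimately show "departure (t (2 * N + 2) + 1 - t (2 * N + 1)) \<delta> (\<lambda>i. \<xi> (t (2 * N + 1) + i - 1))"
      unfolding len by simp
  qed (use front(1) t1 bounds Q in auto)
  have A3: "cond_A3 N \<epsilon> \<delta> \<Delta>" using bounds(5) by (simp add: cond_A3_def)
  have io: "measure \<Omega> (io_event \<Omega> Z (t (2 * N + 2)) ?X) = 1" if "harris_recurrent \<mu> m q"
  proof -
    have "departure L \<delta> b" using rear(4) by (intro rear(5))
    then obtain j where "linked b 1 L 1 j" using bounds(1) rear(1) by (rule departure_linked)
    then have "linked (\<lambda>k. g (k + (n + h - 1))) 1 L 1 j"
      using linked_cong[of 1 L "\<lambda>k. g (k + (n + h - 1))" b] g_back by simp
    moreover have "linked (\<lambda>k. g (k + (n - 1))) 1 (h + 1) 1 1"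
      using linked_cong[of 1 "h + 1" "\<lambda>k. g (k + (n - 1))" c] g_center center(7) by simp
    moreover have "linked g 1 n i0 1"
      using linked_cong[of 1 n g f] g_front front(3) by simp
    moreover have "1 + (n + h - 1) = n + h" "L + (n + h - 1) = M" "1 + (n - 1) = n" "h + 1 + (n - 1) = n + h"
      using front(1) rear(1) by (auto simp: M_def)
    ultimately have "linked g 1 n i0 1" "linked g n (n + h) 1 1" "linked g (n + h) M 1 j"
      unfolding linked_shift by (simp_all only:)
    moreover have "1 \<le> n" "n \<le> n + h" "n + h \<le> M" using front(1) rear(1) by (auto simp: M_def)
    ultimately have "linked g 1 M i0 j"
      by (meson linked_trans order.trans)
    then obtain y where y: "y 1 = i0" "\<forall>k\<in>{1..M}. y k \<in> {1..m}"
      "\<forall>k\<in>{1<..M}. 0 < q (g k, y k) (g (k - 1), y (k - 1))"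
      unfolding linked_def by blast
    show ?thesis
      unfolding tM
    proof (rule box_visited_infinitely_often[OF that])
      show "reachable \<mu> m q (g 1, y 1)"
        using front(1,2) g_front[of 1] y(1) by simp
    qed (use y g_W W_open front(1) in \<open>auto simp: M_def\<close>)
  qed
  have "restrict g {1..M} \<in> ?X" using g_W by auto
  then have "?X \<noteq> {}" by blast
  with A1' A2 A3 io show ?thesis unfolding barrier_exists_def by blast
qed

end

section \<open>The parts of a barrier\<close>

context lsc_pairwise_markov_model
begin

context
  fixes l E Yp
  assumes l: "2 \<le> l" and E: "openin (power_topology l) E"
    and Yp: "\<And>x. x \<in> E \<Longrightarrow> Yplus m q l x = Yp"
    and rectangle: "\<And>i j. i \<in> fst ` Yp \<Longrightarrow> j \<in> snd ` Yp \<Longrightarrow> (i, j) \<in> Yp"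
begin

lemma E_restrict: "e \<in> E \<Longrightarrow> (\<lambda>i\<in>{1..l}. e i) = e"
  using openin_subset[OF E] by (auto simp: PiE_iff extensional_restrict)

lemma mem_Yp_iff_linked:
  assumes "(\<lambda>i\<in>{1..l}. \<xi> (i + d)) \<in> E"
  shows "(i, j) \<in> Yp \<longleftrightarrow> linked \<xi> (1 + d) (l + d) i j"
proof -
  have "(i, j) \<in> Yp \<longleftrightarrow> linked (\<lambda>i\<in>{1..l}. \<xi> (i + d)) 1 l i j"
    using mem_Yplus_iff[OF l] Yp[OF assms] by blast
  also have "\<dots> \<longleftrightarrow> linked (\<lambda>i. \<xi> (i + d)) 1 l i j"
    by (rule linked_cong) simp
  also have "\<dots> \<longleftrightarrow> linked \<xi> (1 + d) (l + d) i j"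
    by (rule linked_shift)
  finally show ?thesis .
qed

lemma Yp_labels: "e \<in> E \<Longrightarrow> Yp \<subseteq> {1..m} \<times> {1..m}"
  using Yp[of e] by (auto simp: Yplus_def)

text \<open>
  Follow \<open>e\<close> and then walk from its last position, with a label \<open>j0\<close> that ends a positive path in \<open>E\<close>,
  into \<open>V \<times> {1}\<close>. Near this trajectory the initial segment stays in \<open>E\<close>, so the labels that can start a
  positive path lie in \<open>fst ` Yp\<close>. The rectangle property links each of these to \<open>j0\<close> and thus to 1, and
  this finite family of links stays above a common \<open>\<delta>\<close>.
\<close>
lemma entrance_exists:
  assumes start: "e \<in> E" "i0 \<in> fst ` Yp"
    and target: "reachable \<mu> m q (x, 1)" "open V" "x \<in> V"
  obtains n f F \<delta> where "2 \<le> n" "f 1 = e 1" "f n \<in> V" "linked f 1 n i0 1" "0 < \<delta>"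
    "\<forall>k. open (F k) \<and> f k \<in> F k" "\<forall>\<xi>. (\<forall>k\<in>{1..n}. \<xi> k \<in> F k) \<longrightarrow> entrance n \<delta> \<xi>"
proof -
  obtain j0 where j0: "(i0, j0) \<in> Yp" using start(2) by auto
  then have j0m: "j0 \<in> {1..m}" using Yp_labels[OF start(1)] by blast
  obtain r w where w: "2 \<le> r" "w 1 = e l" "w r \<in> V" "linked w 1 r j0 1"
    using reachable_linked[OF target j0m] .
  define n where "n = l + r - 1"
  define f where "f k = (if k \<le> l then e k else w (k - (l - 1)))" for k
  have n: "2 \<le> n" "l \<le> n" using l w(1) by (auto simp: n_def)
  have f_w: "f (k + (l - 1)) = w k" if "k \<in> {1..r}" for k
    using that l w(2) by (cases "k = 1") (auto simp: f_def)
  have "(\<lambda>i\<in>{1..l}. f (i + 0)) = (\<lambda>i\<in>{1..l}. e i)"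
    by (rule restrict_ext) (simp add: f_def)
  then have fE: "(\<lambda>i\<in>{1..l}. f (i + 0)) \<in> E"
    using E_restrict[OF start(1)] start(1) by simp
  have "linked (\<lambda>k. f (k + (l - 1))) 1 r j0 1"
    using linked_cong[of 1 r "\<lambda>k. f (k + (l - 1))" w] f_w w(4) by simp
  moreover have "1 + (l - 1) = l" "r + (l - 1) = n" using l by (auto simp: n_def)
  ultimately have tail: "linked f l n j0 1"
    unfolding linked_shift by (simp only:)
  have link: "linked f 1 n i 1" if "i \<in> fst ` Yp" for i
  proof -
    have "(i, j0) \<in> Yp" using that j0 by (intro rectangle) force+
    then have "linked f 1 l i j0" using mem_Yp_iff_linked[OF fE] by simp
    then show ?thesis using tail l n by (auto intro: linked_trans)
  qed
  have "finite Yp" using Yp_labels[OF start(1)] by (rule finite_subset) simp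
  then have "finite (fst ` Yp \<times> {1})" by simp
  then have "\<exists>\<delta>>0. \<forall>\<^sub>F \<xi> in nhds f. \<forall>(i, j)\<in>fst ` Yp \<times> {1}. \<delta> \<le> pmax m q n \<xi> i j"
    by (rule linked_stable_finite) (use link n(1) in blast)+
  then obtain \<delta> where \<delta>: "0 < \<delta>"
    "\<forall>\<^sub>F \<xi> in nhds f. \<forall>(i, j)\<in>fst ` Yp \<times> {1}. \<delta> \<le> pmax m q n \<xi> i j"
    by blast
  have ev: "\<forall>\<^sub>F \<xi> in nhds f. entrance n \<delta> \<xi>"
    using \<delta>(2) eventually_window_in[OF E fE]
  proof eventually_elim
    case (elim \<xi>)
    have pos: "\<delta> \<le> pmax m q n \<xi> i 1" if "i \<in> fst ` Yp" for i
      using elim(1) that by auto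
    have "i \<in> fst ` Yp" if "(i, j) \<in> Yplus m q n \<xi>" for i j
    proof -
      have "linked \<xi> 1 n i j" using that mem_Yplus_iff[OF n(1)] by blast
      then obtain j' where "linked \<xi> 1 l i j'"
        using l n by (auto elim: linked_split[of _ _ _ _ _ l])
      then have "(i, j') \<in> Yp" using mem_Yp_iff_linked[OF elim(2)] by simp
      then show ?thesis by force
    qed
    then have "\<forall>i\<in>fst ` Yplus m q n \<xi>. \<delta> \<le> pmax m q n \<xi> i 1"
      using pos by auto
    moreover have "linked \<xi> 1 n i0 1"
      using pos[OF start(2)] \<delta>(1) pmax_pos_iff_linked[of n i0 1 \<xi>] n(1) m_pos j0 Yp_labels[OF start(1)]
      by auto
    ultimately show ?case
      unfolding entrance_def using mem_Yplus_iff[OF n(1)] by blast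
  qed
  have local: "entrance n \<delta> \<xi>'" if "\<And>k. k \<in> {1..n} \<Longrightarrow> \<xi> k = \<xi>' k" "entrance n \<delta> \<xi>" for \<xi> \<xi>'
    using entrance_cong[of n \<xi> \<xi>' \<delta>] that by simp
  have "\<exists>F. (\<forall>k. open (F k)) \<and> (\<forall>k. f k \<in> F k) \<and> (\<forall>\<xi>. (\<forall>k\<in>{1..n}. \<xi> k \<in> F k) \<longrightarrow> entrance n \<delta> \<xi>)"
    by (rule eventually_nhds_box[where I="{1..n}", OF ev]) (rule local)
  then obtain F where F: "\<forall>k. open (F k)" "\<forall>k. f k \<in> F k"
    "\<forall>\<xi>. (\<forall>k\<in>{1..n}. \<xi> k \<in> F k) \<longrightarrow> entrance n \<delta> \<xi>"
    by (elim exE conjE)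
  have "f 1 = e 1" "f n \<in> V"
    using l w f_w[of r] \<open>r + (l - 1) = n\<close> by (auto simp: f_def)
  then show thesis
    using n(1) link[OF start(2)] \<delta>(1) F by (intro that[of n f \<delta> F]) simp_all
qed

text \<open>
  The mirror image: walk from \<open>(x, 1)\<close> into the first coordinate set of \<open>E\<close>, arriving with the label
  \<open>i0\<close>, and stay in \<open>E\<close> afterwards. Here \<open>x\<close> is arbitrary, since a reachable point can be reached from
  everywhere.
\<close>
lemma departure_exists:
  assumes start: "e \<in> E" "i0 \<in> fst ` Yp" and reach: "reachable \<mu> m q (e 1, i0)"
  obtains n b B \<delta> where "2 \<le> n" "b 1 = x" "0 < \<delta>"
    "\<forall>k. open (B k) \<and> b k \<in> B k" "\<forall>\<xi>. (\<forall>k\<in>{1..n}. \<xi> k \<in> B k) \<longrightarrow> departure n \<delta> \<xi>"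
proof -
  \<comment> \<open>a box in \<open>E\<close> around \<open>e\<close>: the first coordinate can be replaced by the end of the walk\<close>
  obtain T where T: "\<And>i. i \<in> {1..l} \<Longrightarrow> open (T i)" "\<And>i. i \<in> {1..l} \<Longrightarrow> e i \<in> T i" "PiE {1..l} T \<subseteq> E"
    using power_topology_box[OF E start(1)] by blast
  have "1 \<in> {1..m}" using m_pos by simp
  obtain r w where w: "2 \<le> r" "w 1 = x" "w r \<in> T 1" "linked w 1 r 1 i0"
    using reachable_linked[OF reach T(1)[of 1] T(2)[of 1] \<open>1 \<in> {1..m}\<close>] l by auto
  define n where "n = l + r - 1"
  define b where "b k = (if k \<le> r then w k else e (k - (r - 1)))" for k
  have n: "2 \<le> n" "r \<le> n" "l + (r - 1) = n" "1 + (r - 1) = r" using l w(1) by (auto simp: n_def)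
  have "b (i + (r - 1)) \<in> T i" if "i \<in> {1..l}" for i
    using that w(1,3) T(2)[OF that] by (cases "i = 1") (auto simp: b_def)
  then have bE: "(\<lambda>i\<in>{1..l}. b (i + (r - 1))) \<in> E"
    by (intro subsetD[OF T(3)]) auto
  have head: "linked b 1 r 1 i0"
    using linked_cong[of 1 r b w] w(4) by (simp add: b_def)
  have link: "linked b 1 n 1 j" if "j \<in> snd ` Yp" for j
  proof -
    have "(i0, j) \<in> Yp" using that start(2) by (intro rectangle)
    then have "linked b r n i0 j" using mem_Yp_iff_linked[OF bE] n by simp
    with head show ?thesis using n w(1) by (auto intro: linked_trans)
  qed
  have "finite Yp" using Yp_labels[OF start(1)] by (rule finite_subset) simp
  then have "finite ({1} \<times> snd ` Yp)" by simp
  then have "\<exists>\<delta>>0. \<forall>\<^sub>F \<xi> in nhds b. \<forall>(i, j)\<in>{1} \<times> snd ` Yp. \<delta> \<le> pmax m q n \<xi> i j"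
    by (rule linked_stable_finite) (use link n(1) in blast)+
  then obtain \<delta> where \<delta>: "0 < \<delta>"
    "\<forall>\<^sub>F \<xi> in nhds b. \<forall>(i, j)\<in>{1} \<times> snd ` Yp. \<delta> \<le> pmax m q n \<xi> i j"
    by blast
  obtain j0 where j0: "(i0, j0) \<in> Yp" using start(2) by auto
  have ev: "\<forall>\<^sub>F \<xi> in nhds b. departure n \<delta> \<xi>"
    using \<delta>(2) eventually_window_in[OF E bE]
  proof eventually_elim
    case (elim \<xi>)
    have pos: "\<delta> \<le> pmax m q n \<xi> 1 j" if "j \<in> snd ` Yp" for j
      using elim(1) that by auto
    have "j \<in> snd ` Yp" if "(i, j) \<in> Yplus m q n \<xi>" for i j
    proof -
      have "linked \<xi> 1 n i j" using that mem_Yplus_iff[OF n(1)] by blast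
      then obtain i' where "linked \<xi> r n i' j"
        using n w(1) by (auto elim: linked_split[of _ _ _ _ _ r])
      then have "(i', j) \<in> Yp" using mem_Yp_iff_linked[OF elim(2)] n by simp
      then show ?thesis by force
    qed
    then have "\<forall>j\<in>snd ` Yplus m q n \<xi>. \<delta> \<le> pmax m q n \<xi> 1 j"
      using pos by auto
    moreover have "\<delta> \<le> pmax m q n \<xi> 1 j0" using j0 by (intro pos) force
    then have "linked \<xi> 1 n 1 j0"
      using \<delta>(1) pmax_pos_iff_linked[of n 1 j0 \<xi>] n(1) m_pos j0 Yp_labels[OF start(1)] by auto
    ultimately show ?case
      unfolding departure_def using mem_Yplus_iff[OF n(1)] by blast
  qed
  have local: "departure n \<delta> \<xi>'" if "\<And>k. k \<in> {1..n} \<Longrightarrow> \<xi> k = \<xi>' k" "departure n \<delta> \<xi>" for \<xi> \<xi>'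
    using departure_cong[of n \<xi> \<xi>' \<delta>] that by simp
  have "\<exists>B. (\<forall>k. open (B k)) \<and> (\<forall>k. b k \<in> B k) \<and>
      (\<forall>\<xi>. (\<forall>k\<in>{1..n}. \<xi> k \<in> B k) \<longrightarrow> departure n \<delta> \<xi>)"
    by (rule eventually_nhds_box[where I="{1..n}", OF ev]) (rule local)
  then obtain B where B: "\<forall>k. open (B k)" "\<forall>k. b k \<in> B k"
    "\<forall>\<xi>. (\<forall>k\<in>{1..n}. \<xi> k \<in> B k) \<longrightarrow> departure n \<delta> \<xi>"
    by (elim exE conjE)
  have "b 1 = x" using w by (simp add: b_def)
  then show thesis
    using n(1) \<delta>(1) B by (intro that[of n b \<delta> B]) simp_all
qed

end

text \<open>
  With a second label the inequality \<open>p\<^sub>1\<^sub>1 (1 - \<epsilon>) > p\<^sub>2\<^sub>2 \<ge> 0\<close> forces \<open>p\<^sub>1\<^sub>1 > 0\<close> and \<open>\<epsilon> < 1\<close>. So the constant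
  label 1 at the ends of the cycles can be completed to a positive walk through the whole center.
\<close>
lemma strong_center_cycles:
  assumes cen: "strong_center_part m q N n \<epsilon> X C" and \<zeta>: "\<zeta> \<in> X"
    and m2: "2 \<le> m"
  shows "\<epsilon> < 1" and "linked \<zeta> (n 1) (n (2 * N + 1)) 1 1"
proof -
  have A1': "cond_A1' m q N n \<epsilon> X" using cen by (simp add: strong_center_part_def)
  then have N: "2 \<le> N" and mono: "strict_mono_on {1..2 * N + 2} n" and n1: "1 \<le> n 1"
    and cyc: "\<And>k. k \<in> {1..2 * N} \<Longrightarrow> cycle_ineqs \<epsilon> (cycle_pmax n k \<zeta>)"
    using \<zeta> unfolding cond_A1'_iff by auto
  have n_less: "n k < n (k + 1)" if "k \<in> {1..2 * N}" for k
    using mono that by (auto simp: strict_mono_on_def)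
  have pos: "0 < cycle_pmax n k \<zeta> 1 1 \<and> \<epsilon> < 1" if k: "k \<in> {1..2 * N}" for k
  proof -
    let ?p = "cycle_pmax n k \<zeta>"
    have "?p 1 1 * (1 - \<epsilon>) > ?p 2 2"
      using cyc[OF k] m2 unfolding cycle_ineqs_def by auto
    moreover have "0 \<le> ?p 2 2" "0 \<le> ?p 1 1"
      unfolding cycle_pmax_def using n_less[OF k] m2 by (auto intro!: pmax_nonneg)
    ultimately show ?thesis
      by (metis diff_gt_0_iff_gt less_eq_real_def mult_zero_left order_le_less_trans zero_less_mult_pos)
  qed
  show "\<epsilon> < 1" using pos[of 1] N by auto
  have step: "linked \<zeta> (n k) (n (k + 1)) 1 1" if k: "k \<in> {1..2 * N}" for k
  proof -
    let ?L = "n (k + 1) + 1 - n k" and ?d = "n k - 1"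
    have nk: "1 \<le> n k"
      using n1 strict_mono_onD[OF mono, of 1 k] k by (cases "k = 1") auto
    have "linked (\<lambda>i\<in>{1..?L}. \<zeta> (n k + i - 1)) 1 ?L 1 1"
      using pos[OF k] n_less[OF k] m2 by (subst pmax_pos_iff_linked[symmetric]) (auto simp: cycle_pmax_def)
    also have "?this \<longleftrightarrow> linked (\<lambda>i. \<zeta> (i + ?d)) 1 ?L 1 1"
    proof (rule linked_cong)
      fix i assume "i \<in> {1..?L}"
      then have "n k + i - 1 = i + ?d" using nk by auto
      with \<open>i \<in> {1..?L}\<close> show "(\<lambda>i\<in>{1..?L}. \<zeta> (n k + i - 1)) i = \<zeta> (i + ?d)" by simp
    qed
    also have "\<dots> \<longleftrightarrow> linked \<zeta> (1 + ?d) (?L + ?d) 1 1" by (rule linked_shift)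
    also have "1 + ?d = n k" using nk by simp
    also have "?L + ?d = n (k + 1)" using nk n_less[OF k] by simp
    finally show ?thesis .
  qed
  have "linked \<zeta> (n 1) (n (Suc k)) 1 1 \<and> n 1 \<le> n (Suc k)" if "k \<in> {1..2 * N}" for k
    using that
  proof (induction k)
    case (Suc k)
    show ?case
    proof (cases "k = 0")
      case True
      then show ?thesis using step[of 1] n_less[of 1] N by auto
    next
      case False
      then have "linked \<zeta> (n 1) (n (Suc k)) 1 1" "n 1 \<le> n (Suc k)" using Suc by auto
      moreover have "linked \<zeta> (n (Suc k)) (n (Suc (Suc k))) 1 1" "n (Suc k) < n (Suc (Suc k))"
        using step[of "Suc k"] n_less[of "Suc k"] Suc.prems by auto
      ultimately show ?thesis by (auto intro: linked_trans)
    qed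
  qed simp
  from this[of "2 * N"] N show "linked \<zeta> (n 1) (n (2 * N + 1)) 1 1" by auto
qed

lemma q_bounded_uniformly:
  assumes "\<And>i j. i \<in> {1..m} \<Longrightarrow> j \<in> {1..m} \<Longrightarrow> bounded (range (\<lambda>(x, x'). q (x, i) (x', j)))"
  obtains Q where "1 \<le> Q" "\<And>x x' i j. i \<in> {1..m} \<Longrightarrow> j \<in> {1..m} \<Longrightarrow> q (x, i) (x', j) \<le> Q"
proof -
  have "bounded (\<Union>(i, j)\<in>{1..m} \<times> {1..m}. range (\<lambda>(x, x'). q (x, i) (x', j)))"
    using assms by (intro bounded_UN) auto
  then obtain Q where Q: "\<And>v. v \<in> (\<Union>(i, j)\<in>{1..m} \<times> {1..m}. range (\<lambda>(x, x'). q (x, i) (x', j))) \<Longrightarrow> \<bar>v\<bar> \<le> Q"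
    unfolding bounded_real by blast
  have "q (x, i) (x', j) \<le> max 1 Q" if "i \<in> {1..m}" "j \<in> {1..m}" for x x' i j
  proof -
    have "q (x, i) (x', j) \<in> (\<Union>(i, j)\<in>{1..m} \<times> {1..m}. range (\<lambda>(x, x'). q (x, i) (x', j)))"
      using that by force
    from Q[OF this] show ?thesis by simp
  qed
  with that[of "max 1 Q"] show thesis by auto
qed

text \<open>
  The conditions on a strong center part depend only on the center: a sequence whose window lies in \<open>C\<close>
  has the same blocks as some element of \<open>X\<close>, up to the shift that moves the position \<open>n 1\<close> to 1.
\<close>
lemma strong_center_window:
  assumes cen: "strong_center_part m q N n \<epsilon> X C" and N: "2 \<le> N"
    and \<xi>: "(\<lambda>i\<in>{1..n (2 * N + 1) + 1 - n 1}. \<xi> i) \<in> C"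
  obtains \<zeta> where "\<zeta> \<in> X" "\<xi> 1 = \<zeta> (n 1)"
    "\<And>k. k \<in> {1..2 * N} \<Longrightarrow> cycle_pmax (\<lambda>k. n k - n 1 + 1) k \<xi> = cycle_pmax n k \<zeta>"
proof -
  let ?H = "n (2 * N + 1) + 1 - n 1" and ?s = "\<lambda>k. n k - n 1 + 1"
  have A1': "cond_A1' m q N n \<epsilon> X" and C: "C = slice X (n 1) (n (2 * N + 1))"
    using cen by (simp_all add: strong_center_part_def)
  have mono: "strict_mono_on {1..2 * N + 2} n" and n1: "1 \<le> n 1"
    using A1' unfolding cond_A1'_iff by auto
  obtain \<zeta> where \<zeta>: "\<zeta> \<in> X" "(\<lambda>i\<in>{1..?H}. \<xi> i) = (\<lambda>i\<in>{1..?H}. \<zeta> (n 1 + i - 1))"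
    using \<xi> unfolding C slice_def by auto
  have eq: "\<xi> i = \<zeta> (n 1 + i - 1)" if "i \<in> {1..?H}" for i
    using fun_cong[OF \<zeta>(2), of i] that by simp
  have le: "n 1 \<le> n k" "n k \<le> n (2 * N + 1)" if "k \<in> {1..2 * N + 1}" for k
    using that strict_mono_onD[OF mono, of 1 k] strict_mono_onD[OF mono, of k "2 * N + 1"]
    by (cases "k = 1"; cases "k = 2 * N + 1"; force)+
  have "cycle_pmax ?s k \<xi> = cycle_pmax n k \<zeta>" if k: "k \<in> {1..2 * N}" for k
  proof -
    have nk: "n 1 \<le> n k" "n k < n (k + 1)" "n (k + 1) \<le> n (2 * N + 1)"
      using le[of k] le[of "k + 1"] strict_mono_onD[OF mono, of k "k + 1"] k by auto
    then have len: "?s (k + 1) + 1 - ?s k = n (k + 1) + 1 - n k" by simp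
    show ?thesis
      unfolding cycle_pmax_def len
    proof (rule pmax_cong)
      fix i assume i: "i \<in> {1..n (k + 1) + 1 - n k}"
      then have "?s k + i - 1 \<in> {1..?H}" using nk by auto
      then have "\<xi> (?s k + i - 1) = \<zeta> (n 1 + (?s k + i - 1) - 1)" by (rule eq)
      also have "n 1 + (?s k + i - 1) - 1 = n k + i - 1" using i nk by auto
      finally show "(\<lambda>i\<in>{1..n (k + 1) + 1 - n k}. \<xi> (?s k + i - 1)) i =
          (\<lambda>i\<in>{1..n (k + 1) + 1 - n k}. \<zeta> (n k + i - 1)) i"
        using i by simp
    qed
  qed
  moreover have "\<xi> 1 = \<zeta> (n 1)" using eq[of 1] le(1)[of "2 * N + 1"] by simp
  ultimately show thesis using that \<zeta>(1) by blast
qed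

lemma entrance_mono: "entrance n \<delta> x \<Longrightarrow> \<delta>' \<le> \<delta> \<Longrightarrow> entrance n \<delta>' x"
  unfolding entrance_def by (meson order_trans)

lemma departure_mono: "departure n \<delta> x \<Longrightarrow> \<delta>' \<le> \<delta> \<Longrightarrow> departure n \<delta>' x"
  unfolding departure_def by (meson order_trans)

lemma infinite_walk:
  assumes "z \<in> space S"
  obtains w :: "nat \<Rightarrow> 'x \<times> nat" where "w 1 = z" "\<And>k. w k \<in> space S" "\<And>k. 1 \<le> k \<Longrightarrow> 0 < q (w (Suc k)) (w k)"
proof -
  obtain nxt where nxt: "\<And>z. z \<in> space S \<Longrightarrow> nxt z \<in> space S \<and> 0 < q (nxt z) z"
    using bchoice[of "space S" "\<lambda>z w. w \<in> space S \<and> 0 < q w z"] successor_exists by blast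
  define w where "w k = (nxt ^^ k) z" for k
  have wS: "w k \<in> space S" for k
    by (induction k) (use assms nxt in \<open>auto simp: w_def\<close>)
  have w: "w k \<in> space S" "w 0 = z" "0 < q (w (Suc k)) (w k)" for k
    using wS[of k] nxt[OF wS[of k]] by (simp_all add: w_def)
  show thesis
  proof (rule that[of "\<lambda>k. w (k - 1)"])
    show "0 < q (w (Suc k - 1)) (w (k - 1))" if "1 \<le> k" for k
      using w(3)[of "k - 1"] that by simp
  qed (use w in auto)
qed

lemma single_label_box:
  assumes m1: "m = 1" and link: "linked x 1 2 1 1"
  obtains U \<delta> where "0 < \<delta>" "\<forall>k. open (U k) \<and> x k \<in> U k"
    "\<forall>\<xi>. (\<forall>k\<in>{1..2}. \<xi> k \<in> U k) \<longrightarrow> entrance 2 \<delta> \<xi> \<and> departure 2 \<delta> \<xi>"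
proof -
  obtain \<delta> where \<delta>: "0 < \<delta>" "\<forall>\<^sub>F \<xi> in nhds x. \<delta> \<le> pmax m q 2 \<xi> 1 1"
    using linked_stable[OF link] by auto
  have ev: "\<forall>\<^sub>F \<xi> in nhds x. entrance 2 \<delta> \<xi> \<and> departure 2 \<delta> \<xi>"
    using \<delta>(2)
  proof eventually_elim
    case (elim \<xi>)
    then have "Yplus m q 2 \<xi> = {(1, 1)}" using \<delta>(1) m1 by (auto simp: Yplus_def)
    with elim show ?case by (simp add: entrance_def departure_def)
  qed
  have local: "entrance 2 \<delta> \<xi>' \<and> departure 2 \<delta> \<xi>'"
    if "\<And>k. k \<in> {1..2} \<Longrightarrow> \<xi> k = \<xi>' k" "entrance 2 \<delta> \<xi> \<and> departure 2 \<delta> \<xi>" for \<xi> \<xi>'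
    using entrance_cong[of 2 \<xi> \<xi>' \<delta>] departure_cong[of 2 \<xi> \<xi>' \<delta>] that by simp
  have "\<exists>U. (\<forall>k. open (U k)) \<and> (\<forall>k. x k \<in> U k) \<and> (\<forall>\<xi>. (\<forall>k\<in>{1..2}. \<xi> k \<in> U k) \<longrightarrow> entrance 2 \<delta> \<xi> \<and> departure 2 \<delta> \<xi>)"
    by (rule eventually_nhds_box[where I="{1..2}", OF ev]) (rule local)
  then obtain U where U: "\<forall>k. open (U k)" "\<forall>k. x k \<in> U k"
    "\<forall>\<xi>. (\<forall>k\<in>{1..2}. \<xi> k \<in> U k) \<longrightarrow> entrance 2 \<delta> \<xi> \<and> departure 2 \<delta> \<xi>"
    by (elim exE conjE)
  with \<delta>(1) show thesis by (intro that[of \<delta> U]) simp_all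
qed

text \<open>
  With a single label the inequalities of a cycle are vacuous, also for \<open>\<epsilon> = 1\<close>, but for the same reason
  a given strong center part may have density zero. Any walk with positive density, cut into pieces of
  one step, serves instead; one exists because a probability density is positive somewhere.
\<close>
lemma barrier_exists_single_label:
  assumes m1: "m = 1" and reach: "reachable \<mu> m q z"
    and Q: "1 \<le> Q" "\<And>x x' i j. i \<in> {1..m} \<Longrightarrow> j \<in> {1..m} \<Longrightarrow> q (x, i) (x', j) \<le> Q"
  shows barrier_exists
proof -
  have "z \<in> space S" using reach by (simp add: reachable_def)
  then obtain w where w: "w 1 = z" "\<And>k. w k \<in> space S" "\<And>k. 1 \<le> k \<Longrightarrow> 0 < q (w (Suc k)) (w k)"
    using infinite_walk by blast
  define x where "x k = fst (w k)" for k
  have w_eq: "w k = (x k, 1)" for k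
  proof -
    have "w k \<in> UNIV \<times> {1..m}" using w(2)[of k] by (simp only: space_S)
    then show ?thesis using m1 by (auto simp: x_def)
  qed
  have link: "linked (\<lambda>k. x (k + d)) 1 b 1 1" if "1 \<le> b" for b d
    unfolding linked_shift linked_def
  proof (intro exI[of _ "\<lambda>_. 1"] conjI ballI)
    fix k assume "k \<in> {1 + d<..b + d}"
    then have "1 \<le> k - 1" "Suc (k - 1) = k" by auto
    then show "0 < q (x k, 1) (x (k - 1), 1)"
      using w(3)[of "k - 1"] by (simp only: w_eq)
  qed (use m1 in auto)
  have link0: "linked x 1 2 1 1" and link5: "linked (\<lambda>k. x (k + 5)) 1 2 1 1"
    using link[of 2 0] link[of 2 5] by simp_all
  obtain F \<delta>1 where F: "0 < \<delta>1" "\<forall>k. open (F k) \<and> x k \<in> F k"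
    "\<forall>\<xi>. (\<forall>k\<in>{1..2}. \<xi> k \<in> F k) \<longrightarrow> entrance 2 \<delta>1 \<xi> \<and> departure 2 \<delta>1 \<xi>"
    using single_label_box[OF m1 link0] .
  obtain B \<delta>2 where B: "0 < \<delta>2" "\<forall>k. open (B k) \<and> x (k + 5) \<in> B k"
    "\<forall>\<xi>. (\<forall>k\<in>{1..2}. \<xi> k \<in> B k) \<longrightarrow> entrance 2 \<delta>2 \<xi> \<and> departure 2 \<delta>2 \<xi>"
    using single_label_box[OF m1 link5] .
  have trivial: "cycle_ineqs 1 p" "strict_entry p" for p
    unfolding cycle_ineqs_def strict_entry_def unfolding m1 by auto
  let ?\<delta> = "min \<delta>1 \<delta>2"
  show ?thesis
  proof (rule barrier_assembly[where f=x and n=2 and ?i0.0=1 and F=F and \<delta>="?\<delta>" and N=2 and \<epsilon>=1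
        and s="\<lambda>k. k" and h=4 and c="\<lambda>k. x (k + 1)" and C="\<lambda>_. UNIV" and L=2
        and b="\<lambda>k. x (k + 5)" and B=B and \<Delta>="?\<delta> + Q" and Q=Q])
    show "reachable \<mu> m q (x 1, 1)" using reach unfolding w(1)[symmetric] w_eq .
    show "linked x 1 2 1 1" by (rule link0)
    show "entrance 2 ?\<delta> \<xi>" if "\<And>k. k \<in> {1..2} \<Longrightarrow> \<xi> k \<in> F k" for \<xi>
    proof -
      have "entrance 2 \<delta>1 \<xi>" using F(3) that by blast
      then show ?thesis by (rule entrance_mono) simp
    qed
    show "departure 2 ?\<delta> \<xi>" if "\<And>k. k \<in> {1..2} \<Longrightarrow> \<xi> k \<in> B k" for \<xi>
    proof -
      have "departure 2 \<delta>2 \<xi>" using B(3) that by blast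
      then show ?thesis by (rule departure_mono) simp
    qed
    show "linked (\<lambda>k. x (k + 1)) 1 (4 + 1) 1 1" by (rule link) simp
    show "x (1 + 1) = x 2" unfolding one_add_one ..
    show "strict_mono_on {1..2 * 2 + 1} (\<lambda>k::nat. k)" by (auto intro: strict_mono_onI)
  qed (use Q F B trivial in \<open>auto simp: add.commute[of _ 5]\<close>)
qed

text \<open>
  The bounds \<open>\<delta>\<close> and \<open>\<Delta>\<close> have to be fixed before the number \<open>N\<close> of cycles that makes A3 hold, while the
  center, and with it the point at which the final part begins, depends on \<open>N\<close>. Compactness resolves
  this: finitely many final parts, chosen beforehand, cover all points at which the center can end.
\<close>
lemma barrier_exists_several_labels:
  assumes m2: "2 \<le> m" and B1: "cond_B1 \<mu> m q" and B2: "cond_B2 \<mu> m q"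
    and Q: "1 \<le> Q" "\<And>x x' i j. i \<in> {1..m} \<Longrightarrow> j \<in> {1..m} \<Longrightarrow> q (x, i) (x', j) \<le> Q"
  shows barrier_exists
proof -
  obtain l E Yp xE i0 where l: "2 \<le> l" and E: "openin (power_topology l) E"
    and Yp: "\<forall>x\<in>E. Yplus m q l x = Yp" and rect: "\<forall>i\<in>fst ` Yp. \<forall>j\<in>snd ` Yp. (i, j) \<in> Yp"
    and xE: "xE \<in> coord E 1" and i0: "i0 \<in> fst ` Yp" and reachE: "reachable \<mu> m q (xE, i0)"
    using B1 unfolding cond_B1_def by blast
  obtain e where e: "e \<in> E" "xE = e 1" using xE unfolding coord_def by blast
  obtain \<epsilon> T K0 xs where K0: "compact K0"
    and cen: "\<forall>N\<ge>2. \<exists>n X C. strong_center_part m q N n \<epsilon> X C \<and>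
        openin (power_topology (n (2 * N + 1) + 1 - n 1)) C \<and> C \<noteq> {} \<and>
        coord X (n 1) = T \<and> coord X (n (2 * N + 1)) \<subseteq> K0"
    and xs: "xs \<in> T" "reachable \<mu> m q (xs, 1)"
    using B2 unfolding cond_B2_def by blast

  have center_le: "n 1 < n (2 * N + 1)"
    if "strong_center_part m q N n \<epsilon> X C" for N n X C
    using that unfolding strong_center_part_def cond_A1'_iff
    by (auto elim!: strict_mono_onD)
  have center_window: "(\<lambda>i\<in>{1..n (2 * N + 1) + 1 - n 1}. \<zeta> (n 1 + i - 1)) \<in> C"
    if "strong_center_part m q N n \<epsilon> X C" "\<zeta> \<in> X" for N n X C \<zeta>
    using that unfolding strong_center_part_def slice_def by blast

  \<comment> \<open>\<open>T\<close> is a neighbourhood of \<open>xs\<close>, as a projection of an open set\<close>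
  have "\<epsilon> < 1 \<and> 0 < \<epsilon> \<and> (\<exists>V. open V \<and> xs \<in> V \<and> V \<subseteq> T)"
  proof -
    obtain n X C where C: "strong_center_part m q 2 n \<epsilon> X C"
        "openin (power_topology (n 5 + 1 - n 1)) C" "coord X (n 1) = T"
      using cen[rule_format, of 2] by auto
    obtain \<zeta> where \<zeta>: "\<zeta> \<in> X" "xs = \<zeta> (n 1)" using xs(1) C(3) unfolding coord_def by blast
    have \<epsilon>: "\<epsilon> < 1" using strong_center_cycles(1)[OF C(1) \<zeta>(1) m2] .
    have "0 < \<epsilon>" using C(1) unfolding strong_center_part_def cond_A1'_iff by blast
    let ?H = "n 5 + 1 - n 1"
    define c where "c = (\<lambda>i\<in>{1..?H}. \<zeta> (n 1 + i - 1))"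
    have H: "1 \<in> {1..?H}" using center_le[OF C(1)] by simp
    have "c \<in> C" using center_window[OF C(1) \<zeta>(1)] by (simp add: c_def)
    obtain U where U: "\<And>i. i \<in> {1..?H} \<Longrightarrow> open (U i)" "\<And>i. i \<in> {1..?H} \<Longrightarrow> c i \<in> U i" "PiE {1..?H} U \<subseteq> C"
      using power_topology_box[OF C(2) \<open>c \<in> C\<close>] by blast
    have "u \<in> T" if "u \<in> U 1" for u
    proof -
      have "(\<lambda>i\<in>{1..?H}. (c(1 := u)) i) \<in> C"
        using U(2) that H by (intro subsetD[OF U(3)]) auto
      then have "(\<lambda>i\<in>{1..n (2 * 2 + 1) + 1 - n 1}. (c(1 := u)) i) \<in> C" by simp
      from strong_center_window[OF C(1) order.refl this] obtain \<zeta>' where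
        "\<zeta>' \<in> X" "(c(1 := u)) 1 = \<zeta>' (n 1)" .
      then have "u \<in> coord X (n 1)" unfolding coord_def by (metis fun_upd_same image_eqI)
      then show ?thesis using C(3) by simp
    qed
    moreover have "xs \<in> U 1" using U(2)[OF H] H \<zeta>(2) by (simp add: c_def)
    ultimately show ?thesis using \<epsilon> \<open>0 < \<epsilon>\<close> U(1)[OF H] by blast
  qed
  then obtain V where \<epsilon>: "0 < \<epsilon>" "\<epsilon> < 1" and V: "open V" "xs \<in> V" "V \<subseteq> T" by blast

  obtain n0 f F \<delta>1 where f: "2 \<le> n0" "f 1 = e 1" "f n0 \<in> V" "linked f 1 n0 i0 1" "0 < \<delta>1"
      "\<forall>k. open (F k) \<and> f k \<in> F k" "\<forall>\<xi>. (\<forall>k\<in>{1..n0}. \<xi> k \<in> F k) \<longrightarrow> entrance n0 \<delta>1 \<xi>"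
    using entrance_exists[OF l E Yp[rule_format] rect[rule_format] e(1) i0 xs(2) V(1,2)] .
  note F = f(6,7)

  define good where "good x n b B \<delta> \<longleftrightarrow> 2 \<le> n \<and> b 1 = x \<and> 0 < \<delta> \<and> (\<forall>k. open (B k) \<and> b k \<in> B k) \<and>
    (\<forall>\<xi>. (\<forall>k\<in>{1..n}. \<xi> k \<in> B k) \<longrightarrow> departure n \<delta> \<xi>)"
    for x n and b :: "nat \<Rightarrow> 'x" and B :: "nat \<Rightarrow> 'x set" and \<delta> :: real
  have "\<forall>x. \<exists>n b B \<delta>. good x n b B \<delta>"
  proof
    fix x
    obtain n b B \<delta> where "2 \<le> n" "b 1 = x" "0 < \<delta>"
      "\<forall>k. open (B k) \<and> b k \<in> B k" "\<forall>\<xi>. (\<forall>k\<in>{1..n}. \<xi> k \<in> B k) \<longrightarrow> departure n \<delta> \<xi>"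
      using departure_exists[OF l E Yp[rule_format] rect[rule_format] e(1) i0 reachE[unfolded e(2)]] .
    then have "good x n b B \<delta>" unfolding good_def by blast
    then show "\<exists>n b B \<delta>. good x n b B \<delta>" by blast
  qed
  then obtain nf bf Bf \<delta>f where good: "\<And>x. good x (nf x) (bf x) (Bf x) (\<delta>f x)" by metis
  have nbhd: "open (Bf x 1)" "x \<in> Bf x 1" for x
    using good[of x] unfolding good_def by metis+
  \<comment> \<open>finitely many final parts suffice, whatever the end point of the center\<close>
  obtain D where D: "D \<subseteq> K0" "finite D" "K0 \<subseteq> (\<Union>x\<in>D. Bf x 1)"
    using compactE_image[OF K0, of K0 "\<lambda>x. Bf x 1"] nbhd by blast

  define \<delta> where "\<delta> = Min (insert \<delta>1 (\<delta>f ` D))"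
  \<comment> \<open>\<open>P\<close> bounds the lengths of the initial part and of all final parts in use\<close>
  define P where "P = n0 + (\<Sum>x\<in>D. nf x)"
  define \<Delta> where "\<Delta> = \<delta> + Q ^ P"
  have \<delta>: "0 < \<delta>" "\<delta> \<le> \<delta>1" "\<And>x. x \<in> D \<Longrightarrow> \<delta> \<le> \<delta>f x"
    unfolding \<delta>_def using D(2) f(5) good by (auto simp: good_def)
  have QP: "Q ^ k \<le> \<Delta>" if "k \<le> P" for k
    using power_increasing[OF that Q(1)] \<delta>(1) by (simp add: \<Delta>_def)
  have \<delta>\<Delta>: "\<delta> \<le> \<Delta>" using Q(1) by (simp add: \<Delta>_def)
  obtain k where k: "(1 - \<epsilon>) ^ k < \<delta> / \<Delta>"
    using real_arch_pow_inv[of "\<delta> / \<Delta>" "1 - \<epsilon>"] \<delta>(1) \<delta>\<Delta> \<epsilon> by auto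
  define N where "N = k + 2"
  have "(1 - \<epsilon>) ^ N \<le> (1 - \<epsilon>) ^ k"
    unfolding N_def using \<epsilon> by (intro power_decreasing) auto
  with k have "(1 - \<epsilon>) ^ N < \<delta> / \<Delta>" by linarith
  then have A3: "\<Delta> / \<delta> * (1 - \<epsilon>) ^ N < 1"
    using \<delta>(1) \<delta>\<Delta> by (simp add: field_simps)

  have "2 \<le> N" by (simp add: N_def)
  then obtain n X C where C: "strong_center_part m q N n \<epsilon> X C"
      "openin (power_topology (n (2 * N + 1) + 1 - n 1)) C" "coord X (n 1) = T"
      "coord X (n (2 * N + 1)) \<subseteq> K0"
    using cen by blast
  have A1': "cond_A1' m q N n \<epsilon> X" using C(1) by (simp add: strong_center_part_def)
  have mono: "strict_mono_on {1..2 * N + 2} n" and n1: "1 \<le> n 1"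
    and cycles: "\<And>k \<zeta>. k \<in> {1..2 * N} \<Longrightarrow> \<zeta> \<in> X \<Longrightarrow> cycle_ineqs \<epsilon> (cycle_pmax n k \<zeta>)"
    and strict: "(\<forall>k\<in>{1..2 * N}. \<forall>x\<in>X. strict_entry (cycle_pmax n k x)) \<or>
      (\<forall>k\<in>{1..2 * N}. \<forall>x\<in>X. strict_exit (cycle_pmax n k x))"
    using A1' unfolding cond_A1'_iff by blast+
  obtain \<zeta> where \<zeta>: "\<zeta> \<in> X" "f n0 = \<zeta> (n 1)"
    using f(3) V(3) C(3) unfolding coord_def by blast
  define h where "h = n (2 * N + 1) - n 1"
  have n_le: "n 1 < n (2 * N + 1)" using center_le[OF C(1)] .
  then have h: "n (2 * N + 1) + 1 - n 1 = h + 1" by (simp add: h_def)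
  define c where "c i = \<zeta> (i + (n 1 - 1))" for i
  have "(\<lambda>i\<in>{1..h + 1}. c i) = (\<lambda>i\<in>{1..h + 1}. \<zeta> (n 1 + i - 1))"
    using n1 by (intro restrict_ext) (simp add: c_def add.commute)
  then have cC: "(\<lambda>i\<in>{1..h + 1}. c i) \<in> C"
    using center_window[OF C(1) \<zeta>(1)] unfolding h by simp
  obtain U where Uc: "\<And>i. i \<in> {1..h + 1} \<Longrightarrow> open (U i)"
      "\<And>i. i \<in> {1..h + 1} \<Longrightarrow> (\<lambda>i\<in>{1..h + 1}. c i) i \<in> U i" "PiE {1..h + 1} U \<subseteq> C"
    using power_topology_box[OF C(2)[unfolded h] cC] by blast
  have "c i \<in> U i" if "i \<in> {1..h + 1}" for i using Uc(2)[OF that] that by simp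
  note U = Uc(1) this Uc(3)
  define s where "s = (\<lambda>k. n k - n 1 + 1)"
  have transfer: "\<exists>\<zeta>\<in>X. \<forall>k\<in>{1..2 * N}. cycle_pmax s k \<xi> = cycle_pmax n k \<zeta>"
    if "\<forall>k\<in>{1..h + 1}. \<xi> k \<in> U k" for \<xi>
  proof -
    have "(\<lambda>i\<in>{1..h + 1}. \<xi> i) \<in> C" using that by (intro subsetD[OF U(3)]) auto
    then show ?thesis
    proof (rule strong_center_window[OF C(1) \<open>2 \<le> N\<close>, unfolded h])
      fix \<zeta> assume "\<zeta> \<in> X"
        and "\<And>k. k \<in> {1..2 * N} \<Longrightarrow> cycle_pmax (\<lambda>k. n k - n 1 + 1) k \<xi> = cycle_pmax n k \<zeta>"
      then show ?thesis unfolding s_def by (intro bexI[of _ \<zeta>]) simp_all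
    qed
  qed

  have c_end: "c (h + 1) = \<zeta> (n (2 * N + 1))" using n1 n_le by (simp add: c_def h_def)
  then have "c (h + 1) \<in> K0" using C(4) \<zeta>(1) unfolding coord_def by auto
  then obtain t where t: "t \<in> D" "c (h + 1) \<in> Bf t 1" using D(3) by blast
  note gt = good[of t, unfolded good_def]

  show ?thesis
  proof (rule barrier_assembly[where Q=Q and n=n0 and f=f and ?i0.0=i0 and F=F and \<delta>=\<delta> and N=N
        and \<epsilon>=\<epsilon> and s=s and h=h and c=c and C=U and L="nf t" and b="(bf t)(1 := c (h + 1))"
        and B="Bf t" and \<Delta>=\<Delta>])
    show "reachable \<mu> m q (f 1, i0)" using reachE f(2) e(2) by simp
    show "entrance n0 \<delta> \<xi>" if "\<And>k. k \<in> {1..n0} \<Longrightarrow> \<xi> k \<in> F k" for \<xi>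
    proof -
      have "entrance n0 \<delta>1 \<xi>" using F(2) that by blast
      then show ?thesis using \<delta>(2) by (rule entrance_mono)
    qed
    show "s 1 = 1" "s (2 * N + 1) = h + 1" by (simp_all add: s_def h_def)
    show "strict_mono_on {1..2 * N + 1} s"
    proof (rule strict_mono_onI)
      fix k l assume "k \<in> {1..2 * N + 1}" "l \<in> {1..2 * N + 1}" "k < l"
      then show "s k < s l"
        using strict_mono_onD[OF mono, of k l] strict_mono_onD[OF mono, of 1 k]
        by (cases "k = 1") (auto simp: s_def)
    qed
    show "c 1 = f n0" using \<zeta>(2) n1 by (simp add: c_def)
    show "linked c 1 (h + 1) 1 1"
    proof -
      have "1 + (n 1 - 1) = n 1" "h + 1 + (n 1 - 1) = n (2 * N + 1)"
        using n1 n_le by (auto simp: h_def)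
      then show ?thesis
        using strong_center_cycles(2)[OF C(1) \<zeta>(1) m2] unfolding c_def linked_shift by (simp only:)
    qed
    show "cycle_ineqs \<epsilon> (cycle_pmax s k \<xi>)"
      if "\<And>k. k \<in> {1..h + 1} \<Longrightarrow> \<xi> k \<in> U k" "k \<in> {1..2 * N}" for \<xi> k
      using transfer[of \<xi>] cycles[OF that(2)] that by metis
    show "(\<forall>\<xi>. (\<forall>k\<in>{1..h + 1}. \<xi> k \<in> U k) \<longrightarrow> (\<forall>k\<in>{1..2 * N}. strict_entry (cycle_pmax s k \<xi>))) \<or>
      (\<forall>\<xi>. (\<forall>k\<in>{1..h + 1}. \<xi> k \<in> U k) \<longrightarrow> (\<forall>k\<in>{1..2 * N}. strict_exit (cycle_pmax s k \<xi>)))"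
      using strict
    proof
      assume "\<forall>k\<in>{1..2 * N}. \<forall>x\<in>X. strict_entry (cycle_pmax n k x)"
      then show ?thesis using transfer by metis
    next
      assume "\<forall>k\<in>{1..2 * N}. \<forall>x\<in>X. strict_exit (cycle_pmax n k x)"
      then show ?thesis using transfer by metis
    qed
    show "((bf t)(1 := c (h + 1))) k \<in> Bf t k" for k
      using t(2) gt by (cases "k = 1") auto
    show "departure (nf t) \<delta> \<xi>" if "\<And>k. k \<in> {1..nf t} \<Longrightarrow> \<xi> k \<in> Bf t k" for \<xi>
    proof -
      have "departure (nf t) (\<delta>f t) \<xi>" using gt that by blast
      then show ?thesis using \<delta>(3)[OF t(1)] by (rule departure_mono)
    qed
    show "Q ^ (n0 - 1) \<le> \<Delta>" by (rule QP) (simp add: P_def)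
    have "nf t \<le> (\<Sum>x\<in>D. nf x)" using D(2) t(1) by (intro member_le_sum) auto
    then show "Q ^ (nf t - 1) \<le> \<Delta>" by (intro QP) (simp add: P_def)
  qed (use Q f F \<epsilon> \<delta> \<delta>\<Delta> A3 U gt \<open>2 \<le> N\<close> in simp_all)
qed

end

section \<open>Existence of barriers and their recurrence\<close>

theorem theorem3p1:
  fixes \<Omega> :: "'w measure"
    and \<mu> :: "'x::{metric_space, second_countable_topology} measure"
    and m :: nat
    and q :: "'x \<times> nat \<Rightarrow> 'x \<times> nat \<Rightarrow> real"
    and Z :: "nat \<Rightarrow> 'w \<Rightarrow> 'x \<times> nat"
  assumes model: "pairwise_markov_model \<Omega> \<mu> m q Z"
    and mu_pos: "strictly_positive_measure \<mu>"
    and q_lsc: "\<And>i j. i \<in> {1..m} \<Longrightarrow> j \<in> {1..m} \<Longrightarrow>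
      lower_semicontinuous (\<lambda>(x, x'). q (x, i) (x', j))"
    and q_bdd: "\<And>i j. i \<in> {1..m} \<Longrightarrow> j \<in> {1..m} \<Longrightarrow>
      bounded (range (\<lambda>(x, x'). q (x, i) (x', j)))"
    and B1: "cond_B1 \<mu> m q"
    and B2: "cond_B2 \<mu> m q"
  shows "\<exists>N n \<epsilon> \<delta> \<Delta> Xs.
    Xs \<noteq> {} \<and> cond_A1' m q N n \<epsilon> Xs \<and> cond_A2 m q N n \<delta> \<Delta> Xs \<and> cond_A3 N \<epsilon> \<delta> \<Delta> \<and>
    (harris_recurrent \<mu> m q \<longrightarrow> measure \<Omega> (io_event \<Omega> Z (n (2 * N + 2)) Xs) = 1)"
proof -
  interpret pairwise_markov_model \<Omega> \<mu> m q Z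
    by (rule model)
  interpret lsc_pairwise_markov_model \<Omega> \<mu> m q Z
    by unfold_locales (use mu_pos q_lsc in auto)
  obtain Q where Q: "1 \<le> Q" "\<And>x x' i j. i \<in> {1..m} \<Longrightarrow> j \<in> {1..m} \<Longrightarrow> q (x, i) (x', j) \<le> Q"
    using q_bounded_uniformly[OF q_bdd] by blast
  have barrier_exists
  proof (cases "m = 1")
    case True
    obtain z where "reachable \<mu> m q z" using B1 unfolding cond_B1_def by blast
    with True show ?thesis using Q by (rule barrier_exists_single_label)
  next
    case False
    with m_pos have "2 \<le> m" by simp
    then show ?thesis using B1 B2 Q by (rule barrier_exists_several_labels)
  qed
  then show ?thesis
    unfolding barrier_exists_def .
qed

end
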